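(* Let $\mathbf{S}_0$ be the $2$-adic Banach space of $2^{-1/2}$-overconvergent cuspidal $2$-adic modular forms of weight $0$ and tame level $1$ over $\mathbf{Q}_2$, with its compact operator $U=U_2$. Let $D$ be the infinite diagonal matrix $(d_{i,j})_{i,j\ge1}$ with diagonal entries $$d_{j,j}=\frac{2^{4j+1}\,(3j)!^2\,j!^2}{3\cdot(2j)!^4},\qquad j\ge1.$$ Then the ($2$-adic) Newton polygons of $\det(1-XU)$ on $\mathbf{S}_0$ and of $\det(1-XD)$ coincide.
   Context: Let $\Delta(\tau)=q\prod_{n\ge1}(1-q^n)^{24}$, $q=e^{2\pi i\tau}$, $f(\tau)=\Delta(2\tau)/\Delta(\tau)=q+24q^2+\cdots$ and $g=2^6f$. The space $\mathbf{M}_0$ of $2^{-1/2}$-overconvergent $2$-adic modular forms of weight $0$ and tame level $1$ is the Banach space (with supremum norm) of rigid analytic functions over $\mathbf{Q}_2$ on the affinoid $X_0(1)_{\ge 2^{-1/2}}$ of the level one modular curve obtained by removing the open disc of radius $2^{-1/2}$ (in the sense of a suitable local parameter after adding auxiliary level structure) over the supersingular point. Concretely this affinoid is the region $\{|j|\ge 2^{-6}\}$ of the $j$-line, and it is identified (preserving $q$-expansions) with the region $\{|g|\le 1\}$ of $X_0(2)$; thus $\mathbf{M}_0$ is the space of series $\sum_{n\ge0}a_ng^n$ with $a_n\in\mathbf{Q}_2$, $a_n\to0$, with norm $\max_n|a_n|$. The subspace $\mathbf{S}_0=\mathbf{S}_0(\mathrm{SL}_2(\mathbf{Z});\mathbf{Q}_2;2^{-1/2})$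 consists of the elements whose $q$-expansion has zero constant term, i.e. the series $\sum_{n\ge1}a_ng^n$ with $a_n\to 0$. The operator $U$ acts on $q$-expansions by $U(\sum a_nq^n)=\sum a_{2n}q^n$; it is a compact operator on $\mathbf{M}_0$ preserving $\mathbf{S}_0$. For a compact operator, $\det(1-X\,\cdot)\in\mathbf{Q}_2[[X]]$ denotes its characteristic (Fredholm) power series in the sense of Serre; the matrix $D$ defines a compact operator on $\mathbf{S}_0$ by $g^j\mapsto d_{j,j}g^j$, and $\det(1-XD)=\prod_{j\ge1}(1-d_{j,j}X)$. The Newton polygon of a power series $1+\sum_{n\ge1} c_nX^n$ is the lower convex hull of the points $(0,0)$ and $(n,v_2(c_n))$, where $v_2$ is the $2$-adic valuation with $v_2(2)=1$. *)

theory Defs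
  imports "HOL-Analysis.Analysis"
begin

section \<open>The 2-adic absolute value on the rationals\<close>

definition abs2 :: "rat \<Rightarrow> real" where
  "abs2 x = (if x = 0 then 0 else
     2 powi (int (multiplicity 2 (snd (quotient_of x))) - int (multiplicity 2 (fst (quotient_of x)))))"

lemma abs2_0 [simp]: "abs2 0 = 0"
  by (simp add: abs2_def)

lemma abs2_quot:
  fixes a b :: int
  assumes "a \<noteq> 0" "b \<noteq> 0"
  shows "abs2 (of_int a / of_int b) = 2 powi (int (multiplicity 2 b) - int (multiplicity 2 a))"
proof -
  obtain c d where q: "quotient_of (of_int a / of_int b) = (c, d)" by (cases "quotient_of (of_int a / of_int b)")
  have d: "d > 0" using quotient_of_denom_pos[OF q] .
  have e: "(of_int a / of_int b :: rat) = of_int c / of_int d" using quotient_of_div[OF q] .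
  have c: "c \<noteq> 0" using e assms d by auto
  have "(of_int (a * d) :: rat) = of_int (c * b)"
    using e assms d by (simp add: field_simps)
  then have "a * d = c * b" by (simp only: of_int_eq_iff)
  then have "multiplicity 2 (a * d) = multiplicity 2 (c * b)" by simp
  then have "multiplicity 2 a + multiplicity 2 d = multiplicity 2 c + multiplicity 2 b"
    using assms c d by (simp add: prime_elem_multiplicity_mult_distrib)
  then have "int (multiplicity 2 b) - int (multiplicity 2 a) = int (multiplicity 2 d) - int (multiplicity 2 c)"
    by linarith
  then show ?thesis using assms q by (simp add: abs2_def)
qed

lemma rat_quotE:
  fixes x :: rat
  obtains a b :: int where "x = of_int a / of_int b" "b \<noteq> 0"
  by (metis Fract_of_int_quotient Rat_cases less_irrefl)

lemma abs2_nonneg [simp]: "abs2 x \<ge> 0"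
  by (simp add: abs2_def)

lemma abs2_eq_0_iff [simp]: "abs2 x = 0 \<longleftrightarrow> x = 0"
  by (simp add: abs2_def)

lemma abs2_mult: "abs2 (x * y) = abs2 x * abs2 y"
proof (cases "x = 0 \<or> y = 0")
  case False
  obtain a b where x: "x = of_int a / of_int b" "b \<noteq> 0" by (rule rat_quotE)
  obtain c d where y: "y = of_int c / of_int d" "d \<noteq> 0" by (rule rat_quotE)
  have ac: "a \<noteq> 0" "c \<noteq> 0" using x y False by auto
  have xy: "x * y = of_int (a * c) / of_int (b * d)" using x y by simp
  have "abs2 (x * y) = 2 powi (int (multiplicity 2 (b * d)) - int (multiplicity 2 (a * c)))"
    unfolding xy using ac x y by (intro abs2_quot) auto
  also have "\<dots> = 2 powi ((int (multiplicity 2 b) - int (multiplicity 2 a)) + (int (multiplicity 2 d) - int (multiplicity 2 c)))"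
    using ac x y by (simp add: prime_elem_multiplicity_mult_distrib algebra_simps)
  also have "\<dots> = abs2 x * abs2 y"
    using ac x y by (simp add: power_int_add abs2_quot)
  finally show ?thesis .
qed auto

lemma abs2_1 [simp]: "abs2 1 = 1"
  using abs2_quot[of 1 1] by simp

lemma abs2_minus [simp]: "abs2 (- x) = abs2 x"
proof -
  have "abs2 (- 1) = 1" using abs2_quot[of "- 1" 1] by (simp add: multiplicity_unit_right)
  then show ?thesis using abs2_mult[of "- 1" x] by simp
qed

lemma abs2_minus_commute: "abs2 (x - y) = abs2 (y - x)"
  using abs2_minus[of "x - y"] by simp

lemma abs2_inverse: "abs2 (inverse x) = inverse (abs2 x)"
proof (cases "x = 0")
  case False
  then have "abs2 x * abs2 (inverse x) = 1" by (simp flip: abs2_mult)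
  then show ?thesis by (simp add: inverse_unique)
qed auto

lemma abs2_ultra: "abs2 (x + y) \<le> max (abs2 x) (abs2 y)"
proof (cases "x = 0 \<or> y = 0 \<or> x + y = 0")
  case False
  obtain a b where x: "x = of_int a / of_int b" "b \<noteq> 0" by (rule rat_quotE)
  obtain c d where y: "y = of_int c / of_int d" "d \<noteq> 0" by (rule rat_quotE)
  define A where "A = a * d"
  define C where "C = c * b"
  define B where "B = b * d"
  have x': "x = of_int A / of_int B" and y': "y = of_int C / of_int B" and B: "B \<noteq> 0"
    using x y by (auto simp: A_def B_def C_def)
  have AC: "A \<noteq> 0" "C \<noteq> 0" using x' y' False by auto
  have s: "x + y = of_int (A + C) / of_int B" by (simp add: x' y' add_divide_distrib)
  have S: "A + C \<noteq> 0" using s False by (metis div_0 of_int_0)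
  define k where "k = min (multiplicity 2 A) (multiplicity 2 C)"
  have "2 ^ k dvd A" "2 ^ k dvd C" by (auto simp: k_def intro!: multiplicity_dvd')
  then have "2 ^ k dvd A + C" by simp
  then have "k \<le> multiplicity 2 (A + C)"
    using S by (intro multiplicity_geI) auto
  then have *: "int (multiplicity 2 B) - int (multiplicity 2 (A + C)) \<le> int (multiplicity 2 B) - int k" by simp
  have "abs2 (x + y) = 2 powi (int (multiplicity 2 B) - int (multiplicity 2 (A + C)))"
    unfolding s using S B by (rule abs2_quot)
  also have "\<dots> \<le> 2 powi (int (multiplicity 2 B) - int k)"
    using * by (intro power_int_increasing) auto
  also have "\<dots> \<le> max (abs2 x) (abs2 y)"
    using AC B by (auto simp: x' y' abs2_quot k_def min_def)
  finally show ?thesis .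
qed (auto simp: le_max_iff_disj)

lemma abs2_triangle: "abs2 (x + y) \<le> abs2 x + abs2 y"
  using abs2_ultra[of x y] abs2_nonneg[of x] abs2_nonneg[of y] by linarith

lemma abs2_diff_triangle: "abs2 (x - z) \<le> abs2 (x - y) + abs2 (y - z)"
  using abs2_triangle[of "x - y" "y - z"] by simp

lemma abs2_diff_le: "\<bar>abs2 x - abs2 y\<bar> \<le> abs2 (x - y)"
  using abs2_triangle[of "x - y" y] abs2_triangle[of "y - x" x] abs2_minus_commute[of x y] by simp

section \<open>The field of 2-adic numbers\<close>

definition cauchy2 :: "(nat \<Rightarrow> rat) \<Rightarrow> bool" where
  "cauchy2 X \<longleftrightarrow> (\<forall>e>0. \<exists>N. \<forall>m\<ge>N. \<forall>n\<ge>N. abs2 (X m - X n) < e)"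

definition vanishes2 :: "(nat \<Rightarrow> rat) \<Rightarrow> bool" where
  "vanishes2 X \<longleftrightarrow> (\<lambda>n. abs2 (X n)) \<longlonglongrightarrow> 0"

definition Q2_rel :: "(nat \<Rightarrow> rat) \<Rightarrow> (nat \<Rightarrow> rat) \<Rightarrow> bool" where
  "Q2_rel X Y \<longleftrightarrow> cauchy2 X \<and> cauchy2 Y \<and> vanishes2 (\<lambda>n. X n - Y n)"

lemma vanishes2_0 [simp]: "vanishes2 (\<lambda>n. 0)"
  by (simp add: vanishes2_def)

lemma cauchy2_const [simp]: "cauchy2 (\<lambda>n. c)"
  by (simp add: cauchy2_def)

lemma vanishes2_squeeze:
  assumes "\<And>n. abs2 (Z n) \<le> f n" "f \<longlonglongrightarrow> 0"
  shows "vanishes2 Z"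
  unfolding vanishes2_def
  by (rule tendsto_sandwich[OF _ _ tendsto_const assms(2)]) (auto simp: assms(1))

lemma vanishes2_minus: "vanishes2 X \<Longrightarrow> vanishes2 (\<lambda>n. - X n)"
  by (simp add: vanishes2_def)

lemma vanishes2_add: "vanishes2 X \<Longrightarrow> vanishes2 Y \<Longrightarrow> vanishes2 (\<lambda>n. X n + Y n)"
  by (rule vanishes2_squeeze[OF abs2_triangle])
    (auto simp: vanishes2_def intro: tendsto_eq_intros)

lemma cauchy2_minus: "cauchy2 X \<Longrightarrow> cauchy2 (\<lambda>n. - X n)"
proof -
  have "abs2 (- X m - - X n) = abs2 (X m - X n)" for m n
    using abs2_minus_commute[of "X m" "X n"] by simp
  then show "cauchy2 X \<Longrightarrow> cauchy2 (\<lambda>n. - X n)" by (simp add: cauchy2_def)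
qed

lemma cauchy2_add:
  assumes "cauchy2 X" "cauchy2 Y"
  shows "cauchy2 (\<lambda>n. X n + Y n)"
  unfolding cauchy2_def
proof (intro allI impI)
  fix e :: real assume e: "e > 0"
  obtain N where N: "\<And>m n. m \<ge> N \<Longrightarrow> n \<ge> N \<Longrightarrow> abs2 (X m - X n) < e" using assms(1) e unfolding cauchy2_def by blast
  obtain M where M: "\<And>m n. m \<ge> M \<Longrightarrow> n \<ge> M \<Longrightarrow> abs2 (Y m - Y n) < e" using assms(2) e unfolding cauchy2_def by blast
  show "\<exists>N. \<forall>m\<ge>N. \<forall>n\<ge>N. abs2 (X m + Y m - (X n + Y n)) < e"
  proof (intro exI allI impI)
    fix m n assume mn: "m \<ge> max N M" "n \<ge> max N M"
    have eq: "X m + Y m - (X n + Y n) = (X m - X n) + (Y m - Y n)" by simp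
    show "abs2 (X m + Y m - (X n + Y n)) < e"
      unfolding eq using abs2_ultra[of "X m - X n" "Y m - Y n"] N[of m n] M[of m n] mn by simp
  qed
qed

lemma cauchy2_bounded:
  assumes "cauchy2 X"
  shows "\<exists>B>0. \<forall>n. abs2 (X n) \<le> B"
proof -
  obtain N where N: "\<And>m n. m \<ge> N \<Longrightarrow> n \<ge> N \<Longrightarrow> abs2 (X m - X n) < 1"
    using assms unfolding cauchy2_def by (metis zero_less_one)
  define B where "B = (\<Sum>i\<le>N. abs2 (X i)) + 1"
  have S: "i \<le> N \<Longrightarrow> abs2 (X i) \<le> (\<Sum>i\<le>N. abs2 (X i))" for i
    by (rule member_le_sum) auto
  have "B > 0" unfolding B_def by (smt (verit) abs2_nonneg sum_nonneg)
  moreover have "abs2 (X n) \<le> B" for n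
  proof (cases "n \<le> N")
    case False
    have "abs2 (X n) \<le> abs2 (X n - X N) + abs2 (X N)" using abs2_triangle[of "X n - X N" "X N"] by simp
    then show ?thesis using N[of n N] False S[of N] by (simp add: B_def)
  qed (use S[of n] in \<open>simp add: B_def\<close>)
  ultimately show ?thesis by blast
qed

lemma vanishes2_mult:
  assumes "cauchy2 X" "vanishes2 Y"
  shows "vanishes2 (\<lambda>n. X n * Y n)"
proof -
  obtain B where B: "B > 0" "\<And>n. abs2 (X n) \<le> B" using cauchy2_bounded[OF assms(1)] by blast
  show ?thesis
  proof (rule vanishes2_squeeze)
    show "abs2 (X n * Y n) \<le> B * abs2 (Y n)" for n
      using B by (simp add: abs2_mult mult_right_mono)
    show "(\<lambda>n. B * abs2 (Y n)) \<longlonglongrightarrow> 0"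
      using assms(2) tendsto_mult_right_zero unfolding vanishes2_def by blast
  qed
qed

lemma cauchy2_mult:
  assumes "cauchy2 X" "cauchy2 Y"
  shows "cauchy2 (\<lambda>n. X n * Y n)"
  unfolding cauchy2_def
proof (intro allI impI)
  fix e :: real assume e: "e > 0"
  obtain A where A: "A > 0" "\<And>n. abs2 (X n) \<le> A" using cauchy2_bounded[OF assms(1)] by blast
  obtain B where B: "B > 0" "\<And>n. abs2 (Y n) \<le> B" using cauchy2_bounded[OF assms(2)] by blast
  obtain N where N: "\<And>m n. m \<ge> N \<Longrightarrow> n \<ge> N \<Longrightarrow> abs2 (X m - X n) < e / B"
    using assms(1) e B unfolding cauchy2_def by (metis divide_pos_pos)
  obtain M where M: "\<And>m n. m \<ge> M \<Longrightarrow> n \<ge> M \<Longrightarrow> abs2 (Y m - Y n) < e / A"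
    using assms(2) e A unfolding cauchy2_def by (metis divide_pos_pos)
  show "\<exists>N. \<forall>m\<ge>N. \<forall>n\<ge>N. abs2 (X m * Y m - X n * Y n) < e"
  proof (intro exI allI impI)
    fix m n assume mn: "m \<ge> max N M" "n \<ge> max N M"
    have eq: "X m * Y m - X n * Y n = X m * (Y m - Y n) + (X m - X n) * Y n" by (simp add: algebra_simps)
    have "abs2 (X m * (Y m - Y n)) \<le> A * abs2 (Y m - Y n)"
      using A by (simp add: abs2_mult mult_right_mono)
    also have "\<dots> < e" using M[of m n] mn A by (simp add: field_simps)
    finally have 1: "abs2 (X m * (Y m - Y n)) < e" .
    have "abs2 ((X m - X n) * Y n) \<le> abs2 (X m - X n) * B"
      using B by (simp add: abs2_mult mult_left_mono)
    also have "\<dots> < e" using N[of m n] mn B by (simp add: field_simps)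
    finally have 2: "abs2 ((X m - X n) * Y n) < e" .
    show "abs2 (X m * Y m - X n * Y n) < e"
      unfolding eq using abs2_ultra[of "X m * (Y m - Y n)" "(X m - X n) * Y n"] 1 2 by simp
  qed
qed

lemma cauchy2_not_vanishes:
  assumes "cauchy2 X" "\<not> vanishes2 X"
  shows "\<exists>b>0. \<exists>N. \<forall>n\<ge>N. abs2 (X n) \<ge> b"
proof -
  from assms(2) obtain e where e: "e > 0" "\<And>N. \<exists>n\<ge>N. abs2 (X n) \<ge> e"
    unfolding vanishes2_def LIMSEQ_def by (auto simp: not_less)
  obtain N where N: "\<And>m n. m \<ge> N \<Longrightarrow> n \<ge> N \<Longrightarrow> abs2 (X m - X n) < e / 2"
    using assms(1) e unfolding cauchy2_def by (metis half_gt_zero)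
  obtain k where k: "k \<ge> N" "abs2 (X k) \<ge> e" using e by blast
  have "abs2 (X n) \<ge> e / 2" if "n \<ge> N" for n
    using abs2_diff_le[of "X k" "X n"] N[of k n] k that by linarith
  then show ?thesis using e by (intro exI[of _ "e / 2"]) auto
qed

lemma cauchy2_inverse:
  assumes "cauchy2 X" "\<not> vanishes2 X"
  shows "cauchy2 (\<lambda>n. inverse (X n))"
  unfolding cauchy2_def
proof (intro allI impI)
  fix e :: real assume e: "e > 0"
  obtain b N where b: "b > 0" "\<And>n. n \<ge> N \<Longrightarrow> abs2 (X n) \<ge> b" using cauchy2_not_vanishes[OF assms] by blast
  have "e * (b * b) > 0" using e b by simp
  then obtain M where M: "\<And>m n. m \<ge> M \<Longrightarrow> n \<ge> M \<Longrightarrow> abs2 (X m - X n) < e * (b * b)"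
    using assms(1) unfolding cauchy2_def by metis
  show "\<exists>N. \<forall>m\<ge>N. \<forall>n\<ge>N. abs2 (inverse (X m) - inverse (X n)) < e"
  proof (intro exI allI impI)
    fix m n assume mn: "m \<ge> max N M" "n \<ge> max N M"
    have bb: "abs2 (X m) \<ge> b" "abs2 (X n) \<ge> b" using b mn by auto
    then have nz: "X m \<noteq> 0" "X n \<noteq> 0" using b by auto
    have "inverse (X m) - inverse (X n) = inverse (X m) * (X n - X m) * inverse (X n)"
      using nz by (simp add: field_simps)
    then have "abs2 (inverse (X m) - inverse (X n)) = abs2 (X n - X m) / (abs2 (X m) * abs2 (X n))"
      by (simp only: abs2_mult abs2_inverse) (simp add: divide_inverse mult_ac)
    also have "\<dots> \<le> abs2 (X n - X m) / (b * b)"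
      using bb b by (intro divide_left_mono mult_mono) (auto intro: mult_pos_pos)
    also have "\<dots> < e" using M[of n m] mn b by (simp add: field_simps)
    finally show "abs2 (inverse (X m) - inverse (X n)) < e" .
  qed
qed

lemma vanishes2_diff_inverse:
  assumes "cauchy2 X" "\<not> vanishes2 X" "cauchy2 Y" "\<not> vanishes2 Y" "vanishes2 (\<lambda>n. X n - Y n)"
  shows "vanishes2 (\<lambda>n. inverse (X n) - inverse (Y n))"
proof -
  obtain b N where b: "b > 0" "\<And>n. n \<ge> N \<Longrightarrow> abs2 (X n) \<ge> b" using cauchy2_not_vanishes[OF assms(1,2)] by blast
  obtain c M where c: "c > 0" "\<And>n. n \<ge> M \<Longrightarrow> abs2 (Y n) \<ge> c" using cauchy2_not_vanishes[OF assms(3,4)] by blast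
  have *: "vanishes2 (\<lambda>n. inverse (X n) * (inverse (Y n) * - (X n - Y n)))"
    by (intro vanishes2_mult cauchy2_inverse vanishes2_minus assms)
  have "\<forall>\<^sub>F n in sequentially. inverse (X n) * (inverse (Y n) * - (X n - Y n)) = inverse (X n) - inverse (Y n)"
    using eventually_ge_at_top[of "max N M"]
  proof eventually_elim
    case (elim n)
    then have "X n \<noteq> 0" "Y n \<noteq> 0" using b(2)[of n] c(2)[of n] b(1) c(1) by auto
    then show ?case by (simp add: field_simps)
  qed
  then have "\<forall>\<^sub>F n in sequentially. abs2 (inverse (X n) * (inverse (Y n) * - (X n - Y n))) = abs2 (inverse (X n) - inverse (Y n))"
    by eventually_elim simp
  then show ?thesis using * unfolding vanishes2_def by (rule Lim_transform_eventually[rotated])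
qed

lemma symp_Q2_rel: "symp Q2_rel"
proof -
  have "vanishes2 (\<lambda>n. Y n - X n)" if "vanishes2 (\<lambda>n. X n - Y n)" for X Y :: "nat \<Rightarrow> rat"
    using vanishes2_minus[OF that] by simp
  then show ?thesis by (auto simp: symp_def Q2_rel_def)
qed

lemma transp_Q2_rel: "transp Q2_rel"
proof -
  have "vanishes2 (\<lambda>n. X n - Z n)" if "vanishes2 (\<lambda>n. X n - Y n)" "vanishes2 (\<lambda>n. Y n - Z n)"
    for X Y Z :: "nat \<Rightarrow> rat"
    using vanishes2_add[OF that] by simp
  then show ?thesis unfolding transp_def Q2_rel_def by blast
qed

lemma part_equivp_Q2_rel: "part_equivp Q2_rel"
  by (rule part_equivpI[OF _ symp_Q2_rel transp_Q2_rel])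
    (auto simp: Q2_rel_def intro!: exI[of _ "\<lambda>n. 0"])

quotient_type Q2 = "nat \<Rightarrow> rat" / partial: Q2_rel
  morphisms rep_Q2 Abs_Q2
  by (rule part_equivp_Q2_rel)

lemma Q2_rel_vanishes_iff: "Q2_rel X Y \<Longrightarrow> vanishes2 X \<longleftrightarrow> vanishes2 Y"
proof -
  have "vanishes2 Y" if "Q2_rel X Y" "vanishes2 X" for X Y
  proof -
    have "vanishes2 (\<lambda>n. X n + - (X n - Y n))"
      using that by (intro vanishes2_add vanishes2_minus) (auto simp: Q2_rel_def)
    then show ?thesis by simp
  qed
  moreover assume "Q2_rel X Y"
  moreover from this have "Q2_rel Y X" by (rule sympD[OF symp_Q2_rel])
  ultimately show ?thesis by blast
qed

lemma Q2_rel_add: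
  assumes "Q2_rel X X'" "Q2_rel Y Y'"
  shows "Q2_rel (\<lambda>n. X n + Y n) (\<lambda>n. X' n + Y' n)"
proof -
  have "vanishes2 (\<lambda>n. (X n - X' n) + (Y n - Y' n))"
    using assms by (intro vanishes2_add) (auto simp: Q2_rel_def)
  then show ?thesis using assms by (auto simp: Q2_rel_def cauchy2_add algebra_simps)
qed

lemma Q2_rel_mult:
  assumes "Q2_rel X X'" "Q2_rel Y Y'"
  shows "Q2_rel (\<lambda>n. X n * Y n) (\<lambda>n. X' n * Y' n)"
proof -
  have "vanishes2 (\<lambda>n. X n * (Y n - Y' n) + Y' n * (X n - X' n))"
    using assms by (intro vanishes2_add vanishes2_mult) (auto simp: Q2_rel_def)
  then show ?thesis using assms by (auto simp: Q2_rel_def cauchy2_mult algebra_simps)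
qed

lemma Q2_rel_minus:
  assumes "Q2_rel X X'"
  shows "Q2_rel (\<lambda>n. - X n) (\<lambda>n. - X' n)"
proof -
  have "vanishes2 (\<lambda>n. - (X n - X' n))"
    using assms by (intro vanishes2_minus) (auto simp: Q2_rel_def)
  then show ?thesis using assms by (auto simp: Q2_rel_def cauchy2_minus algebra_simps)
qed

instantiation Q2 :: field
begin

lift_definition zero_Q2 :: Q2 is "\<lambda>n. 0" by (simp add: Q2_rel_def)

lift_definition one_Q2 :: Q2 is "\<lambda>n. 1" by (simp add: Q2_rel_def)

lift_definition plus_Q2 :: "Q2 \<Rightarrow> Q2 \<Rightarrow> Q2" is "\<lambda>X Y n. X n + Y n" by (rule Q2_rel_add)

lift_definition uminus_Q2 :: "Q2 \<Rightarrow> Q2" is "\<lambda>X n. - X n" by (rule Q2_rel_minus)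

lift_definition times_Q2 :: "Q2 \<Rightarrow> Q2 \<Rightarrow> Q2" is "\<lambda>X Y n. X n * Y n" by (rule Q2_rel_mult)

lift_definition inverse_Q2 :: "Q2 \<Rightarrow> Q2" is
  "\<lambda>X. if vanishes2 X then (\<lambda>n. 0) else (\<lambda>n. inverse (X n))"
proof -
  fix X Y assume a: "Q2_rel X Y"
  show "Q2_rel (if vanishes2 X then \<lambda>n. 0 else (\<lambda>n. inverse (X n)))
               (if vanishes2 Y then \<lambda>n. 0 else (\<lambda>n. inverse (Y n)))"
    using a Q2_rel_vanishes_iff[OF a]
    by (auto simp: Q2_rel_def cauchy2_inverse vanishes2_diff_inverse)
qed

definition "x - y = x + - y" for x y :: Q2

definition "x div y = x * inverse y" for x y :: Q2

instance
proof
  fix a b c :: Q2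
  show "a + b = b + a" by transfer (auto simp: ac_simps Q2_rel_def intro!: cauchy2_add cauchy2_mult cauchy2_minus)
  show "(a + b) + c = a + (b + c)" by transfer (auto simp: ac_simps Q2_rel_def intro!: cauchy2_add cauchy2_mult cauchy2_minus)
  show "0 + a = a" by transfer (auto simp: Q2_rel_def intro!: cauchy2_add cauchy2_mult cauchy2_minus)
  show "- a + a = 0" by transfer (auto simp: Q2_rel_def intro!: cauchy2_add cauchy2_mult cauchy2_minus)
  show "a - b = a + - b" by (rule minus_Q2_def)
  show "(a * b) * c = a * (b * c)" by transfer (auto simp: ac_simps Q2_rel_def intro!: cauchy2_add cauchy2_mult cauchy2_minus)
  show "a * b = b * a" by transfer (auto simp: ac_simps Q2_rel_def intro!: cauchy2_add cauchy2_mult cauchy2_minus)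
  show "1 * a = a" by transfer (auto simp: Q2_rel_def intro!: cauchy2_add cauchy2_mult cauchy2_minus)
  show "(a + b) * c = a * c + b * c" by transfer (auto simp: distrib_right Q2_rel_def intro!: cauchy2_add cauchy2_mult cauchy2_minus)
  show "(0::Q2) \<noteq> 1" by transfer (simp add: Q2_rel_def vanishes2_def LIMSEQ_const_iff)
  have inv: "vanishes2 (\<lambda>n. inverse (X n) * X n - 1)" if X: "cauchy2 X" "\<not> vanishes2 X" for X
  proof -
    obtain b N where b: "b > 0" "\<And>n. n \<ge> N \<Longrightarrow> abs2 (X n) \<ge> b" using cauchy2_not_vanishes[OF X] by blast
    have "\<forall>\<^sub>F n in sequentially. 0 = abs2 (inverse (X n) * X n - 1)"
      using eventually_ge_at_top[of N]
    proof eventually_elim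
      case (elim n)
      then have "X n \<noteq> 0" using b(2)[of n] b(1) by auto
      then show ?case by simp
    qed
    then show ?thesis unfolding vanishes2_def by (rule Lim_transform_eventually[OF tendsto_const])
  qed
  have "Q2_rel (\<lambda>n. (if vanishes2 X then \<lambda>n. 0 else (\<lambda>n. inverse (X n))) n * X n) (\<lambda>n. 1)"
    if "Q2_rel X X" "\<not> Q2_rel X (\<lambda>n. 0)" for X
    using that inv[of X] by (auto simp: Q2_rel_def intro!: cauchy2_mult cauchy2_inverse)
  note * = this
  show "inverse a * a = 1" if "a \<noteq> 0" using that by transfer (rule *)
  show "a div b = a * inverse b" by (rule divide_Q2_def)
  show "inverse (0::Q2) = 0" by transfer (simp add: Q2_rel_def)
qed

end

lemma cauchy2_abs2_convergent: "cauchy2 X \<Longrightarrow> convergent (\<lambda>n. abs2 (X n))"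
proof (rule Cauchy_convergent, rule metric_CauchyI)
  fix e :: real assume "cauchy2 X" "e > 0"
  then obtain N where "\<And>m n. m \<ge> N \<Longrightarrow> n \<ge> N \<Longrightarrow> abs2 (X m - X n) < e" unfolding cauchy2_def by blast
  then show "\<exists>M. \<forall>m\<ge>M. \<forall>n\<ge>M. dist (abs2 (X m)) (abs2 (X n)) < e"
    unfolding dist_real_def using abs2_diff_le order.strict_trans1 by meson
qed

lift_definition norm2 :: "Q2 \<Rightarrow> real" is "\<lambda>X. lim (\<lambda>n. abs2 (X n))"
proof -
  fix X Y assume a: "Q2_rel X Y"
  then have "(\<lambda>n. abs2 (X n)) \<longlonglongrightarrow> lim (\<lambda>n. abs2 (X n))"
    using cauchy2_abs2_convergent by (simp add: convergent_LIMSEQ_iff Q2_rel_def)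
  moreover have "(\<lambda>n. abs2 (Y n) - abs2 (X n)) \<longlonglongrightarrow> 0"
  proof (rule Lim_null_comparison)
    show "\<forall>\<^sub>F n in sequentially. norm (abs2 (Y n) - abs2 (X n)) \<le> abs2 (X n - Y n)"
      using abs2_diff_le abs2_minus_commute by (auto intro!: always_eventually) (metis)
    show "(\<lambda>n. abs2 (X n - Y n)) \<longlonglongrightarrow> 0" using a by (simp add: Q2_rel_def vanishes2_def)
  qed
  ultimately have "(\<lambda>n. abs2 (X n) + (abs2 (Y n) - abs2 (X n))) \<longlonglongrightarrow> lim (\<lambda>n. abs2 (X n)) + 0"
    by (rule tendsto_add)
  then have "(\<lambda>n. abs2 (Y n)) \<longlonglongrightarrow> lim (\<lambda>n. abs2 (X n))" by simp
  then show "lim (\<lambda>n. abs2 (X n)) = lim (\<lambda>n. abs2 (Y n))" by (simp add: limI)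
qed

lemma Abs_Q2_cases:
  obtains X where "x = Abs_Q2 X" "cauchy2 X"
proof -
  have "Q2_rel (rep_Q2 x) (rep_Q2 x)" by (rule Quotient3_rep_reflp[OF Quotient3_Q2])
  then show ?thesis using that[of "rep_Q2 x"] Quotient3_abs_rep[OF Quotient3_Q2, of x]
    by (simp add: Q2_rel_def)
qed

lemma Abs_Q2_eq_iff: "cauchy2 X \<Longrightarrow> cauchy2 Y \<Longrightarrow> Abs_Q2 X = Abs_Q2 Y \<longleftrightarrow> vanishes2 (\<lambda>n. X n - Y n)"
  using Quotient3_rel[OF Quotient3_Q2, of X Y] by (simp add: Q2_rel_def)

lemma add_Abs_Q2: "cauchy2 X \<Longrightarrow> cauchy2 Y \<Longrightarrow> Abs_Q2 X + Abs_Q2 Y = Abs_Q2 (\<lambda>n. X n + Y n)"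
  using plus_Q2.transfer by (simp add: Q2.pcr_cr_eq cr_Q2_def Q2_rel_def rel_fun_def)

lemma uminus_Abs_Q2: "cauchy2 X \<Longrightarrow> - Abs_Q2 X = Abs_Q2 (\<lambda>n. - X n)"
  using uminus_Q2.transfer by (simp add: Q2.pcr_cr_eq cr_Q2_def Q2_rel_def rel_fun_def)

lemma diff_Abs_Q2: "cauchy2 X \<Longrightarrow> cauchy2 Y \<Longrightarrow> Abs_Q2 X - Abs_Q2 Y = Abs_Q2 (\<lambda>n. X n - Y n)"
  by (simp add: minus_Q2_def add_Abs_Q2 uminus_Abs_Q2 cauchy2_minus)

lemma mult_Abs_Q2: "cauchy2 X \<Longrightarrow> cauchy2 Y \<Longrightarrow> Abs_Q2 X * Abs_Q2 Y = Abs_Q2 (\<lambda>n. X n * Y n)"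
  using times_Q2.transfer by (simp add: Q2.pcr_cr_eq cr_Q2_def Q2_rel_def rel_fun_def)

lemma norm2_Abs_Q2: "cauchy2 X \<Longrightarrow> norm2 (Abs_Q2 X) = lim (\<lambda>n. abs2 (X n))"
  using norm2.transfer by (simp add: Q2.pcr_cr_eq cr_Q2_def Q2_rel_def rel_fun_def)

lemma norm2_Abs_Q2_LIMSEQ: "cauchy2 X \<Longrightarrow> (\<lambda>n. abs2 (X n)) \<longlonglongrightarrow> norm2 (Abs_Q2 X)"
  using cauchy2_abs2_convergent by (simp add: norm2_Abs_Q2 convergent_LIMSEQ_iff)

lemma norm2_nonneg [simp]: "norm2 x \<ge> 0"
proof -
  obtain X where X: "x = Abs_Q2 X" "cauchy2 X" by (rule Abs_Q2_cases)
  show ?thesis unfolding X(1) using norm2_Abs_Q2_LIMSEQ[OF X(2)] by (rule LIMSEQ_le_const) auto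
qed

lemma norm2_eq_0_iff [simp]: "norm2 x = 0 \<longleftrightarrow> x = 0"
proof -
  obtain X where X: "x = Abs_Q2 X" "cauchy2 X" by (rule Abs_Q2_cases)
  have "(norm2 x = 0) = vanishes2 X"
    unfolding X(1) vanishes2_def using norm2_Abs_Q2_LIMSEQ[OF X(2)] LIMSEQ_unique by auto
  also have "\<dots> = (x = 0)"
    using Abs_Q2_eq_iff[OF X(2), of "\<lambda>n. 0"] by (simp add: X(1) zero_Q2_def)
  finally show ?thesis .
qed

lemma norm2_0 [simp]: "norm2 0 = 0"
  by simp

lemma norm2_mult: "norm2 (x * y) = norm2 x * norm2 y"
proof -
  obtain X where X: "x = Abs_Q2 X" "cauchy2 X" by (rule Abs_Q2_cases)
  obtain Y where Y: "y = Abs_Q2 Y" "cauchy2 Y" by (rule Abs_Q2_cases)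
  have "(\<lambda>n. abs2 (X n * Y n)) \<longlonglongrightarrow> norm2 x * norm2 y"
    unfolding abs2_mult X(1) Y(1) by (intro tendsto_mult norm2_Abs_Q2_LIMSEQ X Y)
  moreover have "(\<lambda>n. abs2 (X n * Y n)) \<longlonglongrightarrow> norm2 (x * y)"
    using norm2_Abs_Q2_LIMSEQ[OF cauchy2_mult[OF X(2) Y(2)]] X Y by (simp add: mult_Abs_Q2)
  ultimately show ?thesis by (blast intro: LIMSEQ_unique)
qed

lemma norm2_ultra: "norm2 (x + y) \<le> max (norm2 x) (norm2 y)"
proof -
  obtain X where X: "x = Abs_Q2 X" "cauchy2 X" by (rule Abs_Q2_cases)
  obtain Y where Y: "y = Abs_Q2 Y" "cauchy2 Y" by (rule Abs_Q2_cases)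
  have 1: "(\<lambda>n. max (abs2 (X n)) (abs2 (Y n))) \<longlonglongrightarrow> max (norm2 x) (norm2 y)"
    unfolding X(1) Y(1) by (intro tendsto_max norm2_Abs_Q2_LIMSEQ X Y)
  have 2: "(\<lambda>n. abs2 (X n + Y n)) \<longlonglongrightarrow> norm2 (x + y)"
    using norm2_Abs_Q2_LIMSEQ[OF cauchy2_add[OF X(2) Y(2)]] X Y by (simp add: add_Abs_Q2)
  show ?thesis by (rule LIMSEQ_le[OF 2 1]) (auto simp: abs2_ultra)
qed

lemma norm2_minus [simp]: "norm2 (- x) = norm2 x"
proof -
  obtain X where X: "x = Abs_Q2 X" "cauchy2 X" by (rule Abs_Q2_cases)
  show ?thesis using X by (simp add: uminus_Abs_Q2 norm2_Abs_Q2 cauchy2_minus)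
qed

instantiation Q2 :: metric_space
begin

definition dist_Q2 :: "Q2 \<Rightarrow> Q2 \<Rightarrow> real" where "dist_Q2 x y = norm2 (x - y)"

definition uniformity_Q2 :: "(Q2 \<times> Q2) filter" where
  "uniformity_Q2 = (INF e\<in>{0 <..}. principal {(x, y). dist x y < e})"

definition open_Q2 :: "Q2 set \<Rightarrow> bool" where
  "open_Q2 U \<longleftrightarrow> (\<forall>x\<in>U. \<forall>\<^sub>F (x', y) in uniformity. x' = x \<longrightarrow> y \<in> U)"

instance
proof
  show "uniformity = (INF e\<in>{0 <..}. principal {(x, y :: Q2). dist x y < e})"
    by (rule uniformity_Q2_def)
  show "open U \<longleftrightarrow> (\<forall>x\<in>U. \<forall>\<^sub>F (x', y) in uniformity. x' = x \<longrightarrow> y \<in> U)" for U :: "Q2 set"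
    by (rule open_Q2_def)
  fix x y z :: Q2
  show "dist x y = 0 \<longleftrightarrow> x = y" by (simp add: dist_Q2_def)
  have "norm2 (y - z) = norm2 (z - y)" using norm2_minus[of "y - z"] by simp
  then show "dist x y \<le> dist x z + dist y z"
    using norm2_ultra[of "x - z" "z - y"] norm2_nonneg[of "x - z"] norm2_nonneg[of "z - y"]
    unfolding dist_Q2_def by (simp add: max_def del: norm2_nonneg split: if_splits)
qed

end

lemma of_nat_Q2: "of_nat k = Abs_Q2 (\<lambda>n. of_nat k)"
  by (induction k) (simp_all add: zero_Q2_def one_Q2_def add_Abs_Q2)

instance Q2 :: field_char_0
proof
  show "inj (of_nat :: nat \<Rightarrow> Q2)"
    by (rule injI) (auto simp: of_nat_Q2 Abs_Q2_eq_iff vanishes2_def LIMSEQ_const_iff)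
qed

lemma of_int_Q2: "of_int k = Abs_Q2 (\<lambda>n. of_int k)"
  by (cases k rule: int_cases2) (simp_all add: of_nat_Q2 uminus_Abs_Q2)

lemma of_rat_Q2: "of_rat r = Abs_Q2 (\<lambda>n. r)"
proof -
  obtain a b where r: "r = of_int a / of_int b" "b \<noteq> 0" by (rule rat_quotE)
  have "Abs_Q2 (\<lambda>n. r) * of_int b = of_int a"
    using r by (simp add: of_int_Q2 mult_Abs_Q2)
  moreover have "of_rat r * of_int b = (of_int a :: Q2)"
    using r by (simp add: of_rat_divide)
  ultimately show ?thesis using r(2) by (metis mult_right_cancel of_int_eq_0_iff)
qed

lemma norm2_of_rat [simp]: "norm2 (of_rat r) = abs2 r"
  by (simp add: of_rat_Q2 norm2_Abs_Q2)

lemma Q2_of_rat_dense: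
  assumes "e > 0"
  shows "\<exists>r. norm2 (x - of_rat r) < e"
proof -
  obtain X where X: "x = Abs_Q2 X" "cauchy2 X" by (rule Abs_Q2_cases)
  obtain N where N: "\<And>m n. m \<ge> N \<Longrightarrow> n \<ge> N \<Longrightarrow> abs2 (X m - X n) < e / 2"
    using X assms unfolding cauchy2_def by (metis half_gt_zero)
  have "cauchy2 (\<lambda>n. X n + - X N)" by (intro cauchy2_add X) simp
  then have c: "cauchy2 (\<lambda>n. X n - X N)" by simp
  have "norm2 (x - of_rat (X N)) \<le> e / 2"
    using norm2_Abs_Q2_LIMSEQ[OF c] N
    by (intro LIMSEQ_le_const2[of _ "norm2 (x - of_rat (X N))"])
       (auto simp: X of_rat_Q2 diff_Abs_Q2 intro!: exI[of _ N] less_imp_le)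
  then show ?thesis using assms by (intro exI[of _ "X N"]) simp
qed

instance Q2 :: complete_space
proof
  fix x :: "nat \<Rightarrow> Q2" assume x: "Cauchy x"
  have "\<exists>r. norm2 (x n - of_rat r) < inverse (real (Suc n))" for n
    by (rule Q2_of_rat_dense) simp
  then obtain r where r: "\<And>n. norm2 (x n - of_rat (r n)) < inverse (real (Suc n))" by metis
  have small: "\<exists>N. \<forall>n\<ge>N. inverse (real (Suc n)) < e" if "e > 0" for e
    using LIMSEQ_inverse_real_of_nat that unfolding LIMSEQ_def dist_real_def by auto
  have c: "cauchy2 r"
    unfolding cauchy2_def
  proof (intro allI impI)
    fix e :: real assume e: "e > 0"
    obtain N where N: "\<And>n. n \<ge> N \<Longrightarrow> inverse (real (Suc n)) < e" using small[OF e] by blast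
    obtain M where M: "\<And>m n. m \<ge> M \<Longrightarrow> n \<ge> M \<Longrightarrow> dist (x m) (x n) < e"
      using x e unfolding Cauchy_def by blast
    have "abs2 (r m - r n) < e" if mn: "m \<ge> max N M" "n \<ge> max N M" for m n
    proof -
      have "abs2 (r m - r n) = norm2 (of_rat (r m) - of_rat (r n) :: Q2)"
        by (simp flip: of_rat_diff)
      also have "of_rat (r m) - of_rat (r n) = (- (x m - of_rat (r m)) + (x m - x n)) + (x n - of_rat (r n))"
        by simp
      also have "norm2 \<dots> \<le> max (max (norm2 (x m - of_rat (r m))) (norm2 (x m - x n))) (norm2 (x n - of_rat (r n)))"
        using norm2_ultra norm2_minus by (smt (verit))
      also have "\<dots> < e"
        using r[of m] r[of n] N[of m] N[of n] M[of m n] mn by (auto simp: dist_Q2_def)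
      finally show ?thesis .
    qed
    then show "\<exists>N. \<forall>m\<ge>N. \<forall>n\<ge>N. abs2 (r m - r n) < e" by blast
  qed
  have "x \<longlonglongrightarrow> Abs_Q2 r"
  proof (rule metric_LIMSEQ_I)
    fix e :: real assume e: "e > 0"
    obtain N where N: "\<And>n. n \<ge> N \<Longrightarrow> inverse (real (Suc n)) < e" using small[OF e] by blast
    obtain M where M: "\<And>m n. m \<ge> M \<Longrightarrow> n \<ge> M \<Longrightarrow> abs2 (r m - r n) < e / 2"
      using c e unfolding cauchy2_def by (metis half_gt_zero)
    have "dist (x n) (Abs_Q2 r) < e" if n: "n \<ge> max N M" for n
    proof -
      have "cauchy2 (\<lambda>k. r n + - r k)" by (intro cauchy2_add cauchy2_minus c) simp
      then have c': "cauchy2 (\<lambda>k. r n - r k)" by simp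
      have "norm2 (of_rat (r n) - Abs_Q2 r) \<le> e / 2"
        using norm2_Abs_Q2_LIMSEQ[OF c'] M n
        by (intro LIMSEQ_le_const2[of _ "norm2 (of_rat (r n) - Abs_Q2 r)"])
           (auto simp: c of_rat_Q2 diff_Abs_Q2 intro!: exI[of _ M] less_imp_le)
      moreover have "norm2 (x n - Abs_Q2 r) \<le> max (norm2 (x n - of_rat (r n))) (norm2 (of_rat (r n) - Abs_Q2 r))"
        using norm2_ultra[of "x n - of_rat (r n)" "of_rat (r n) - Abs_Q2 r"] by simp
      ultimately show ?thesis using r[of n] N[of n] n e by (simp add: dist_Q2_def)
    qed
    then show "\<exists>N. \<forall>n\<ge>N. dist (x n) (Abs_Q2 r) < e" by blast
  qed
  then show "convergent x" by (rule convergentI)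
qed

section \<open>Overconvergent forms of weight 0\<close>

text \<open>The infinite product converges in the \<open>q\<close>-adic (coefficientwise) topology.\<close>

definition Delta :: "Q2 fps" where
  "Delta = fps_X * (\<Prod>n. (1 - fps_X ^ Suc n) ^ 24)"

definition fq :: "Q2 fps" where
  "fq = (Delta oo fps_X ^ 2) / Delta"

definition gq :: "Q2 fps" where
  "gq = fps_const (2 ^ 6) * fq"

text \<open>
  The affinoid \<open>|j| \<ge> 2 ^ -6\<close> of the \<open>j\<close>-line is identified with the closed disc \<open>|g| \<le> 1\<close> of
  \<open>X_0(2)\<close>, so its rigid functions are the series \<open>\<Sum>n. a n * g ^ n\<close> over \<open>Q2\<close> with
  \<open>a n \<longlonglongrightarrow> 0\<close>, normed by \<open>Max_n |a n|\<close>. Forms are represented by their \<open>q\<close>-expansions. Since \<open>gq\<close> has zero constant term, the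
  composition \<open>Abs_fps a oo gq\<close> is the \<open>q\<close>-expansion of \<open>\<Sum>n. a n * gq ^ n\<close>.
\<close>

definition M0 :: "Q2 fps set" where
  "M0 = {Abs_fps a oo gq | a. a \<longlonglongrightarrow> 0}"

definition S0 :: "Q2 fps set" where
  "S0 = {F \<in> M0. fps_nth F 0 = 0}"

definition g_coeff :: "Q2 fps \<Rightarrow> nat \<Rightarrow> Q2" where
  "g_coeff F = (THE a. F = Abs_fps a oo gq)"

definition M0_norm :: "Q2 fps \<Rightarrow> real" where
  "M0_norm F = (SUP n. norm2 (g_coeff F n))"

definition U_op :: "Q2 fps \<Rightarrow> Q2 fps" where
  "U_op F = Abs_fps (\<lambda>n. fps_nth F (2 * n))"

definition d_entry :: "nat \<Rightarrow> Q2" where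
  "d_entry j = 2 ^ (4 * j + 1) * fact (3 * j) ^ 2 * fact j ^ 2 / (3 * fact (2 * j) ^ 4)"

text \<open>
  The diagonal matrix acts by \<open>gq ^ j \<mapsto> d_entry j * gq ^ j\<close>. Only \<open>j \<ge> 1\<close> matters, as
  \<open>g_coeff F 0 = 0\<close> for \<open>F\<close> in \<open>S0\<close>.
\<close>

definition D_op :: "Q2 fps \<Rightarrow> Q2 fps" where
  "D_op F = Abs_fps (\<lambda>j. d_entry j * g_coeff F j) oo gq"

section \<open>Characteristic power series of an operator\<close>

text \<open>
  Here \<open>V\<close> is a space of \<open>q\<close>-expansions with norm \<open>N\<close>; bases are indexed from 0.
\<close>

definition expands_in :: "(Q2 fps \<Rightarrow> real) \<Rightarrow> (nat \<Rightarrow> Q2 fps) \<Rightarrow> Q2 fps \<Rightarrow> (nat \<Rightarrow> Q2) \<Rightarrow> bool" where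
  "expands_in N e v a \<longleftrightarrow> a \<longlonglongrightarrow> 0 \<and> (\<lambda>n. N (v - (\<Sum>j<n. fps_const (a j) * e j))) \<longlonglongrightarrow> 0"

definition orthonormal_basis :: "Q2 fps set \<Rightarrow> (Q2 fps \<Rightarrow> real) \<Rightarrow> (nat \<Rightarrow> Q2 fps) \<Rightarrow> bool" where
  "orthonormal_basis V N e \<longleftrightarrow> range e \<subseteq> V \<and>
     (\<forall>v\<in>V. (\<exists>!a. expands_in N e v a) \<and>
        (\<forall>a. expands_in N e v a \<longrightarrow> N v = (SUP n. norm2 (a n))))"

definition op_matrix :: "(Q2 fps \<Rightarrow> real) \<Rightarrow> (nat \<Rightarrow> Q2 fps) \<Rightarrow> (Q2 fps \<Rightarrow> Q2 fps) \<Rightarrow> nat \<Rightarrow> nat \<Rightarrow> Q2" where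
  "op_matrix N e T i j = (THE a. expands_in N e (T (e j)) a) i"

text \<open>
  \<open>det (1 - X A)\<close> for an infinite matrix \<open>A\<close>: up to sign, the coefficient of \<open>X ^ m\<close> is the sum of
  the principal minors of size \<open>m\<close>, an unordered infinite sum in \<open>Q2\<close>.
\<close>

definition fredholm_det :: "(nat \<Rightarrow> nat \<Rightarrow> Q2) \<Rightarrow> Q2 fps" where
  "fredholm_det A = Abs_fps (\<lambda>m. (- 1) ^ m *
     (\<Sum>\<^sub>\<infinity>S\<in>{S. finite S \<and> card S = m}. \<Sum>p | p permutes S. of_int (sign p) * (\<Prod>i\<in>S. A i (p i))))"

text \<open>
  For a compact operator the series \<open>det (1 - X T)\<close> is computed by the matrix of \<open>T\<close> in any
  orthonormal basis and does not depend on the basis (Serre).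
\<close>

definition char_series :: "Q2 fps set \<Rightarrow> (Q2 fps \<Rightarrow> real) \<Rightarrow> (Q2 fps \<Rightarrow> Q2 fps) \<Rightarrow> Q2 fps" where
  "char_series V N T = (THE P. \<forall>e. orthonormal_basis V N e \<longrightarrow> P = fredholm_det (op_matrix N e T))"

section \<open>Newton polygons\<close>

text \<open>
  The Newton polygon is given as the function whose graph is the lower boundary of the convex hull
  of the points; it is \<open>\<infinity>\<close> where no point of the hull lies above \<open>x\<close>.
\<close>

text \<open>\<open>v2 0\<close> is irrelevant: zero coefficients (of infinite valuation) contribute no point.\<close>

definition v2 :: "Q2 \<Rightarrow> real" where
  "v2 x = - log 2 (norm2 x)"

definition newton_polygon :: "Q2 fps \<Rightarrow> real \<Rightarrow> ereal" where
  "newton_polygon P x =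
     (INF y \<in> {y. (x, y) \<in> convex hull {(real n, v2 (fps_nth P n)) | n. fps_nth P n \<noteq> 0}}. ereal y)"

section \<open>The powers of \<open>g\<close> form an orthonormal basis of the cusp forms\<close>

lemma fps_one_minus_X_power_pow:
  fixes m k :: nat
  shows "\<exists>h. (1 - fps_X ^ m) ^ k = (1 + fps_X ^ m * h :: 'a :: comm_ring_1 fps)"
proof (induction k)
  case 0
  show ?case by (intro exI[of _ 0]) simp
next
  case (Suc k)
  then obtain h where h: "(1 - fps_X ^ m) ^ k = (1 + fps_X ^ m * h :: 'a fps)" by blast
  show ?case by (intro exI[of _ "h - 1 - fps_X ^ m * h"]) (simp add: h algebra_simps)
qed

lemma Delta_prod:
  obtains H :: "Q2 fps" where "(\<lambda>n. (1 - fps_X ^ Suc n) ^ 24) has_prod H" "fps_nth H 0 = 1"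
proof -
  define P :: "nat \<Rightarrow> Q2 fps" where "P n = (\<Prod>i\<le>n. (1 - fps_X ^ Suc i) ^ 24)" for n
  have step: "fps_nth (P (Suc n)) k = fps_nth (P n) k" if "k \<le> n" for n k
  proof -
    obtain h :: "Q2 fps" where h: "(1 - fps_X ^ Suc (Suc n)) ^ 24 = 1 + fps_X ^ Suc (Suc n) * h"
      using fps_one_minus_X_power_pow by blast
    have "P (Suc n) = P n + fps_X ^ Suc (Suc n) * (P n * h)"
      unfolding P_def prod.atMost_Suc h by (simp add: algebra_simps)
    then show ?thesis using that by (simp add: fps_X_power_mult_nth del: power_Suc)
  qed
  have st: "fps_nth (P n) k = fps_nth (P k) k" if "k \<le> n" for n k
    using that by (induction n rule: dec_induct) (simp_all add: step)
  define H where "H = Abs_fps (\<lambda>k. fps_nth (P k) k)"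
  have lim: "P \<longlonglongrightarrow> H"
    by (rule tendsto_fpsI, unfold H_def fps_nth_Abs_fps)
       (rule eventually_mono[OF eventually_ge_at_top], erule st)
  have H0: "fps_nth H 0 = 1" by (simp add: H_def P_def fps_nth_power_0)
  then have "H \<noteq> 0" by auto
  with lim have "raw_has_prod (\<lambda>n. (1 - fps_X ^ Suc n) ^ 24) 0 H"
    by (simp add: raw_has_prod_def P_def[abs_def])
  then have "(\<lambda>n. (1 - fps_X ^ Suc n) ^ 24) has_prod H" by (simp add: has_prod_def)
  then show ?thesis using H0 that by blast
qed

lemma fq_nth_0: "fps_nth fq 0 = 0" and fq_nth_1: "fps_nth fq 1 = 1"
proof -
  obtain H :: "Q2 fps" where H: "(\<lambda>n. (1 - fps_X ^ Suc n) ^ 24) has_prod H" "fps_nth H 0 = 1"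
    by (rule Delta_prod)
  have D: "Delta = fps_X * H" unfolding Delta_def using has_prod_unique[OF H(1)] by simp
  have "Delta oo fps_X ^ 2 = fps_X * (fps_X * (H oo fps_X ^ 2))"
    by (simp add: D fps_compose_mult_distrib power2_eq_square mult.assoc)
  then have "fq = (fps_X * (fps_X * (H oo fps_X ^ 2))) / (fps_X * H)" by (simp add: fq_def D)
  also have "\<dots> = (fps_X * (H oo fps_X ^ 2)) / H" by (rule div_mult_mult1) simp
  also have "\<dots> = (fps_X * (H oo fps_X ^ 2)) * inverse H" using H(2) by (intro fps_divide_unit) simp
  finally have f: "fq = fps_X * ((H oo fps_X ^ 2) * inverse H)" by (simp add: mult.assoc)
  show "fps_nth fq 0 = 0" by (simp add: f)
  show "fps_nth fq 1 = 1" unfolding f using H(2) by (simp add: fps_compose_nth)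
qed

lemma gq_nth_0 [simp]: "fps_nth gq 0 = 0"
  by (simp add: gq_def fq_nth_0)

lemma gq_nth_1: "fps_nth gq 1 \<noteq> 0"
  using fq_nth_1 by (simp add: gq_def)

lemma compose_gq_inject: "A oo gq = B oo gq \<longleftrightarrow> A = B"
proof
  assume "A oo gq = B oo gq"
  then have "(A oo gq) oo fps_inv gq = (B oo gq) oo fps_inv gq" by simp
  moreover have "fps_nth (fps_inv gq) 0 = 0" by (simp add: fps_inv_def)
  moreover have "gq oo fps_inv gq = fps_X" using gq_nth_1 by (intro fps_inv_right) auto
  ultimately show "A = B" by (simp add: fps_compose_assoc[symmetric])
qed simp

lemma g_coeff_compose [simp]: "g_coeff (Abs_fps a oo gq) = a"
  unfolding g_coeff_def compose_gq_inject by (rule the_equality) (auto simp: fps_eq_iff)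

lemma gq_power: "gq ^ j = Abs_fps (\<lambda>n. if n = j then 1 else 0) oo gq"
proof -
  have "Abs_fps (\<lambda>n. if n = j then 1 else 0) = (fps_X ^ j :: Q2 fps)" by (simp add: fps_eq_iff)
  then show ?thesis by (simp add: fps_compose_power[symmetric])
qed

lemma D_op_gq_power: "D_op (gq ^ j) = fps_const (d_entry j) * gq ^ j"
proof -
  have "Abs_fps (\<lambda>i. d_entry i * (if i = j then 1 else 0)) =
      fps_const (d_entry j) * Abs_fps (\<lambda>n. if n = j then 1 else 0)"
    by (simp add: fps_eq_iff)
  then show ?thesis unfolding D_op_def gq_power g_coeff_compose
    by (simp add: fps_compose_mult_distrib)
qed

lemma Q2_tendsto_0_iff: "a \<longlonglongrightarrow> (0 :: Q2) \<longleftrightarrow> (\<lambda>n. norm2 (a n)) \<longlonglongrightarrow> 0"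
  unfolding tendsto_dist_iff[of a] by (simp add: dist_Q2_def)

lemma null_bdd_above:
  assumes "a \<longlonglongrightarrow> (0 :: Q2)"
  shows "bdd_above (range (\<lambda>n. norm2 (a n)))"
proof -
  have "convergent (\<lambda>n. norm2 (a n))" using assms unfolding Q2_tendsto_0_iff by (rule convergentI)
  then have "Bseq (\<lambda>n. norm2 (a n))" by (rule convergent_imp_Bseq)
  then show ?thesis by (intro bounded_imp_bdd_above) (simp add: Bseq_eq_bounded)
qed

lemma M0_norm_diff:
  "M0_norm ((Abs_fps a oo gq) - (\<Sum>j<n. fps_const (c j) * gq ^ Suc j)) =
     (SUP k. norm2 (a k - (if 0 < k \<and> k \<le> n then c (k - 1) else 0)))"
proof -
  have "(\<Sum>j<n. fps_const (c j) * gq ^ Suc j) = (\<Sum>j<n. fps_const (c j) * fps_X ^ Suc j) oo gq"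
    by (simp add: fps_compose_sum_distrib fps_compose_mult_distrib fps_compose_power[symmetric] del: power_Suc)
  note 1 = this
  have 2: "fps_nth (\<Sum>j<n. fps_const (c j) * fps_X ^ Suc j) k = (if 0 < k \<and> k \<le> n then c (k - 1) else 0)" for k
  proof (cases k)
    case (Suc l)
    have "fps_nth (\<Sum>j<n. fps_const (c j) * fps_X ^ Suc j) k = (\<Sum>j<n. if j = l then c j else 0)"
      unfolding fps_sum_nth by (intro sum.cong) (auto simp: Suc simp del: power_Suc)
    then show ?thesis by (simp add: Suc Suc_le_eq)
  qed (simp add: fps_sum_nth)
  have "Abs_fps a - (\<Sum>j<n. fps_const (c j) * fps_X ^ Suc j) =
      Abs_fps (\<lambda>k. a k - (if 0 < k \<and> k \<le> n then c (k - 1) else 0))"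
    by (rule fps_ext) (simp only: fps_sub_nth fps_nth_Abs_fps 2)
  then have "(Abs_fps a oo gq) - (\<Sum>j<n. fps_const (c j) * gq ^ Suc j) =
      Abs_fps (\<lambda>k. a k - (if 0 < k \<and> k \<le> n then c (k - 1) else 0)) oo gq"
    by (simp only: 1 fps_compose_sub_distrib[symmetric])
  then show ?thesis by (simp add: M0_norm_def)
qed

lemma S0_cases:
  assumes "F \<in> S0"
  obtains a where "F = Abs_fps a oo gq" "a \<longlonglongrightarrow> 0" "a 0 = 0"
  using assms by (auto simp: S0_def M0_def)

lemma S0_expands_in:
  assumes a: "a \<longlonglongrightarrow> 0" "a 0 = 0"
  shows "expands_in M0_norm (\<lambda>j. gq ^ Suc j) (Abs_fps a oo gq) b \<longleftrightarrow> b = (\<lambda>j. a (Suc j))"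
proof
  assume "b = (\<lambda>j. a (Suc j))"
  then have b: "\<And>j. b j = a (Suc j)" by simp
  have "(\<lambda>n. M0_norm ((Abs_fps a oo gq) - (\<Sum>j<n. fps_const (b j) * gq ^ Suc j))) \<longlonglongrightarrow> 0"
  proof (rule LIMSEQ_I)
    fix e :: real assume e: "e > 0"
    then have "e / 2 > 0" by simp
    then obtain K where K: "\<And>k. k \<ge> K \<Longrightarrow> norm2 (a k) < e / 2"
      using LIMSEQ_D[OF a(1)[unfolded Q2_tendsto_0_iff]] by (metis diff_zero norm2_nonneg real_norm_def abs_of_nonneg)
    have "norm (M0_norm ((Abs_fps a oo gq) - (\<Sum>j<n. fps_const (b j) * gq ^ Suc j)) - 0) < e" if n: "n \<ge> K" for n
    proof -
      let ?s = "SUP k. norm2 (a k - (if 0 < k \<and> k \<le> n then b (k - 1) else 0))"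
      have le: "norm2 (a k - (if 0 < k \<and> k \<le> n then b (k - 1) else 0)) \<le> e / 2" for k
        using K[of k] n a(2) e by (cases k) (auto simp: b intro: less_imp_le)
      then have "?s \<le> e / 2" by (intro cSUP_least) auto
      moreover have "0 \<le> ?s"
        by (rule cSUP_upper2[of _ _ 0]) (auto intro!: bdd_aboveI2[of _ _ "e / 2"] le)
      ultimately show ?thesis using e by (simp add: M0_norm_diff del: power_Suc)
    qed
    then show "\<exists>no. \<forall>n\<ge>no. norm (M0_norm ((Abs_fps a oo gq) - (\<Sum>j<n. fps_const (b j) * gq ^ Suc j)) - 0) < e"
      by blast
  qed
  moreover have "b \<longlonglongrightarrow> 0" unfolding b[abs_def] using a(1) by (rule LIMSEQ_Suc)
  ultimately show "expands_in M0_norm (\<lambda>j. gq ^ Suc j) (Abs_fps a oo gq) b" by (simp add: expands_in_def)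
next
  assume "expands_in M0_norm (\<lambda>j. gq ^ Suc j) (Abs_fps a oo gq) b"
  then have b0: "b \<longlonglongrightarrow> 0" and
    lim: "(\<lambda>n. SUP k. norm2 (a k - (if 0 < k \<and> k \<le> n then b (k - 1) else 0))) \<longlonglongrightarrow> 0"
    by (simp_all add: expands_in_def M0_norm_diff del: power_Suc)
  have "norm2 (a (Suc j) - b j) \<le> 0" for j
  proof (rule LIMSEQ_le_const[OF lim], intro exI allI impI)
    fix n assume n: "n \<ge> Suc j"
    have "(\<lambda>k. a k - (if 0 < k \<and> k \<le> n then b (k - 1) else 0)) \<longlonglongrightarrow> 0"
      using a(1) by (rule Lim_transform_eventually)
        (auto intro!: eventually_mono[OF eventually_gt_at_top[of n]])
    from cSUP_upper[OF UNIV_I null_bdd_above[OF this], of "Suc j"]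
    show "norm2 (a (Suc j) - b j) \<le> (SUP k. norm2 (a k - (if 0 < k \<and> k \<le> n then b (k - 1) else 0)))"
      using n by simp
  qed
  then have "norm2 (a (Suc j) - b j) = 0" for j by (rule antisym) (rule norm2_nonneg)
  then show "b = (\<lambda>j. a (Suc j))" by auto
qed

theorem orthonormal_basis_gq: "orthonormal_basis S0 M0_norm (\<lambda>j. gq ^ Suc j)"
  unfolding orthonormal_basis_def
proof (intro conjI ballI)
  have "gq ^ Suc j \<in> S0" for j
  proof -
    have "(\<lambda>n. if n = Suc j then 1 else 0 :: Q2) \<longlonglongrightarrow> 0"
      using tendsto_const by (rule Lim_transform_eventually)
        (auto intro!: eventually_mono[OF eventually_gt_at_top[of "Suc j"]])
    moreover have "Abs_fps (\<lambda>n. if n = Suc j then 1 else 0) = (fps_X ^ Suc j :: Q2 fps)"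
      by (simp add: fps_eq_iff del: power_Suc)
    then have "gq ^ Suc j = Abs_fps (\<lambda>n. if n = Suc j then 1 else 0) oo gq"
      by (simp add: fps_compose_power[symmetric] del: power_Suc)
    ultimately show ?thesis unfolding S0_def M0_def by auto
  qed
  then show "range (\<lambda>j. gq ^ Suc j) \<subseteq> S0" by blast
next
  fix F assume "F \<in> S0"
  then obtain a where a: "F = Abs_fps a oo gq" "a \<longlonglongrightarrow> 0" "a 0 = 0" by (rule S0_cases)
  have iff: "expands_in M0_norm (\<lambda>j. gq ^ Suc j) F b \<longleftrightarrow> b = (\<lambda>j. a (Suc j))" for b
    unfolding a(1) using a(2,3) by (rule S0_expands_in)
  then show "\<exists>!b. expands_in M0_norm (\<lambda>j. gq ^ Suc j) F b" by simp
  have bdd: "bdd_above (range (\<lambda>n. norm2 (a n)))" using a(2) by (rule null_bdd_above)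
  have bdd': "bdd_above (range (\<lambda>n. norm2 (a (Suc n))))"
    using a(2) by (intro null_bdd_above LIMSEQ_Suc)
  have "(SUP n. norm2 (a n)) = (SUP n. norm2 (a (Suc n)))"
  proof (rule antisym)
    show "(SUP n. norm2 (a n)) \<le> (SUP n. norm2 (a (Suc n)))"
    proof (rule cSUP_least)
      fix n show "norm2 (a n) \<le> (SUP n. norm2 (a (Suc n)))"
        using cSUP_upper2[OF bdd', of _ 0] cSUP_upper[OF _ bdd'] a(3) by (cases n) auto
    qed simp
    show "(SUP n. norm2 (a (Suc n))) \<le> (SUP n. norm2 (a n))"
      using cSUP_upper[OF _ bdd] by (intro cSUP_least) auto
  qed
  then show "\<forall>b. expands_in M0_norm (\<lambda>j. gq ^ Suc j) F b \<longrightarrow> M0_norm F = (SUP n. norm2 (b n))"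
    unfolding iff by (simp add: M0_norm_def a(1))
qed

end

theory Submission
  imports Defs
begin

text \<open>
  In the basis of powers of \<open>g\<close> the matrix of \<open>U\<close> factors as \<open>A D B\<close>, where \<open>A\<close> is lower and \<open>B\<close> upper
  triangular, both are integral and congruent to the identity modulo 2, and \<open>D\<close> is the diagonal matrix
  of the statement. By cyclicity \<open>det (1 - X A D B) = det (1 - X D C)\<close> with \<open>C = B A\<close> again congruent
  to the identity modulo 2. The norms of the entries of \<open>D\<close> decrease strictly, hence among the principal
  minors of \<open>D C\<close> of size \<open>m\<close> exactly one, the leading one, has maximal norm, and this norm is the product
  of the norms of the first \<open>m\<close> entries of \<open>D\<close>. So the coefficients of the two characteristic series
  have the same norms.

  The entries of \<open>U\<close> come from the quadratic equation satisfied by \<open>f(q)\<close> over the field of series in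
  \<open>q\<^sup>2\<close>, whose coefficients are polynomials in \<open>f(q\<^sup>2)\<close>; it amounts to Jacobi's identity for the eighth
  powers of the product of the \<open>1 - q ^ n\<close>, \<open>n\<close> odd. The product \<open>A D B\<close> is evaluated by a terminating
  well-poised hypergeometric sum.
\<close>

section \<open>Sums of principal minors\<close>

text \<open>The matrix of \<open>U\<close> is not dominated by its diagonal: \<open>U g\<close> has
  the coefficient 32 at \<open>g ^ 2\<close>, while \<open>U (g ^ 2)\<close> has 1152 there, which
  is 2-adically smaller. Moving all of \<open>D\<close> to the left cures this: each row of a minor
  then gives up its factor from \<open>D\<close> and leaves a minor of \<open>C\<close>, a unit. As
  \<open>A\<close> and \<open>B\<close> have ones on the diagonal, \<open>A D B\<close> is an LDU
  decomposition, so \<open>D\<close> collects the pivots of Gaussian elimination on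
  \<open>U\<close>; the first pivot is 24. \<open>char_series\<close> is a description ranging over
  all orthonormal bases, so independence of the basis has to be proved as well. This is a second use
  of cyclicity, for a change of basis and its inverse. Both uses go through one lemma on infinite
  matrices in which only one of the two factors is compact; it is reduced to rectangular
  truncations, whose errors the ultrametric inequality bounds uniformly.\<close>

definition principal_minor :: "(nat \<Rightarrow> nat \<Rightarrow> 'a) \<Rightarrow> nat set \<Rightarrow> 'a::comm_ring_1" where
  "principal_minor A S = (\<Sum>p | p permutes S. of_int (sign p) * (\<Prod>i\<in>S. A i (p i)))"

definition minor_sum :: "nat \<Rightarrow> nat set \<Rightarrow> (nat \<Rightarrow> nat \<Rightarrow> 'a) \<Rightarrow> 'a::comm_ring_1" where
  "minor_sum m I A = (\<Sum>S | S \<subseteq> I \<and> card S = m. principal_minor A S)"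

text \<open>Independent entries of the tuple, instead of an \<open>m\<close>-subset, allow a product
  of row sums to be expanded and the two index sets to be exchanged. The price is a factor
  \<open>fact m\<close> and the tuples with repetitions.\<close>

definition tuple_sum :: "nat \<Rightarrow> nat set \<Rightarrow> (nat \<Rightarrow> nat \<Rightarrow> 'a) \<Rightarrow> 'a::comm_ring_1" where
  "tuple_sum m I A = (\<Sum>t\<in>{..<m} \<rightarrow>\<^sub>E I. \<Sum>p | p permutes {..<m}.
     of_int (sign p) * (\<Prod>i<m. A (t i) (t (p i))))"

text \<open>Conjugation by \<open>t\<close> carries the permutations of the positions to those of
  \<open>S\<close> and preserves the sign.\<close>

lemma permutes_conj_tuple:
  fixes A :: "nat \<Rightarrow> nat \<Rightarrow> 'a::comm_ring_1" and m :: nat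
  assumes t: "bij_betw t {..<m} S"
  shows "(\<Sum>p | p permutes {..<m}. of_int (sign p) * (\<Prod>i<m. A (t i) (t (p i)))) =
    principal_minor A S"
proof -
  let ?h = "map_permutation {..<m} t"
  have inj: "inj_on t {..<m}" using t by (simp add: bij_betw_def)
  have tS: "t i \<in> S" if "i < m" for i using that t by (auto simp: bij_betw_def)
  have "bij_betw (\<lambda>p x. if x \<in> S then t (p (inv_into {..<m} t x)) else x) {p. p permutes {..<m}} {p. p permutes S}"
    using t by (rule bij_betw_permutations)
  moreover have "?h = (\<lambda>p x. if x \<in> S then t (p (inv_into {..<m} t x)) else x)"
    using t by (auto simp: map_permutation_def restrict_id_def bij_betw_def fun_eq_iff)
  ultimately have bij: "bij_betw ?h {p. p permutes {..<m}} {p. p permutes S}" by (simp only:)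
  have sg: "sign (?h p) = sign p" if "p permutes {..<m}" for p
    using that by (intro sign_map_permutation inj) auto
  have "principal_minor A S = (\<Sum>p | p permutes {..<m}. of_int (sign (?h p)) * (\<Prod>i\<in>S. A i (?h p i)))"
    unfolding principal_minor_def by (rule sum.reindex_bij_betw[OF bij, symmetric])
  also have "\<dots> = (\<Sum>p | p permutes {..<m}. of_int (sign p) * (\<Prod>i<m. A (t i) (t (p i))))"
  proof (rule sum.cong)
    fix p assume "p \<in> {p. p permutes {..<m}}"
    then have p: "p permutes {..<m}" by simp
    have "(\<Prod>i\<in>S. A i (?h p i)) = (\<Prod>i<m. A (t i) (?h p (t i)))"
      by (rule prod.reindex_bij_betw[OF t, symmetric])
    also have "\<dots> = (\<Prod>i<m. A (t i) (t (p i)))"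
      by (intro prod.cong) (auto simp: map_permutation_apply inj)
    finally show "of_int (sign (?h p)) * (\<Prod>i\<in>S. A i (?h p i)) = of_int (sign p) * (\<Prod>i<m. A (t i) (t (p i)))"
      by (simp only: sg[OF p])
  qed simp
  finally show ?thesis by simp
qed

text \<open>Composing \<open>p\<close> with the transposition of two positions where
  \<open>t\<close> agrees changes the sign and nothing else, so the sum equals its own
  negative.\<close>

lemma alternating_sum_not_inj:
  fixes A :: "nat \<Rightarrow> nat \<Rightarrow> 'a::field_char_0" and m :: nat
  assumes "\<not> inj_on t {..<m}"
  shows "(\<Sum>p | p permutes {..<m}. of_int (sign p) * (\<Prod>i<m. A (t i) (t (p i)))) = 0" (is "?s = 0")
proof -
  obtain a b where ab: "a < m" "b < m" "a \<noteq> b" "t a = t b" using assms by (auto simp: inj_on_def)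
  let ?r = "Transposition.transpose a b"
  have r: "?r permutes {..<m}" using ab by (intro permutes_swap_id) auto
  have tr: "t (?r k) = t k" for k using ab by (auto simp: Transposition.transpose_def)
  have "?s = (\<Sum>p | p permutes {..<m}. of_int (sign (?r \<circ> p)) * (\<Prod>i<m. A (t i) (t ((?r \<circ> p) i))))"
    using r by (rule setum_permutations_compose_left)
  also have "\<dots> = (\<Sum>p | p permutes {..<m}. - (of_int (sign p) * (\<Prod>i<m. A (t i) (t (p i)))))"
  proof (rule sum.cong)
    fix p assume "p \<in> {p. p permutes {..<m}}"
    then have "permutation p" by (auto intro: permutes_imp_permutation[of "{..<m}"])
    then have "sign (?r \<circ> p) = - sign p"
      using ab by (simp add: sign_compose permutation_swap_id sign_swap_id)
    then show "of_int (sign (?r \<circ> p)) * (\<Prod>i<m. A (t i) (t ((?r \<circ> p) i))) = - (of_int (sign p) * (\<Prod>i<m. A (t i) (t (p i))))"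
      by (simp add: tr)
  qed simp
  also have "\<dots> = - ?s" by (simp add: sum_negf)
  finally show ?thesis by simp
qed

lemma tuple_sum_eq:
  fixes A :: "nat \<Rightarrow> nat \<Rightarrow> 'a::field_char_0"
  assumes "finite I"
  shows "tuple_sum m I A = fact m * minor_sum m I A"
proof -
  let ?f = "\<lambda>t. \<Sum>p | p permutes {..<m}. of_int (sign p) * (\<Prod>i<m. A (t i) (t (p i)))"
  let ?T = "{t \<in> {..<m} \<rightarrow>\<^sub>E I. inj_on t {..<m}}"
  have fin: "finite ({..<m} \<rightarrow>\<^sub>E I)" using assms by (simp add: finite_PiE)
  have "tuple_sum m I A = (\<Sum>t\<in>?T. ?f t)"
    unfolding tuple_sum_def using fin by (intro sum.mono_neutral_right) (auto intro!: alternating_sum_not_inj)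
  also have "\<dots> = (\<Sum>t\<in>?T. principal_minor A (t ` {..<m}))"
  proof (rule sum.cong[OF refl])
    fix t assume "t \<in> ?T"
    then have "bij_betw t {..<m} (t ` {..<m})" by (simp add: bij_betw_def)
    from permutes_conj_tuple[OF this, of A] show "?f t = principal_minor A (t ` {..<m})" .
  qed
  \<comment> \<open>The injective tuples are grouped by their image; every \<open>m\<close>-subset
    is the image of \<open>fact m\<close> of them.\<close>
  also have "\<dots> = (\<Sum>S | S \<subseteq> I \<and> card S = m. \<Sum>t | t \<in> ?T \<and> t ` {..<m} = S. principal_minor A (t ` {..<m}))"
  proof (rule sum.group[of ?T "{S. S \<subseteq> I \<and> card S = m}" "\<lambda>t. t ` {..<m}" "\<lambda>t. principal_minor A (t ` {..<m})", symmetric])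
    show "finite ?T" by (rule finite_subset[OF _ fin]) blast
    show "finite {S. S \<subseteq> I \<and> card S = m}" by (rule finite_subset[of _ "Pow I"]) (use assms in auto)
    show "(\<lambda>t. t ` {..<m}) ` ?T \<subseteq> {S. S \<subseteq> I \<and> card S = m}"
    proof (rule image_subsetI)
      fix t assume t: "t \<in> ?T"
      then have "t i \<in> I" if "i < m" for i using that by (metis (lifting) PiE_mem lessThan_iff mem_Collect_eq)
      then show "t ` {..<m} \<in> {S. S \<subseteq> I \<and> card S = m}" using t by (auto simp: card_image)
    qed
  qed
  also have "\<dots> = (\<Sum>S | S \<subseteq> I \<and> card S = m. fact m * principal_minor A S)"
  proof (rule sum.cong)
    fix S assume S: "S \<in> {S. S \<subseteq> I \<and> card S = m}"
    then have fS: "finite S" using assms finite_subset by auto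
    have "{t. t \<in> ?T \<and> t ` {..<m} = S} = {t \<in> {..<m} \<rightarrow>\<^sub>E S. inj_on t {..<m}}"
    proof (intro equalityI subsetI)
      fix t assume "t \<in> {t \<in> {..<m} \<rightarrow>\<^sub>E S. inj_on t {..<m}}"
      then have t: "t \<in> {..<m} \<rightarrow>\<^sub>E S" "inj_on t {..<m}" by auto
      then have "t ` {..<m} = S" using S by (intro card_subset_eq fS) (auto simp: card_image)
      moreover have "t \<in> {..<m} \<rightarrow>\<^sub>E I" using t(1) S PiE_mono[of "{..<m}" "\<lambda>_. S" "\<lambda>_. I"] by blast
      ultimately show "t \<in> {t. t \<in> ?T \<and> t ` {..<m} = S}" using t by simp
    qed (auto simp: PiE_iff)
    moreover have "card {t \<in> {..<m} \<rightarrow>\<^sub>E S. inj_on t {..<m}} = fact m"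
      using card_inj_on_subset_funcset[of "{..<m}" S "{..<m}"] S fS by (simp add: fact_prod_rev)
    ultimately have c: "card {t. t \<in> ?T \<and> t ` {..<m} = S} = fact m" by simp
    have "(\<Sum>t | t \<in> ?T \<and> t ` {..<m} = S. principal_minor A (t ` {..<m})) = (\<Sum>t | t \<in> ?T \<and> t ` {..<m} = S. principal_minor A S)"
      by (intro sum.cong) auto
    also have "\<dots> = fact m * principal_minor A S" by (simp only: sum_constant c of_nat_fact)
    finally show "(\<Sum>t | t \<in> ?T \<and> t ` {..<m} = S. principal_minor A (t ` {..<m})) = fact m * principal_minor A S" .
  qed simp
  finally show ?thesis by (simp add: minor_sum_def sum_distrib_left)
qed

lemma bij_betw_PiE_compose_permutes:
  assumes p: "p permutes A"
  shows "bij_betw (\<lambda>t. restrict (t \<circ> p) A) (A \<rightarrow>\<^sub>E I) (A \<rightarrow>\<^sub>E I)"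
proof -
  have mem: "restrict (t \<circ> q) A \<in> A \<rightarrow>\<^sub>E I" if "q permutes A" "t \<in> A \<rightarrow>\<^sub>E I" for q t
  proof (rule restrict_PiE_iff[THEN iffD2], rule ballI)
    fix x assume "x \<in> A"
    then have "q x \<in> A" using permutes_in_image[OF that(1)] by simp
    then show "(t \<circ> q) x \<in> I" using PiE_mem[OF that(2)] by simp
  qed
  have inv: "restrict (restrict (t \<circ> q) A \<circ> r) A = t"
    if t: "t \<in> A \<rightarrow>\<^sub>E I" and r: "r permutes A" and e: "\<And>x. q (r x) = x" for q r t
  proof
    fix x
    have "r x \<in> A \<longleftrightarrow> x \<in> A" by (rule permutes_in_image[OF r])
    then show "restrict (restrict (t \<circ> q) A \<circ> r) A x = t x"
      using PiE_arb[OF t, of x] by (simp add: restrict_def e)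
  qed
  show ?thesis
    by (rule bij_betw_byWitness[where f' = "\<lambda>t. restrict (t \<circ> inv p) A"])
      (intro ballI inv p permutes_inv[OF p] permutes_inverses[OF p] image_subsetI mem; assumption)+
qed
text \<open>After expansion both sides run over closed walks \<open>t i\<close>, \<open>s i\<close>,
  \<open>t (p i)\<close>. Reading the walks from \<open>s\<close> instead of \<open>t\<close>
  replaces \<open>t\<close> by \<open>t\<close> composed with \<open>p\<close> and leaves the sign
  of \<open>p\<close> alone.\<close>

lemma tuple_sum_commute:
  fixes X Y :: "nat \<Rightarrow> nat \<Rightarrow> 'a::comm_ring_1"
  assumes "finite I" "finite J"
  shows "tuple_sum m I (\<lambda>i k. \<Sum>j\<in>J. X i j * Y j k) = tuple_sum m J (\<lambda>j k. \<Sum>i\<in>I. Y j i * X i k)"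
proof -
  let ?TI = "{..<m} \<rightarrow>\<^sub>E I" and ?TJ = "{..<m} \<rightarrow>\<^sub>E J" and ?P = "{p. p permutes {..<m}}"
  have fin: "finite ?TI" "finite ?TJ" "finite ?P" using assms by (auto simp: finite_PiE finite_permutations)
  have "tuple_sum m I (\<lambda>i k. \<Sum>j\<in>J. X i j * Y j k) =
      (\<Sum>t\<in>?TI. \<Sum>p\<in>?P. \<Sum>s\<in>?TJ. of_int (sign p) * (\<Prod>i<m. X (t i) (s i) * Y (s i) (t (p i))))"
    unfolding tuple_sum_def by (simp only: prod_sum_PiE[OF finite_lessThan assms(2)] sum_distrib_left)
  also have "\<dots> = (\<Sum>p\<in>?P. \<Sum>s\<in>?TJ. \<Sum>t\<in>?TI. of_int (sign p) * (\<Prod>i<m. X (t i) (s i) * Y (s i) (t (p i))))"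
    by (subst sum.swap) (rule sum.cong[OF refl sum.swap])
  also have "\<dots> = (\<Sum>p\<in>?P. \<Sum>s\<in>?TJ. \<Sum>t\<in>?TI. of_int (sign p) * (\<Prod>i<m. Y (s i) (t i) * X (t i) (s (p i))))"
  proof (rule sum.cong[OF refl], rule sum.cong[OF refl])
    fix p s assume "p \<in> ?P" and s: "s \<in> ?TJ"
    then have p: "p permutes {..<m}" by simp
    have "(\<Sum>t\<in>?TI. of_int (sign p) * (\<Prod>i<m. Y (s i) (t i) * X (t i) (s (p i)))) =
        (\<Sum>t\<in>?TI. of_int (sign p) * (\<Prod>i<m. Y (s i) (restrict (t \<circ> p) {..<m} i) * X (restrict (t \<circ> p) {..<m} i) (s (p i))))"
      by (rule sum.reindex_bij_betw[OF bij_betw_PiE_compose_permutes[OF p], symmetric])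
    also have "\<dots> = (\<Sum>t\<in>?TI. of_int (sign p) * (\<Prod>i<m. X (t i) (s i) * Y (s i) (t (p i))))"
    proof (rule sum.cong[OF refl])
      fix t
      have "(\<Prod>i<m. Y (s i) (restrict (t \<circ> p) {..<m} i) * X (restrict (t \<circ> p) {..<m} i) (s (p i))) =
          (\<Prod>i<m. Y (s i) (t (p i))) * (\<Prod>i<m. X (t (p i)) (s (p i)))"
        by (simp add: prod.distrib)
      also have "(\<Prod>i<m. X (t (p i)) (s (p i))) = (\<Prod>i<m. X (t i) (s i))"
        using prod.permute[OF p, of "\<lambda>i. X (t i) (s i)"] by (simp add: comp_def)
      finally show "of_int (sign p) * (\<Prod>i<m. Y (s i) (restrict (t \<circ> p) {..<m} i) * X (restrict (t \<circ> p) {..<m} i) (s (p i))) =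
          of_int (sign p) * (\<Prod>i<m. X (t i) (s i) * Y (s i) (t (p i)))"
        by (simp add: prod.distrib mult.commute)
    qed
    finally show "(\<Sum>t\<in>?TI. of_int (sign p) * (\<Prod>i<m. X (t i) (s i) * Y (s i) (t (p i)))) =
      (\<Sum>t\<in>?TI. of_int (sign p) * (\<Prod>i<m. Y (s i) (t i) * X (t i) (s (p i))))" by simp
  qed
  also have "\<dots> = (\<Sum>s\<in>?TJ. \<Sum>p\<in>?P. \<Sum>t\<in>?TI. of_int (sign p) * (\<Prod>i<m. Y (s i) (t i) * X (t i) (s (p i))))"
    by (rule sum.swap)
  also have "\<dots> = tuple_sum m J (\<lambda>j k. \<Sum>i\<in>I. Y j i * X i k)"
    unfolding tuple_sum_def by (simp only: prod_sum_PiE[OF finite_lessThan assms(1)] sum_distrib_left)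
  finally show ?thesis .
qed

lemma minor_sum_commute:
  fixes X Y :: "nat \<Rightarrow> nat \<Rightarrow> 'a::field_char_0"
  assumes "finite I" "finite J"
  shows "minor_sum m I (\<lambda>i k. \<Sum>j\<in>J. X i j * Y j k) = minor_sum m J (\<lambda>j k. \<Sum>i\<in>I. Y j i * X i k)"
  using tuple_sum_commute[OF assms, of m X Y] by (simp add: tuple_sum_eq assms)

section \<open>Ultrametric estimates for sums, products and minors\<close>

lemma norm2_1 [simp]: "norm2 1 = 1"
  using norm2_of_rat[of 1] by simp

lemma norm2_diff: "norm2 (x - y) \<le> max (norm2 x) (norm2 y)"
  using norm2_ultra[of x "- y"] by simp

lemma norm2_diff_commute: "norm2 (x - y) = norm2 (y - x)"
  using norm2_minus[of "x - y"] by simp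

lemma norm2_diff_trans: "norm2 (x - y) \<le> e \<Longrightarrow> norm2 (y - z) \<le> e \<Longrightarrow> norm2 (x - z) \<le> e"
  using norm2_ultra[of "x - y" "y - z"] by simp

lemma norm2_sum_le:
  assumes "\<And>i. i \<in> I \<Longrightarrow> norm2 (f i) \<le> e" "0 \<le> e"
  shows "norm2 (sum f I) \<le> e"
  using assms(1)
proof (induction I rule: infinite_finite_induct)
  case (insert x F)
  then have "max (norm2 (f x)) (norm2 (sum f F)) \<le> e" by simp
  then show ?case using insert order_trans[OF norm2_ultra[of "f x" "sum f F"]] by simp
qed (use assms(2) in auto)

lemma norm2_prod: "norm2 (prod f I) = (\<Prod>i\<in>I. norm2 (f i))"
  by (induction I rule: infinite_finite_induct) (simp_all add: norm2_mult)

lemma norm2_power: "norm2 (x ^ n) = norm2 x ^ n"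
  by (induction n) (simp_all add: norm2_mult)

lemma norm2_divide: "norm2 (x / y) = norm2 x / norm2 y"
proof (cases "y = 0")
  case False
  then have "norm2 (x / y) * norm2 y = norm2 x" by (simp flip: norm2_mult)
  then show ?thesis using False by (simp add: field_simps)
qed simp

lemma norm2_of_nat_le: "norm2 (of_nat n) \<le> 1"
proof (induction n)
  case (Suc n)
  then show ?case using norm2_ultra[of 1 "of_nat n"] by simp
qed simp

lemma norm2_of_int_le: "norm2 (of_int n) \<le> 1"
  by (cases n rule: int_cases2) (simp_all add: norm2_of_nat_le)

lemma norm2_prod_le_1:
  assumes "\<And>i. i \<in> I \<Longrightarrow> norm2 (f i) \<le> 1"
  shows "norm2 (prod f I) \<le> 1"
  unfolding norm2_prod using assms by (intro prod_le_1) auto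

lemma norm2_mult_le_left: "norm2 x \<le> 1 \<Longrightarrow> norm2 y \<le> e \<Longrightarrow> norm2 (x * y) \<le> e"
  unfolding norm2_mult using mult_mono[of "norm2 x" 1 "norm2 y" e] norm2_nonneg[of y] by simp

lemma norm2_mult_le_right: "norm2 x \<le> e \<Longrightarrow> norm2 y \<le> 1 \<Longrightarrow> norm2 (x * y) \<le> e"
  using norm2_mult_le_left[of y x e] by (simp add: mult.commute)

lemma norm2_prod_le:
  assumes "finite I" "\<And>i. i \<in> I \<Longrightarrow> norm2 (f i) \<le> 1" "k \<in> I" "norm2 (f k) \<le> e"
  shows "norm2 (prod f I) \<le> e"
  unfolding prod.remove[OF assms(1,3)]
  using assms by (intro norm2_mult_le_right norm2_prod_le_1) auto

lemma norm2_prod_diff: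
  assumes "0 \<le> e" "\<And>i. i \<in> I \<Longrightarrow> norm2 (f i) \<le> 1" "\<And>i. i \<in> I \<Longrightarrow> norm2 (g i) \<le> 1"
    "\<And>i. i \<in> I \<Longrightarrow> norm2 (f i - g i) \<le> e"
  shows "norm2 (prod f I - prod g I) \<le> e"
  using assms(2-)
proof (induction I rule: infinite_finite_induct)
  case (insert x F)
  have eq: "prod f (insert x F) - prod g (insert x F) = (f x - g x) * prod f F + g x * (prod f F - prod g F)"
    using insert by (simp add: algebra_simps)
  have "norm2 ((f x - g x) * prod f F) \<le> e"
    using insert by (intro norm2_mult_le_right norm2_prod_le_1) auto
  moreover have "norm2 (g x * (prod f F - prod g F)) \<le> e"
    using insert by (intro norm2_mult_le_left insert.IH) auto
  ultimately show ?case
    unfolding eq using norm2_ultra[of "(f x - g x) * prod f F" "g x * (prod f F - prod g F)"] by simp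
qed (use assms(1) in auto)

lemma norm2_LIMSEQ_le:
  assumes "f \<longlonglongrightarrow> L" "\<And>n. n \<ge> N \<Longrightarrow> norm2 (f n - a) \<le> e"
  shows "norm2 (L - a) \<le> e"
proof (rule field_le_epsilon)
  fix d :: real assume d: "d > 0"
  then obtain M where M: "\<And>n. n \<ge> M \<Longrightarrow> dist (f n) L < d"
    using assms(1) unfolding LIMSEQ_def by blast
  have "norm2 (f (max M N) - a) \<le> e" "norm2 (L - f (max M N)) \<le> d"
    using assms(2)[of "max M N"] M[of "max M N"] by (simp_all add: dist_Q2_def norm2_diff_commute)
  then show "norm2 (L - a) \<le> e + d"
    using norm2_ultra[of "L - f (max M N)" "f (max M N) - a"] norm2_nonneg[of "f (max M N) - a"] d
    by (simp add: max_def del: norm2_nonneg split: if_splits)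
qed

lemma norm2_eqI:
  assumes "\<And>e. e > 0 \<Longrightarrow> norm2 (x - y) \<le> e"
  shows "x = y"
proof -
  have "norm2 (x - y) \<le> 0" by (rule field_le_epsilon) (simp add: assms)
  then have "norm2 (x - y) = 0" by (rule antisym) simp
  then show ?thesis by simp
qed

lemma norm2_principal_minor_diff:
  assumes "0 \<le> e" "\<And>i j. i \<in> S \<Longrightarrow> j \<in> S \<Longrightarrow> norm2 (A i j) \<le> 1" "\<And>i j. i \<in> S \<Longrightarrow> j \<in> S \<Longrightarrow> norm2 (B i j) \<le> 1"
    "\<And>i j. i \<in> S \<Longrightarrow> j \<in> S \<Longrightarrow> norm2 (A i j - B i j) \<le> e"
  shows "norm2 (principal_minor A S - principal_minor B S) \<le> e"
proof -
  have "principal_minor A S - principal_minor B S =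
      (\<Sum>p | p permutes S. of_int (sign p) * ((\<Prod>i\<in>S. A i (p i)) - (\<Prod>i\<in>S. B i (p i))))"
    unfolding principal_minor_def by (simp add: sum_subtractf right_diff_distrib)
  also have "norm2 \<dots> \<le> e"
  proof (rule norm2_sum_le)
    fix p assume "p \<in> {p. p permutes S}"
    then have "p i \<in> S" if "i \<in> S" for i using that permutes_in_image[of p S i] by simp
    then show "norm2 (of_int (sign p) * ((\<Prod>i\<in>S. A i (p i)) - (\<Prod>i\<in>S. B i (p i)))) \<le> e"
      using assms by (intro norm2_mult_le_left norm2_of_int_le norm2_prod_diff) auto
  qed fact
  finally show ?thesis .
qed

lemma norm2_minor_sum_diff:
  assumes "0 \<le> e" "\<And>i j. i \<in> I \<Longrightarrow> j \<in> I \<Longrightarrow> norm2 (A i j) \<le> 1" "\<And>i j. i \<in> I \<Longrightarrow> j \<in> I \<Longrightarrow> norm2 (B i j) \<le> 1"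
    "\<And>i j. i \<in> I \<Longrightarrow> j \<in> I \<Longrightarrow> norm2 (A i j - B i j) \<le> e"
  shows "norm2 (minor_sum m I A - minor_sum m I B) \<le> e"
proof -
  have "minor_sum m I A - minor_sum m I B = (\<Sum>S | S \<subseteq> I \<and> card S = m. principal_minor A S - principal_minor B S)"
    unfolding minor_sum_def by (rule sum_subtractf[symmetric])
  also have "norm2 \<dots> \<le> e"
  proof (rule norm2_sum_le)
    fix S assume "S \<in> {S. S \<subseteq> I \<and> card S = m}"
    then have "\<And>i. i \<in> S \<Longrightarrow> i \<in> I" by auto
    then show "norm2 (principal_minor A S - principal_minor B S) \<le> e"
      using assms by (intro norm2_principal_minor_diff) auto
  qed fact
  finally show ?thesis .
qed

section \<open>Coefficients of the Fredholm determinant of a completely continuous matrix, as limits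
  over truncations\<close>

definition compact_matrix :: "(nat \<Rightarrow> nat \<Rightarrow> Q2) \<Rightarrow> bool" where
  "compact_matrix A \<longleftrightarrow> (\<forall>i j. norm2 (A i j) \<le> 1) \<and> (\<forall>e>0. \<exists>N. \<forall>i\<ge>N. \<forall>j. norm2 (A i j) \<le> e)"

lemma norm2_principal_minor_le:
  assumes "finite S" "\<And>i j. norm2 (A i j) \<le> 1" "k \<in> S" "\<And>j. norm2 (A k j) \<le> e"
  shows "norm2 (principal_minor A S) \<le> e"
  unfolding principal_minor_def
proof (rule norm2_sum_le)
  show "0 \<le> e" using assms(4)[of 0] norm2_nonneg[of "A k 0"] by linarith
  show "norm2 (of_int (sign p) * (\<Prod>i\<in>S. A i (p i))) \<le> e" for p
    by (intro norm2_mult_le_left norm2_of_int_le norm2_prod_le[of S _ k]) (auto simp: assms)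
qed

text \<open>A set not contained in \<open>{..<N}\<close> has a row of index at least
  \<open>N\<close>, which makes its minor small; by the ultrametric inequality any number of such
  minors together stays below the same bound.\<close>

lemma minor_sum_tail:
  assumes A: "\<And>i j. norm2 (A i j) \<le> 1" and N: "\<And>i j. i \<ge> N \<Longrightarrow> norm2 (A i j) \<le> e" and e: "0 \<le> e"
    and F: "finite F" "F \<subseteq> {S. finite S \<and> card S = m}" "{S. S \<subseteq> {..<N} \<and> card S = m} \<subseteq> F"
  shows "norm2 (sum (principal_minor A) F - minor_sum m {..<N} A) \<le> e"
proof -
  have "sum (principal_minor A) F - minor_sum m {..<N} A = sum (principal_minor A) (F - {S. S \<subseteq> {..<N} \<and> card S = m})"
    unfolding minor_sum_def using F by (simp add: sum_diff)
  also have "norm2 \<dots> \<le> e"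
  proof (rule norm2_sum_le[OF _ e])
    fix S assume S: "S \<in> F - {S. S \<subseteq> {..<N} \<and> card S = m}"
    then have "\<not> S \<subseteq> {..<N}" using F by auto
    then obtain k where "k \<in> S" "k \<ge> N" by (auto simp: subset_eq not_less)
    then show "norm2 (principal_minor A S) \<le> e" using S F(2) A N by (intro norm2_principal_minor_le[of S A k]) auto
  qed
  finally show ?thesis .
qed

lemma fredholm_coeff_approx:
  assumes A: "compact_matrix A" and N: "\<And>i j. i \<ge> N \<Longrightarrow> norm2 (A i j) \<le> e" and e: "0 \<le> e"
  shows "norm2 ((- 1) ^ m * fps_nth (fredholm_det A) m - minor_sum m {..<N} A) \<le> e"
proof -
  let ?X = "{S. finite S \<and> card S = m}" and ?G = "\<lambda>N. {S. S \<subseteq> {..<N::nat} \<and> card S = m}"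
  let ?s = "\<lambda>n. minor_sum m {..<n} A"
  have A1: "norm2 (A i j) \<le> 1" for i j using A by (simp add: compact_matrix_def)
  have G: "finite (?G n)" "?G n \<subseteq> ?X" for n
    by (rule finite_subset[of _ "Pow {..<n}"]) (auto intro: finite_subset)
  have tail: "norm2 (?s n - ?s K) \<le> d" if "n \<ge> K" "\<And>i j. i \<ge> K \<Longrightarrow> norm2 (A i j) \<le> d" "0 \<le> d" for n K d
  proof -
    have "?G K \<subseteq> ?G n" using that(1) by force
    from minor_sum_tail[OF A1 that(2,3) G this] show ?thesis by (simp add: minor_sum_def)
  qed
  have ex: "\<exists>K. \<forall>i\<ge>K. \<forall>j. norm2 (A i j) \<le> d" if "d > 0" for d
    using A that by (simp add: compact_matrix_def)
  have "Cauchy ?s"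
  proof (rule metric_CauchyI)
    fix d :: real assume d: "d > 0"
    then obtain K where K: "\<And>i j. i \<ge> K \<Longrightarrow> norm2 (A i j) \<le> d / 2" using ex[of "d / 2"] by auto
    have "dist (?s a) (?s b) < d" if "a \<ge> K" "b \<ge> K" for a b
      using norm2_diff_trans[of "?s a" "?s K" "d / 2" "?s b"] tail[OF that(1) K] tail[OF that(2) K] d
      by (simp add: dist_Q2_def norm2_diff_commute)
    then show "\<exists>M. \<forall>a\<ge>M. \<forall>b\<ge>M. dist (?s a) (?s b) < d" by blast
  qed
  then obtain c where c: "?s \<longlonglongrightarrow> c" using Cauchy_convergent_iff convergent_def by blast
  have cN: "norm2 (c - ?s K) \<le> d" if "\<And>i j. i \<ge> K \<Longrightarrow> norm2 (A i j) \<le> d" "0 \<le> d" for K d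
    using tail[OF _ that] by (rule norm2_LIMSEQ_le[OF c])
  \<comment> \<open>The unordered sum has the limit of the truncations: a finite family containing
    all \<open>m\<close>-subsets of \<open>{..<K}\<close> adds only minors that meet a row beyond
    \<open>K\<close>.\<close>
  have "(principal_minor A has_sum c) ?X"
    unfolding has_sum_def tendsto_iff eventually_finite_subsets_at_top
  proof (intro allI impI)
    fix d :: real assume d: "d > 0"
    then obtain K where K: "\<And>i j. i \<ge> K \<Longrightarrow> norm2 (A i j) \<le> d / 2" using ex[of "d / 2"] by auto
    show "\<exists>F0. finite F0 \<and> F0 \<subseteq> ?X \<and> (\<forall>F. finite F \<and> F0 \<subseteq> F \<and> F \<subseteq> ?X \<longrightarrow> dist (sum (principal_minor A) F) c < d)"
    proof (intro exI[of _ "?G K"] conjI allI impI G)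
      fix F assume F: "finite F \<and> ?G K \<subseteq> F \<and> F \<subseteq> ?X"
      have "norm2 (sum (principal_minor A) F - ?s K) \<le> d / 2"
        using minor_sum_tail[of A K "d / 2" F m] A1 K F d by auto
      moreover have "norm2 (?s K - c) \<le> d / 2" using cN[of K "d / 2"] K d by (simp add: norm2_diff_commute)
      ultimately have "norm2 (sum (principal_minor A) F - c) \<le> d / 2" by (rule norm2_diff_trans)
      then show "dist (sum (principal_minor A) F) c < d" using d by (simp add: dist_Q2_def)
    qed
  qed
  then have "fps_nth (fredholm_det A) m = (- 1) ^ m * c"
    unfolding fredholm_det_def fps_nth_Abs_fps principal_minor_def by (simp add: infsumI)
  then have "(- 1) ^ m * fps_nth (fredholm_det A) m = c" by (simp flip: mult.assoc power_mult_distrib)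
  then show ?thesis using cN[OF N e] by simp
qed

text \<open>The hypotheses on \<open>X\<close> are as weak as a change of basis demands: bounded
  entries and null columns, without uniformity. The products of the infinite matrices enter as
  entrywise limits \<open>P\<close> and \<open>Q\<close>.\<close>

lemma fredholm_det_commute:
  assumes X: "\<And>i j. norm2 (X i j) \<le> 1" "\<And>j. (\<lambda>i. X i j) \<longlonglongrightarrow> 0" and Y: "compact_matrix Y"
    and P: "\<And>i k. (\<lambda>n. \<Sum>j<n. X i j * Y j k) \<longlonglongrightarrow> P i k"
    and Q: "\<And>j k. (\<lambda>n. \<Sum>i<n. Y j i * X i k) \<longlonglongrightarrow> Q j k"
  shows "fredholm_det P = fredholm_det Q"
proof -
  have Y1: "norm2 (Y i j) \<le> 1" for i j using Y by (simp add: compact_matrix_def)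
  have P1: "norm2 (P i k) \<le> 1" for i k
  proof -
    have "norm2 (P i k - 0) \<le> 1"
      by (intro norm2_LIMSEQ_le[OF P, of 0]) (auto intro!: norm2_sum_le norm2_mult_le_left X(1) Y1)
    then show ?thesis by simp
  qed
  have Q1: "norm2 (Q i k) \<le> 1" for i k
  proof -
    have "norm2 (Q i k - 0) \<le> 1"
      by (intro norm2_LIMSEQ_le[OF Q, of 0]) (auto intro!: norm2_sum_le norm2_mult_le_left X(1) Y1)
    then show ?thesis by simp
  qed
  have exY: "\<exists>N. \<forall>i\<ge>N. \<forall>j. norm2 (Y i j) \<le> e" if "e > 0" for e
    using Y that by (simp add: compact_matrix_def)
  have QN: "norm2 (Q i k) \<le> e" if "\<And>j. norm2 (Y i j) \<le> e" for i k e
  proof -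
    have "0 \<le> e" using that[of 0] norm2_nonneg[of "Y i 0"] by linarith
    then have "norm2 (Q i k - 0) \<le> e"
      by (intro norm2_LIMSEQ_le[OF Q, of 0]) (auto intro!: norm2_sum_le norm2_mult_le_right that X(1))
    then show ?thesis by simp
  qed
  have exX: "\<exists>n. \<forall>i\<ge>n. \<forall>j<N. norm2 (X i j) \<le> e" if "e > 0" for e and N :: nat
  proof -
    have "\<forall>\<^sub>F i in sequentially. norm2 (X i j) \<le> e" for j
      using order_tendstoD(2)[OF X(2)[of j, unfolded Q2_tendsto_0_iff] that] by (rule eventually_mono) simp
    then have "\<forall>\<^sub>F i in sequentially. \<forall>j\<in>{..<N}. norm2 (X i j) \<le> e" by (intro eventually_ball_finite) auto
    then show ?thesis unfolding eventually_sequentially by auto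
  qed
  have cQ: "compact_matrix Q"
    unfolding compact_matrix_def using Q1 exY QN by meson
  \<comment> \<open>Split the inner index at \<open>N\<close>: beyond it the factor from
    \<open>Y\<close> is small, before it the factor from \<open>X\<close>.\<close>
  have PN: "norm2 (P i k) \<le> e"
    if "\<And>i j. i \<ge> N \<Longrightarrow> norm2 (Y i j) \<le> e" "\<And>j. j < N \<Longrightarrow> norm2 (X i j) \<le> e" "e > 0" for N i k e
  proof -
    have "norm2 (X i j * Y j k) \<le> e" for j
      using norm2_mult_le_left[OF X(1), of "Y j k" e i j] norm2_mult_le_right[OF _ Y1, of "X i j" e j k] that
      by (cases "j < N") auto
    then have "norm2 (P i k - 0) \<le> e"
      using that by (intro norm2_LIMSEQ_le[OF P, of 0]) (auto intro!: norm2_sum_le)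
    then show ?thesis by simp
  qed
  have cP: "compact_matrix P"
    unfolding compact_matrix_def
  proof (intro conjI allI impI P1)
    fix e :: real assume e: "e > 0"
    obtain N where N: "\<And>i j. i \<ge> N \<Longrightarrow> norm2 (Y i j) \<le> e" using exY[OF e] by auto
    obtain n where n: "\<And>i j. i \<ge> n \<Longrightarrow> j < N \<Longrightarrow> norm2 (X i j) \<le> e" using exX[OF e] by blast
    show "\<exists>n. \<forall>i\<ge>n. \<forall>k. norm2 (P i k) \<le> e" using PN[OF N n] e by blast
  qed
  show ?thesis
  proof (rule fps_ext, rule norm2_eqI)
    fix m and e :: real assume e: "e > 0"
    obtain N where N: "\<And>i j. i \<ge> N \<Longrightarrow> norm2 (Y i j) \<le> e" using exY[OF e] by auto
    obtain n where n: "\<And>i j. i \<ge> n \<Longrightarrow> j < N \<Longrightarrow> norm2 (X i j) \<le> e" using exX[OF e] by blast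
    let ?p = "(- 1) ^ m * fps_nth (fredholm_det P) m" and ?q = "(- 1) ^ m * fps_nth (fredholm_det Q) m"
    \<comment> \<open>\<open>N\<close> is chosen for the rows of \<open>Y\<close>, and only then
      \<open>n\<close> for the first \<open>N\<close> columns of \<open>X\<close>. The
      \<open>n\<close> by \<open>N\<close> rectangle approximates both products, and finite
      cyclicity applies to rectangles.\<close>
    let ?P = "\<lambda>i k. \<Sum>j<N. X i j * Y j k" and ?Q = "\<lambda>j k. \<Sum>i<n. Y j i * X i k"
    have XY: "norm2 (X i j * Y j k) \<le> 1" "norm2 (Y j i * X i k) \<le> 1" for i j k
      using norm2_mult_le_left[OF X(1) Y1] norm2_mult_le_left[OF Y1 X(1)] by auto
    have Pd: "norm2 (P i k - ?P i k) \<le> e" for i k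
    proof (rule norm2_LIMSEQ_le[OF P])
      fix K assume "K \<ge> N"
      then have "(\<Sum>j<K. X i j * Y j k) - ?P i k = (\<Sum>j\<in>{..<K} - {..<N}. X i j * Y j k)"
        by (subst sum_diff) auto
      also have "norm2 \<dots> \<le> e" using N e by (intro norm2_sum_le norm2_mult_le_left X(1)) auto
      finally show "norm2 ((\<Sum>j<K. X i j * Y j k) - ?P i k) \<le> e" .
    qed
    have Qd: "norm2 (Q j k - ?Q j k) \<le> e" if "k < N" for j k
    proof (rule norm2_LIMSEQ_le[OF Q])
      fix K assume "K \<ge> n"
      then have "(\<Sum>i<K. Y j i * X i k) - ?Q j k = (\<Sum>i\<in>{..<K} - {..<n}. Y j i * X i k)"
        by (subst sum_diff) auto
      also have "norm2 \<dots> \<le> e" using n e that by (intro norm2_sum_le norm2_mult_le_left Y1) auto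
      finally show "norm2 ((\<Sum>i<K. Y j i * X i k) - ?Q j k) \<le> e" .
    qed
    have "norm2 (?p - minor_sum m {..<n} P) \<le> e"
      using PN[OF N n] e by (intro fredholm_coeff_approx cP) auto
    moreover have "norm2 (minor_sum m {..<n} P - minor_sum m {..<n} ?P) \<le> e"
    proof (rule norm2_minor_sum_diff)
      show "norm2 (\<Sum>j<N. X i j * Y j k) \<le> 1" for i k by (intro norm2_sum_le XY) simp
    qed (use e Pd P1 in auto)
    ultimately have "norm2 (?p - minor_sum m {..<n} ?P) \<le> e" by (rule norm2_diff_trans)
    moreover have "minor_sum m {..<n} ?P = minor_sum m {..<N} ?Q" by (rule minor_sum_commute) auto
    moreover have "norm2 (minor_sum m {..<N} ?Q - minor_sum m {..<N} Q) \<le> e"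
      unfolding norm2_diff_commute[of "minor_sum m {..<N} ?Q"]
    proof (rule norm2_minor_sum_diff)
      show "norm2 (\<Sum>i<n. Y j i * X i k) \<le> 1" for j k by (intro norm2_sum_le XY) simp
    qed (use e Qd Q1 in auto)
    ultimately have "norm2 (?p - minor_sum m {..<N} Q) \<le> e"
      using norm2_diff_trans[of ?p "minor_sum m {..<N} ?Q" e "minor_sum m {..<N} Q"] by simp
    moreover have "norm2 (minor_sum m {..<N} Q - ?q) \<le> e"
      unfolding norm2_diff_commute[of "minor_sum m {..<N} Q"]
      using QN N e by (intro fredholm_coeff_approx cQ) auto
    ultimately have "norm2 (?p - ?q) \<le> e" by (rule norm2_diff_trans)
    also have "?p - ?q = (- 1) ^ m * (fps_nth (fredholm_det P) m - fps_nth (fredholm_det Q) m)"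
      by (simp add: right_diff_distrib)
    finally show "norm2 (fps_nth (fredholm_det P) m - fps_nth (fredholm_det Q) m) \<le> e"
      by (simp add: norm2_mult norm2_power)
  qed
qed

section \<open>The dominant principal minor\<close>

lemma norm2_add_dominant:
  assumes "norm2 y < norm2 x"
  shows "norm2 (x + y) = norm2 x"
  using norm2_ultra[of x y] norm2_diff[of "x + y" y] assms by (auto simp: max_def split: if_splits)

lemma principal_minor_identity: "finite S \<Longrightarrow> principal_minor (\<lambda>i j. if i = j then 1 else 0) S = 1"
proof -
  assume S: "finite S"
  have "(\<Prod>i\<in>S. if i = p i then 1 else 0 :: 'a) = (if p = id then 1 else 0)" if "p permutes S" for p
  proof (cases "p = id")
    case False
    then obtain x where "p x \<noteq> x" by (auto simp: fun_eq_iff)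
    then have "x \<in> S" using that by (metis permutes_not_in)
    then show ?thesis using \<open>p x \<noteq> x\<close> False S by (auto intro!: prod_zero bexI[of _ x])
  qed simp
  then have "principal_minor (\<lambda>i j. if i = j then 1 else 0 :: 'a) S =
      (\<Sum>p | p permutes S. if p = id then 1 else 0)"
    unfolding principal_minor_def by (intro sum.cong) (auto simp: sign_id)
  also have "\<dots> = 1" using S by (simp add: finite_permutations permutes_id)
  finally show ?thesis .
qed

lemma principal_minor_scale_rows:
  "principal_minor (\<lambda>i j. d i * C i j) S = (\<Prod>i\<in>S. d i) * principal_minor C S"
  unfolding principal_minor_def by (simp add: prod.distrib sum_distrib_left mult_ac)

text \<open>\<open>S\<close> and \<open>{..<m}\<close> have equally many elements outside each
  other. Those of \<open>S\<close> are at least \<open>m\<close>, those of \<open>{..<m}\<close> are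
  below \<open>m\<close>, and \<open>f m\<close> separates the values.\<close>

lemma prod_lt_initial_segment:
  fixes f :: "nat \<Rightarrow> real"
  assumes pos: "\<And>i. f i > 0" and dec: "\<And>i j. i < j \<Longrightarrow> f j < f i"
    and S: "finite S" "card S = m" "S \<noteq> {..<m}"
  shows "prod f S < prod f {..<m}"
proof -
  let ?A = "S - {..<m}" and ?B = "{..<m} - S"
  have "card (S \<inter> {..<m}) + card ?A = card S" "card ({..<m} \<inter> S) + card ?B = card {..<m}"
    using S by (metis card_Int_Diff finite_lessThan)+
  then have AB: "card ?A = card ?B" using S by (simp add: Int_commute)
  have ne: "?B \<noteq> {}"
  proof
    assume "?B = {}"
    then have "{..<m} \<subseteq> S" by auto
    then have "{..<m} = S" using S by (intro card_subset_eq) auto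
    then show False using S by simp
  qed
  have "f i \<le> f m" if "i \<in> ?A" for i using that dec[of m i] by (cases "i = m") auto
  then have "prod f ?A \<le> (\<Prod>i\<in>?A. f m)" using pos by (intro prod_mono) (auto intro: less_imp_le)
  also have "\<dots> = (\<Prod>i\<in>?B. f m)" using AB by simp
  also have "\<dots> < prod f ?B"
  proof -
    obtain k where "k \<in> ?B" using ne by blast
    then show ?thesis using pos dec by (intro prod_mono_strict[of k]) (auto intro: less_imp_le)
  qed
  finally have "prod f ?A < prod f ?B" .
  moreover have "prod f (S \<inter> {..<m}) > 0" using pos by (intro prod_pos) auto
  ultimately have "prod f (S \<inter> {..<m}) * prod f ?A < prod f (S \<inter> {..<m}) * prod f ?B" by simp
  moreover have "prod f S = prod f (S \<inter> {..<m}) * prod f ?A"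
    using prod.Int_Diff[of S f "{..<m}"] S by simp
  moreover have "prod f {..<m} = prod f (S \<inter> {..<m}) * prod f ?B"
    using prod.Int_Diff[of "{..<m}" f S] by (simp add: Int_commute)
  ultimately show ?thesis by simp
qed

lemma norm2_fredholm_coeff:
  assumes d: "\<And>i. d i \<noteq> 0" "\<And>i j. i < j \<Longrightarrow> norm2 (d j) < norm2 (d i)"
    and cmp: "compact_matrix (\<lambda>i j. d i * C i j)"
    and C: "\<And>i j. norm2 (C i j - (if i = j then 1 else 0)) \<le> 1 / 2"
  shows "norm2 (fps_nth (fredholm_det (\<lambda>i j. d i * C i j)) m) = (\<Prod>i<m. norm2 (d i))"
proof -
  let ?I = "\<lambda>i j. if i = j then 1 else 0 :: Q2" and ?A = "\<lambda>i j. d i * C i j"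
  let ?p = "\<Prod>i<m. norm2 (d i)"
  have pos: "norm2 (d i) > 0" for i using d(1)[of i] by (simp add: less_le)
  have p: "?p > 0" using pos by (intro prod_pos) auto
  have C1: "norm2 (C i j) \<le> 1" for i j
    using norm2_ultra[of "C i j - ?I i j" "?I i j"] C[of i j] by (auto simp: max_def split: if_splits)
  have minor: "norm2 (principal_minor ?A S) = (\<Prod>i\<in>S. norm2 (d i))" if "finite S" for S
  proof -
    have "norm2 (principal_minor C S - principal_minor ?I S) \<le> 1 / 2"
      by (rule norm2_principal_minor_diff) (use C in \<open>auto simp: C1\<close>)
    then have "norm2 (principal_minor C S - 1) < norm2 1" using that by (simp add: principal_minor_identity)
    then have "norm2 (1 + (principal_minor C S - 1)) = norm2 1" by (rule norm2_add_dominant)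
    then show ?thesis by (simp add: principal_minor_scale_rows norm2_mult norm2_prod)
  qed
  obtain N0 where N0: "\<And>i j. i \<ge> N0 \<Longrightarrow> norm2 (?A i j) \<le> ?p / 2"
    using cmp p unfolding compact_matrix_def by (metis half_gt_zero)
  \<comment> \<open>The truncation error is at most half the norm of the leading minor, hence cannot
    disturb it; the maximum with \<open>m\<close> puts \<open>{..<m}\<close> among the sets that are
    summed.\<close>
  define N where "N = max N0 m"
  have N: "norm2 (?A i j) \<le> ?p / 2" if "i \<ge> N" for i j using N0 that by (simp add: N_def)
  let ?G = "{S. S \<subseteq> {..<N} \<and> card S = m}"
  have G: "finite ?G" "{..<m} \<in> ?G" by (auto simp: N_def)
  let ?r = "sum (principal_minor ?A) (?G - {{..<m}})"
  have "norm2 ?r < ?p"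
  proof -
    \<comment> \<open>Strictness survives because a largest norm is attained among finitely many
      minors; inserting 0 keeps the set nonempty when the leading minor is the only one.\<close>
    define e where "e = Max (insert 0 ((\<lambda>S. norm2 (principal_minor ?A S)) ` (?G - {{..<m}})))"
    have fin: "finite (insert 0 ((\<lambda>S. norm2 (principal_minor ?A S)) ` (?G - {{..<m}})))" using G by simp
    have "norm2 ?r \<le> e" unfolding e_def using fin by (intro norm2_sum_le Max_ge) auto
    also have "e < ?p"
      unfolding e_def
    proof (subst Max_less_iff[OF fin], simp, intro ballI)
      fix x assume "x \<in> insert 0 ((\<lambda>S. norm2 (principal_minor ?A S)) ` (?G - {{..<m}}))"
      then show "x < ?p"
      proof
        assume "x \<in> (\<lambda>S. norm2 (principal_minor ?A S)) ` (?G - {{..<m}})"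
        then obtain S where S: "S \<in> ?G" "S \<noteq> {..<m}" and x: "x = norm2 (principal_minor ?A S)" by auto
        then have fS: "finite S" by (auto intro: finite_subset)
        show ?thesis unfolding x minor[OF fS]
          using S fS by (intro prod_lt_initial_segment pos d(2)) auto
      qed (simp add: p)
    qed
    finally show ?thesis .
  qed
  moreover have "minor_sum m {..<N} ?A = principal_minor ?A {..<m} + ?r"
    unfolding minor_sum_def using G by (rule sum.remove)
  ultimately have M: "norm2 (minor_sum m {..<N} ?A) = ?p"
    using norm2_add_dominant[of ?r "principal_minor ?A {..<m}"] minor[of "{..<m}"] by simp
  let ?c = "(- 1) ^ m * fps_nth (fredholm_det ?A) m"
  have "norm2 (?c - minor_sum m {..<N} ?A) \<le> ?p / 2"
    using p by (intro fredholm_coeff_approx cmp N) auto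
  then have "norm2 (minor_sum m {..<N} ?A + (?c - minor_sum m {..<N} ?A)) = ?p"
    using norm2_add_dominant[of "?c - minor_sum m {..<N} ?A" "minor_sum m {..<N} ?A"] M p by simp
  then show ?thesis by (simp add: norm2_mult norm2_power)
qed

section \<open>Independence of the orthonormal basis\<close>

text \<open>Coordinates are indexed from 0 for the basis \<open>gq ^ Suc j\<close>;
  \<open>case_nat 0\<close> supplies the vanishing constant term.\<close>

definition cusp_series :: "(nat \<Rightarrow> Q2) \<Rightarrow> Q2 fps" where
  "cusp_series a = Abs_fps (case_nat 0 a) oo gq"

lemma case_nat_null: "a \<longlonglongrightarrow> (0::Q2) \<Longrightarrow> case_nat 0 a \<longlonglongrightarrow> 0"
  by (rule LIMSEQ_imp_Suc) simp

lemma cusp_series_add: "cusp_series (\<lambda>i. a i + b i) = cusp_series a + cusp_series b"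
proof -
  have "Abs_fps (case_nat 0 (\<lambda>i. a i + b i)) = Abs_fps (case_nat 0 a) + Abs_fps (case_nat 0 b)"
    by (auto simp: fps_eq_iff split: nat.split)
  then show ?thesis by (simp add: cusp_series_def fps_compose_add_distrib)
qed

lemma cusp_series_scale: "cusp_series (\<lambda>i. c * a i) = fps_const c * cusp_series a"
proof -
  have "Abs_fps (case_nat 0 (\<lambda>i. c * a i)) = fps_const c * Abs_fps (case_nat 0 a)"
    by (auto simp: fps_eq_iff split: nat.split)
  then show ?thesis by (simp add: cusp_series_def fps_compose_mult_distrib)
qed

lemma fps_const_neg_1: "fps_const (- 1) = (- 1 :: 'a::ring_1 fps)"
  by (metis fps_const_1_eq_1 fps_const_neg)

lemma cusp_series_diff: "cusp_series (\<lambda>i. a i - b i) = cusp_series a - cusp_series b"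
  using cusp_series_add[of a "\<lambda>i. - 1 * b i"] unfolding cusp_series_scale[of "- 1" b] by (simp add: fps_const_neg_1)

lemma cusp_series_0: "cusp_series (\<lambda>i. 0) = 0"
  using cusp_series_scale[of 0 "\<lambda>i. 0"] by simp

lemma cusp_series_sum: "cusp_series (\<lambda>i. \<Sum>j<n. f j i) = (\<Sum>j<(n::nat). cusp_series (f j))"
  by (induction n) (simp_all add: cusp_series_0 cusp_series_add)

lemma S0_iff_cusp_series: "F \<in> S0 \<longleftrightarrow> (\<exists>a. a \<longlonglongrightarrow> 0 \<and> F = cusp_series a)"
proof
  assume "F \<in> S0"
  then obtain a where a: "F = Abs_fps a oo gq" "a \<longlonglongrightarrow> 0" "a 0 = 0" by (rule S0_cases)
  have "case_nat 0 (\<lambda>i. a (Suc i)) = a" using a(3) by (auto simp: fun_eq_iff split: nat.split)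
  then show "\<exists>a. a \<longlonglongrightarrow> 0 \<and> F = cusp_series a"
    using LIMSEQ_Suc[OF a(2)] a(1) by (intro exI[of _ "\<lambda>i. a (Suc i)"]) (simp add: cusp_series_def)
next
  assume "\<exists>a. a \<longlonglongrightarrow> 0 \<and> F = cusp_series a"
  then obtain a where a: "a \<longlonglongrightarrow> 0" "F = cusp_series a" by blast
  then show "F \<in> S0" using case_nat_null[OF a(1)] by (auto simp: S0_def M0_def cusp_series_def)
qed

lemma cusp_series_in_S0: "a \<longlonglongrightarrow> 0 \<Longrightarrow> cusp_series a \<in> S0"
  by (auto simp: S0_iff_cusp_series)

lemma norm2_tendsto_iff: "f \<longlonglongrightarrow> (L::Q2) \<longleftrightarrow> (\<lambda>n. norm2 (f n - L)) \<longlonglongrightarrow> 0"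
  unfolding tendsto_dist_iff[of f] by (simp add: dist_Q2_def)

lemma null_add: "a \<longlonglongrightarrow> 0 \<Longrightarrow> b \<longlonglongrightarrow> 0 \<Longrightarrow> (\<lambda>i. a i + b i :: Q2) \<longlonglongrightarrow> 0"
  unfolding Q2_tendsto_0_iff
  by (rule tendsto_sandwich[OF _ _ tendsto_const, of _ _ _ "\<lambda>i. max (norm2 (a i)) (norm2 (b i))"])
    (auto simp: norm2_ultra intro: tendsto_eq_intros)

lemma null_scale: "a \<longlonglongrightarrow> 0 \<Longrightarrow> (\<lambda>i. c * a i :: Q2) \<longlonglongrightarrow> 0"
  unfolding Q2_tendsto_0_iff norm2_mult by (rule tendsto_mult_right_zero)

lemma S0_add: "F \<in> S0 \<Longrightarrow> G \<in> S0 \<Longrightarrow> F + G \<in> S0"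
  unfolding S0_iff_cusp_series using null_add cusp_series_add by metis

lemma S0_scale: "F \<in> S0 \<Longrightarrow> fps_const c * F \<in> S0"
  unfolding S0_iff_cusp_series using null_scale cusp_series_scale by metis

lemma S0_0: "0 \<in> S0"
  unfolding S0_iff_cusp_series by (intro exI[of _ "\<lambda>i. 0"]) (simp add: cusp_series_0)

lemma S0_sum: "(\<And>j. j < n \<Longrightarrow> f j \<in> S0) \<Longrightarrow> (\<Sum>j<(n::nat). f j) \<in> S0"
  by (induction n) (simp_all add: S0_0 S0_add)

lemma S0_diff: "F \<in> S0 \<Longrightarrow> G \<in> S0 \<Longrightarrow> F - G \<in> S0"
  using S0_add[of F "fps_const (- 1) * G"] S0_scale[of G "- 1"] by (simp add: fps_const_neg_1)

lemma norm2_le_M0_norm: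
  assumes "a \<longlonglongrightarrow> 0"
  shows "norm2 (a n) \<le> M0_norm (cusp_series a)"
  using cSUP_upper[OF UNIV_I null_bdd_above[OF case_nat_null[OF assms]], of "Suc n"]
  by (simp add: M0_norm_def cusp_series_def)

lemma M0_norm_le:
  assumes "\<And>n. norm2 (a n) \<le> e" "0 \<le> e"
  shows "M0_norm (cusp_series a) \<le> e"
  unfolding M0_norm_def cusp_series_def g_coeff_compose
  using assms by (intro cSUP_least) (auto split: nat.split)

lemma M0_norm_nonneg: "F \<in> S0 \<Longrightarrow> 0 \<le> M0_norm F"
  unfolding S0_iff_cusp_series using norm2_le_M0_norm norm2_nonneg order_trans by metis

lemma M0_norm_add: "F \<in> S0 \<Longrightarrow> G \<in> S0 \<Longrightarrow> M0_norm (F + G) \<le> max (M0_norm F) (M0_norm G)"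
proof -
  assume "F \<in> S0" "G \<in> S0"
  then obtain a b where a: "a \<longlonglongrightarrow> 0" "F = cusp_series a" and b: "b \<longlonglongrightarrow> 0" "G = cusp_series b"
    unfolding S0_iff_cusp_series by blast
  have "norm2 (a n + b n) \<le> max (M0_norm F) (M0_norm G)" for n
    using norm2_le_M0_norm[OF a(1), of n] norm2_le_M0_norm[OF b(1), of n]
    unfolding a(2) b(2) by (intro order_trans[OF norm2_ultra]) auto
  moreover have "0 \<le> max (M0_norm F) (M0_norm G)" using M0_norm_nonneg[OF \<open>F \<in> S0\<close>] by simp
  ultimately have "M0_norm (cusp_series (\<lambda>n. a n + b n)) \<le> max (M0_norm F) (M0_norm G)" by (rule M0_norm_le)
  then show ?thesis using a b by (simp add: cusp_series_add)
qed

lemma M0_norm_scale_le: "F \<in> S0 \<Longrightarrow> M0_norm (fps_const c * F) \<le> norm2 c * M0_norm F"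
proof -
  assume F: "F \<in> S0"
  then obtain a where a: "a \<longlonglongrightarrow> 0" "F = cusp_series a" unfolding S0_iff_cusp_series by blast
  have "norm2 (c * a n) \<le> norm2 c * M0_norm F" for n
    using norm2_le_M0_norm[OF a(1), of n] unfolding a(2) norm2_mult by (intro mult_left_mono) auto
  then have "M0_norm (cusp_series (\<lambda>n. c * a n)) \<le> norm2 c * M0_norm F"
    using M0_norm_nonneg[OF F] by (intro M0_norm_le) auto
  then show ?thesis using a by (simp add: cusp_series_scale)
qed

section \<open>Coordinates with respect to an arbitrary orthonormal basis\<close>

context
  fixes e :: "nat \<Rightarrow> Q2 fps"
  assumes onb: "orthonormal_basis S0 M0_norm e"
begin

definition coords :: "Q2 fps \<Rightarrow> nat \<Rightarrow> Q2" where
  "coords v = (THE a. expands_in M0_norm e v a)"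

lemma basis_in_S0: "e j \<in> S0"
  using onb by (auto simp: orthonormal_basis_def)

lemma coords_ex1:
  assumes "v \<in> S0"
  shows "\<exists>!a. expands_in M0_norm e v a"
  using conjunct1[OF bspec[OF conjunct2[OF onb[unfolded orthonormal_basis_def]] assms]] .

lemma coords_unique: "v \<in> S0 \<Longrightarrow> expands_in M0_norm e v a \<Longrightarrow> coords v = a"
  unfolding coords_def by (rule the1_equality[OF coords_ex1])

lemma expands_in_coords: "v \<in> S0 \<Longrightarrow> expands_in M0_norm e v (coords v)"
  unfolding coords_def by (rule theI'[OF coords_ex1])

lemma M0_norm_coords:
  assumes "v \<in> S0"
  shows "M0_norm v = (SUP n. norm2 (coords v n))"
  using conjunct2[OF bspec[OF conjunct2[OF onb[unfolded orthonormal_basis_def]] assms]] expands_in_coords[OF assms]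
  by (metis (no_types))

lemma coords_null: "v \<in> S0 \<Longrightarrow> coords v \<longlonglongrightarrow> 0"
  using expands_in_coords by (simp add: expands_in_def)

lemma norm2_coords_le: "v \<in> S0 \<Longrightarrow> norm2 (coords v n) \<le> M0_norm v"
  unfolding M0_norm_coords by (rule cSUP_upper[OF UNIV_I null_bdd_above[OF coords_null]])

lemma partial_sum_in_S0: "(\<Sum>j<n. fps_const (a j) * e j) \<in> S0"
  by (intro S0_sum S0_scale basis_in_S0)

text \<open>\<open>orthonormal_basis\<close> speaks only of existence, uniqueness and norms of
  expansions, so linearity has to come from uniqueness: the remainders of the termwise sum are
  bounded by the larger of the two given remainders.\<close>

lemma coords_add:
  assumes v: "v \<in> S0" and w: "w \<in> S0"
  shows "coords (v + w) = (\<lambda>i. coords v i + coords w i)"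
proof (rule coords_unique[OF S0_add[OF v w]], unfold expands_in_def, intro conjI)
  show "(\<lambda>i. coords v i + coords w i) \<longlonglongrightarrow> 0" by (intro null_add coords_null v w)
  let ?r = "\<lambda>v n. v - (\<Sum>j<n. fps_const (coords v j) * e j)"
  have eq: "v + w - (\<Sum>j<n. fps_const (coords v j + coords w j) * e j) = ?r v n + ?r w n" for n
    by (simp add: sum.distrib distrib_right flip: fps_const_add)
  have r: "?r v n \<in> S0" "?r w n \<in> S0" for n using v w by (auto intro!: S0_diff partial_sum_in_S0)
  show "(\<lambda>n. M0_norm (v + w - (\<Sum>j<n. fps_const (coords v j + coords w j) * e j))) \<longlonglongrightarrow> 0"
  proof (rule tendsto_sandwich[OF _ _ tendsto_const, of _ _ _ "\<lambda>n. max (M0_norm (?r v n)) (M0_norm (?r w n))"])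
    show "\<forall>\<^sub>F n in sequentially. 0 \<le> M0_norm (v + w - (\<Sum>j<n. fps_const (coords v j + coords w j) * e j))"
      unfolding eq by (intro always_eventually allI M0_norm_nonneg S0_add r)
    show "\<forall>\<^sub>F n in sequentially. M0_norm (v + w - (\<Sum>j<n. fps_const (coords v j + coords w j) * e j))
        \<le> max (M0_norm (?r v n)) (M0_norm (?r w n))"
      unfolding eq by (intro always_eventually allI M0_norm_add r)
    show "(\<lambda>n. max (M0_norm (?r v n)) (M0_norm (?r w n))) \<longlonglongrightarrow> 0"
      using tendsto_max[of "\<lambda>n. M0_norm (?r v n)" 0 _ "\<lambda>n. M0_norm (?r w n)" 0]
        expands_in_coords[OF v] expands_in_coords[OF w] by (simp add: expands_in_def)
  qed
qed

lemma coords_scale: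
  assumes v: "v \<in> S0"
  shows "coords (fps_const c * v) = (\<lambda>i. c * coords v i)"
proof (rule coords_unique[OF S0_scale[OF v]], unfold expands_in_def, intro conjI)
  show "(\<lambda>i. c * coords v i) \<longlonglongrightarrow> 0" by (intro null_scale coords_null v)
  let ?r = "\<lambda>n. v - (\<Sum>j<n. fps_const (coords v j) * e j)"
  have eq: "fps_const c * v - (\<Sum>j<n. fps_const (c * coords v j) * e j) = fps_const c * ?r n" for n
    by (simp add: sum_distrib_left right_diff_distrib mult.assoc flip: fps_const_mult)
  have r: "?r n \<in> S0" for n using v by (auto intro!: S0_diff partial_sum_in_S0)
  show "(\<lambda>n. M0_norm (fps_const c * v - (\<Sum>j<n. fps_const (c * coords v j) * e j))) \<longlonglongrightarrow> 0"
  proof (rule tendsto_sandwich[OF _ _ tendsto_const, of _ _ _ "\<lambda>n. norm2 c * M0_norm (?r n)"])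
    show "\<forall>\<^sub>F n in sequentially. 0 \<le> M0_norm (fps_const c * v - (\<Sum>j<n. fps_const (c * coords v j) * e j))"
      unfolding eq by (intro always_eventually allI M0_norm_nonneg S0_scale r)
    show "\<forall>\<^sub>F n in sequentially. M0_norm (fps_const c * v - (\<Sum>j<n. fps_const (c * coords v j) * e j)) \<le> norm2 c * M0_norm (?r n)"
      unfolding eq by (intro always_eventually allI M0_norm_scale_le r)
    show "(\<lambda>n. norm2 c * M0_norm (?r n)) \<longlonglongrightarrow> 0"
      using expands_in_coords[OF v] by (intro tendsto_mult_right_zero) (simp add: expands_in_def)
  qed
qed

lemma coords_0: "coords 0 = (\<lambda>i. 0)"
  using coords_scale[OF S0_0, of 0] by simp

lemma coords_sum:
  "(\<And>j. j < n \<Longrightarrow> f j \<in> S0) \<Longrightarrow> coords (\<Sum>j<(n::nat). f j) = (\<lambda>i. \<Sum>j<n. coords (f j) i)"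
  by (induction n) (simp_all add: coords_0 coords_add S0_sum)

lemma coords_diff: "v \<in> S0 \<Longrightarrow> w \<in> S0 \<Longrightarrow> coords (v - w) = (\<lambda>i. coords v i - coords w i)"
  using coords_add[of v "fps_const (- 1) * w"] coords_scale[of w "- 1"] S0_scale[of w "- 1"] by (simp add: fps_const_neg_1)

lemma coords_basis: "coords (e k) = (\<lambda>j. if j = k then 1 else 0)"
proof (rule coords_unique[OF basis_in_S0], unfold expands_in_def, intro conjI)
  show "(\<lambda>j. if j = k then 1 else 0 :: Q2) \<longlonglongrightarrow> 0"
    using tendsto_const by (rule Lim_transform_eventually) (auto intro!: eventually_mono[OF eventually_gt_at_top[of k]])
  have "M0_norm (e k - (\<Sum>j<n. fps_const (if j = k then 1 else 0) * e j)) = 0" if "n > k" for n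
  proof -
    have "(\<Sum>j<n. fps_const (if j = k then 1 else 0) * e j) = (\<Sum>j<n. if j = k then e j else 0)"
      by (intro sum.cong) auto
    then have "e k - (\<Sum>j<n. fps_const (if j = k then 1 else 0) * e j) = cusp_series (\<lambda>i. 0)"
      using that by (simp add: cusp_series_0)
    then show ?thesis using M0_norm_le[of "\<lambda>i. 0" 0] M0_norm_nonneg[OF S0_0] by (simp add: cusp_series_0)
  qed
  then show "(\<lambda>n. M0_norm (e k - (\<Sum>j<n. fps_const (if j = k then 1 else 0) * e j))) \<longlonglongrightarrow> 0"
    by (intro Lim_transform_eventually[OF tendsto_const]) (auto intro!: eventually_mono[OF eventually_gt_at_top[of k]])
qed

lemma M0_norm_basis_le: "M0_norm (e k) \<le> 1"
  unfolding M0_norm_coords[OF basis_in_S0] coords_basis by (intro cSUP_least) auto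

end

section \<open>Change of basis\<close>

lemma gq_power_eq_cusp_series: "gq ^ Suc k = cusp_series (\<lambda>i. if i = k then 1 else 0)"
proof -
  have "case_nat 0 (\<lambda>i. if i = k then 1 else 0) = (\<lambda>n. if n = Suc k then 1 else 0 :: Q2)"
    by (auto simp: fun_eq_iff split: nat.split)
  then show ?thesis unfolding gq_power cusp_series_def by simp
qed

lemma unit_null: "(\<lambda>i. if i = k then 1 else 0 :: Q2) \<longlonglongrightarrow> 0"
  using tendsto_const by (rule Lim_transform_eventually) (auto intro!: eventually_mono[OF eventually_gt_at_top[of k]])

lemma cusp_series_expands_in:
  assumes "y \<longlonglongrightarrow> 0"
  shows "expands_in M0_norm (\<lambda>j. gq ^ Suc j) (cusp_series y) y"
  unfolding cusp_series_def
  by (subst S0_expands_in[OF case_nat_null[OF assms]]) (auto simp: fun_eq_iff)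

lemma gq_power_in_S0: "gq ^ Suc k \<in> S0"
  unfolding gq_power_eq_cusp_series by (rule cusp_series_in_S0[OF unit_null])

lemma M0_norm_gq_power_le: "M0_norm (gq ^ Suc k) \<le> 1"
  unfolding gq_power_eq_cusp_series by (rule M0_norm_le) auto

lemma norm2_sum_le_sum: "norm2 (sum f I) \<le> (\<Sum>i\<in>I. norm2 (f i))"
proof (induction I rule: infinite_finite_induct)
  case (insert x F)
  have "norm2 (f x + sum f F) \<le> norm2 (f x) + norm2 (sum f F)"
    by (rule order_trans[OF norm2_ultra]) simp
  then show ?case using insert by simp
qed auto

text \<open>A coordinate is a linear functional bounded by the norm, hence continuous; it is applied
  to the partial sums of the expansion in powers of \<open>gq\<close>.\<close>

lemma coords_cusp_series_LIMSEQ: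
  assumes onb: "orthonormal_basis S0 M0_norm e" and y: "y \<longlonglongrightarrow> 0"
  shows "(\<lambda>n. \<Sum>i<n. coords e (gq ^ Suc i) j * y i) \<longlonglongrightarrow> coords e (cusp_series y) j"
  unfolding norm2_tendsto_iff[of "\<lambda>n. \<Sum>i<n. coords e (gq ^ Suc i) j * y i"]
proof (rule tendsto_sandwich[OF _ _ tendsto_const])
  let ?p = "\<lambda>n. \<Sum>i<n. fps_const (y i) * gq ^ Suc i"
  have p: "?p n \<in> S0" for n by (intro S0_sum S0_scale gq_power_in_S0)
  have v: "cusp_series y \<in> S0" using y by (rule cusp_series_in_S0)
  show "(\<lambda>n. M0_norm (cusp_series y - ?p n)) \<longlonglongrightarrow> 0"
    using cusp_series_expands_in[OF y] by (simp add: expands_in_def)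
  have "norm2 ((\<Sum>i<n. coords e (gq ^ Suc i) j * y i) - coords e (cusp_series y) j) \<le> M0_norm (cusp_series y - ?p n)" for n
  proof -
    have "coords e (?p n) j = (\<Sum>i<n. coords e (gq ^ Suc i) j * y i)"
      by (simp add: coords_sum[OF onb] S0_scale gq_power_in_S0 coords_scale[OF onb] mult.commute del: power_Suc)
    then have "coords e (cusp_series y - ?p n) j = coords e (cusp_series y) j - (\<Sum>i<n. coords e (gq ^ Suc i) j * y i)"
      using coords_diff[OF onb v p] by simp
    moreover have "norm2 (coords e (cusp_series y - ?p n) j) \<le> M0_norm (cusp_series y - ?p n)"
      by (rule norm2_coords_le[OF onb S0_diff[OF v p]])
    ultimately show ?thesis
      unfolding norm2_diff_commute[of "\<Sum>i<n. coords e (gq ^ Suc i) j * y i"] by simp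
  qed
  then show "\<forall>\<^sub>F n in sequentially. norm2 ((\<Sum>i<n. coords e (gq ^ Suc i) j * y i) - coords e (cusp_series y) j)
      \<le> M0_norm (cusp_series y - ?p n)" by simp
qed simp

text \<open>
  If \<open>W\<close> expresses the basis \<open>e\<close> in the powers of \<open>gq\<close> and \<open>V\<close> is its inverse, then the matrices of
  \<open>T\<close> in the two bases are \<open>V * (A * W)\<close> and \<open>(A * W) * V\<close>.
\<close>

lemma fredholm_det_op_matrix:
  assumes onb: "orthonormal_basis S0 M0_norm e"
    and A: "compact_matrix A" "\<And>i j. j \<ge> r i \<Longrightarrow> A i j = 0"
    and T: "\<And>a. a \<longlonglongrightarrow> 0 \<Longrightarrow> T (cusp_series a) = cusp_series (\<lambda>i. \<Sum>j<r i. A i j * a j)"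
  shows "fredholm_det (op_matrix M0_norm e T) = fredholm_det A"
proof -
  have "\<exists>a. a \<longlonglongrightarrow> 0 \<and> e k = cusp_series a" for k
    using basis_in_S0[OF onb, of k] by (simp add: S0_iff_cusp_series)
  then obtain w where w: "\<And>k. w k \<longlonglongrightarrow> 0" "\<And>k. e k = cusp_series (w k)" by metis
  have w1: "norm2 (w k i) \<le> 1" for k i
    using norm2_le_M0_norm[OF w(1), of k i] M0_norm_basis_le[OF onb, of k] by (simp add: w(2))
  define V where "V k = coords e (gq ^ Suc k)" for k
  have V1: "norm2 (V k i) \<le> 1" for k i
    unfolding V_def using norm2_coords_le[OF onb gq_power_in_S0] M0_norm_gq_power_le by (rule order_trans)
  have V0: "V k \<longlonglongrightarrow> 0" for k unfolding V_def by (rule coords_null[OF onb gq_power_in_S0])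
  define Y where "Y i k = (\<Sum>l<r i. A i l * w k l)" for i k
  have A1: "norm2 (A i j) \<le> 1" for i j using A(1) by (simp add: compact_matrix_def)
  have Ye: "norm2 (Y i k) \<le> d" if "\<And>j. norm2 (A i j) \<le> d" for i k d
    unfolding Y_def
  proof (rule norm2_sum_le)
    show "0 \<le> d" using that[of 0] norm2_nonneg[of "A i 0"] by linarith
  qed (intro norm2_mult_le_right w1 that)
  have Y: "compact_matrix Y"
    unfolding compact_matrix_def
  proof (intro conjI allI impI)
    show "norm2 (Y i j) \<le> 1" for i j by (rule Ye[OF A1])
    fix d :: real assume "d > 0"
    then obtain N where "\<And>i j. i \<ge> N \<Longrightarrow> norm2 (A i j) \<le> d"
      using A(1) unfolding compact_matrix_def by blast
    then have "\<forall>i\<ge>N. \<forall>j. norm2 (Y i j) \<le> d" using Ye by simp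
    then show "\<exists>N. \<forall>i\<ge>N. \<forall>j. norm2 (Y i j) \<le> d" by blast
  qed
  have Y0: "(\<lambda>i. Y i k) \<longlonglongrightarrow> 0" for k
    unfolding Q2_tendsto_0_iff
  proof (rule LIMSEQ_I)
    fix d :: real assume "d > 0"
    then obtain N where "\<And>i j. i \<ge> N \<Longrightarrow> norm2 (Y i j) \<le> d / 2"
      using Y unfolding compact_matrix_def by (metis half_gt_zero)
    then have "norm (norm2 (Y i k) - 0) < d" if "i \<ge> N" for i
      using \<open>d > 0\<close> that order.strict_trans1[of "norm2 (Y i k)" "d / 2" d] by simp
    then show "\<exists>no. \<forall>i\<ge>no. norm (norm2 (Y i k) - 0) < d" by blast
  qed
  have Te: "T (e k) = cusp_series (\<lambda>i. Y i k)" for k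
    unfolding w(2) Y_def by (rule T[OF w(1)])
  \<comment> \<open>\<open>Y = A * W\<close> is compact because \<open>A\<close> is, while
    \<open>V\<close> is only bounded with null columns; these are the two roles in
    \<open>fredholm_det_commute\<close>.\<close>
  show ?thesis
  proof (rule fredholm_det_commute[of "\<lambda>j i. V i j" Y])
    show "(\<lambda>n. \<Sum>i<n. V i j * Y i k) \<longlonglongrightarrow> op_matrix M0_norm e T j k" for j k
      using coords_cusp_series_LIMSEQ[OF onb Y0, of j k]
      by (simp add: op_matrix_def Te V_def coords_def[OF onb] del: power_Suc)
  next
    fix i k
    let ?s = "\<lambda>n l. \<Sum>j<n. V k j * w j l"
    \<comment> \<open>The difference is, up to sign, a coefficient of the remainder when
      \<open>gq ^ Suc k\<close> is expanded in \<open>e\<close>. In the limit \<open>W * V\<close>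
      is the identity, entry by entry.\<close>
    have s: "(\<lambda>n. norm2 (?s n l - (if l = k then 1 else 0))) \<longlonglongrightarrow> 0" for l
    proof (rule tendsto_sandwich[OF _ _ tendsto_const])
      let ?R = "\<lambda>n. gq ^ Suc k - (\<Sum>j<n. fps_const (V k j) * e j)"
      show "(\<lambda>n. M0_norm (?R n)) \<longlonglongrightarrow> 0"
        using expands_in_coords[OF onb gq_power_in_S0, of k] by (simp add: expands_in_def V_def)
      have "norm2 (?s n l - (if l = k then 1 else 0)) \<le> M0_norm (?R n)" for n
      proof -
        have R: "?R n = cusp_series (\<lambda>l. (if l = k then 1 else 0) - ?s n l)"
          unfolding cusp_series_diff cusp_series_sum gq_power_eq_cusp_series
          by (simp add: w(2) cusp_series_scale)
        have "(\<lambda>l. ?s n l) \<longlonglongrightarrow> 0"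
        proof (induction n)
          case (Suc n)
          from null_add[OF Suc null_scale[OF w(1)]] show ?case by simp
        qed simp
        then have "(\<lambda>l. (if l = k then 1 else 0) + - 1 * ?s n l) \<longlonglongrightarrow> 0"
          by (intro null_add null_scale unit_null)
        then have "(\<lambda>l. (if l = k then 1 else 0) - ?s n l) \<longlonglongrightarrow> 0" by simp
        from norm2_le_M0_norm[OF this, of l] show ?thesis unfolding R by (simp only: norm2_diff_commute)
      qed
      then show "\<forall>\<^sub>F n in sequentially. norm2 (?s n l - (if l = k then 1 else 0)) \<le> M0_norm (?R n)" by simp
    qed simp
    \<comment> \<open>Row \<open>i\<close> of \<open>A\<close> ends at \<open>r i\<close>, so
      entrywise convergence is enough to pass to the limit in the product with
      \<open>A\<close>.\<close>
    have "(\<lambda>n. \<Sum>l<r i. norm2 (?s n l - (if l = k then 1 else 0))) \<longlonglongrightarrow> (\<Sum>l<r i. 0)"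
      by (intro tendsto_sum s)
    then have lim: "(\<lambda>n. \<Sum>l<r i. norm2 (?s n l - (if l = k then 1 else 0))) \<longlonglongrightarrow> 0" by simp
    have Aik: "A i k = (\<Sum>l<r i. A i l * (if l = k then 1 else 0))"
      using A(2)[of i k] by (simp add: if_distrib[of "\<lambda>x. _ * x"] cong: if_cong)
    have "norm2 ((\<Sum>j<n. Y i j * V k j) - A i k) \<le> (\<Sum>l<r i. norm2 (?s n l - (if l = k then 1 else 0)))" for n
    proof -
      have "(\<Sum>j<n. Y i j * V k j) = (\<Sum>j<n. \<Sum>l<r i. A i l * (V k j * w j l))"
        by (simp add: Y_def sum_distrib_left sum_distrib_right mult_ac)
      also have "\<dots> = (\<Sum>l<r i. A i l * ?s n l)"
        by (subst sum.swap) (simp add: sum_distrib_left)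
      finally have "(\<Sum>j<n. Y i j * V k j) - A i k = (\<Sum>l<r i. A i l * (?s n l - (if l = k then 1 else 0)))"
        unfolding Aik by (simp only: sum_subtractf right_diff_distrib)
      also have "norm2 \<dots> \<le> (\<Sum>l<r i. norm2 (A i l * (?s n l - (if l = k then 1 else 0))))"
        by (rule norm2_sum_le_sum)
      also have "\<dots> \<le> (\<Sum>l<r i. norm2 (?s n l - (if l = k then 1 else 0)))"
        by (intro sum_mono norm2_mult_le_left A1 order_refl)
      finally show ?thesis .
    qed
    then show "(\<lambda>n. \<Sum>j<n. Y i j * V k j) \<longlonglongrightarrow> A i k"
      unfolding norm2_tendsto_iff[of "\<lambda>n. \<Sum>j<n. Y i j * V k j"]
      by (intro tendsto_sandwich[OF _ _ tendsto_const lim]) auto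
  qed (use V1 V0 Y in auto)
qed

text \<open>All bases give the same series, and \<open>orthonormal_basis_gq\<close> provides one
  basis, without which every series would satisfy the description.\<close>

lemma char_series_eq:
  assumes "compact_matrix A" "\<And>i j. j \<ge> r i \<Longrightarrow> A i j = 0"
    and "\<And>a. a \<longlonglongrightarrow> 0 \<Longrightarrow> T (cusp_series a) = cusp_series (\<lambda>i. \<Sum>j<r i. A i j * a j)"
  shows "char_series S0 M0_norm T = fredholm_det A"
  unfolding char_series_def
proof (rule the_equality)
  show "\<forall>e. orthonormal_basis S0 M0_norm e \<longrightarrow> fredholm_det A = fredholm_det (op_matrix M0_norm e T)"
    using fredholm_det_op_matrix[OF _ assms] by simp
  then show "P = fredholm_det A"
    if "\<forall>e. orthonormal_basis S0 M0_norm e \<longrightarrow> P = fredholm_det (op_matrix M0_norm e T)" for P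
    using that orthonormal_basis_gq by simp
qed

lemma newton_polygon_cong:
  assumes "\<And>m. norm2 (fps_nth P m) = norm2 (fps_nth Q m)"
  shows "newton_polygon P = newton_polygon Q"
proof -
  have "v2 (fps_nth P m) = v2 (fps_nth Q m)" for m by (simp add: v2_def assms)
  moreover have "fps_nth P m = 0 \<longleftrightarrow> fps_nth Q m = 0" for m by (metis assms norm2_eq_0_iff)
  ultimately show ?thesis unfolding newton_polygon_def by simp
qed

section \<open>Euler's product and theta series\<close>

definition dilate :: "'a::field_char_0 fps \<Rightarrow> 'a fps" where
  "dilate f = f oo fps_X ^ 2"

definition twist :: "'a::field_char_0 fps \<Rightarrow> 'a fps" where
  "twist f = f oo (- fps_X)"

lemma dilate_nth: "fps_nth (dilate f) n = (if even n then fps_nth f (n div 2) else 0)"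
proof -
  have "fps_nth (dilate f) n = (\<Sum>i=0..n. if 2 * i = n then fps_nth f i else 0)"
    unfolding dilate_def fps_compose_nth power_mult[symmetric]
    by (intro sum.cong) (auto simp: fps_X_power_nth)
  also have "\<dots> = (if even n then fps_nth f (n div 2) else 0)"
  proof (cases "even n")
    case True
    then obtain k where k: "n = 2 * k" by blast
    have "(\<Sum>i=0..n. if 2 * i = n then fps_nth f i else 0) = (\<Sum>i=0..n. if i = k then fps_nth f i else 0)"
      by (intro sum.cong) (auto simp: k)
    then show ?thesis by (simp add: k)
  next
    case False
    then show ?thesis by (auto intro!: sum.neutral)
  qed
  finally show ?thesis .
qed

lemma twist_nth: "fps_nth (twist f) n = (- 1) ^ n * fps_nth f n"
  by (simp add: twist_def fps_compose_uminus')

lemma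
  shows dilate_mult: "dilate (f * g) = dilate f * dilate g"
    and dilate_power: "dilate (f ^ n) = dilate f ^ n"
    and dilate_add: "dilate (f + g) = dilate f + dilate g"
    and dilate_diff: "dilate (f - g) = dilate f - dilate g"
    and dilate_X: "dilate fps_X = fps_X ^ 2"
    and dilate_1: "dilate 1 = 1"
    and dilate_numeral: "dilate (numeral w) = numeral w"
  by (simp_all add: dilate_def fps_compose_mult_distrib fps_compose_power fps_compose_add_distrib
      fps_compose_sub_distrib numeral_fps_const)

lemma dilate_X_power: "dilate (fps_X ^ m) = (fps_X ^ m) ^ 2"
  by (simp add: dilate_power dilate_X mult.commute flip: power_mult)

lemma
  shows twist_mult: "twist (f * g) = twist f * twist g"
    and twist_power: "twist (f ^ n) = twist f ^ n"
    and twist_diff: "twist (f - g) = twist f - twist g"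
    and twist_X: "twist fps_X = - fps_X"
    and twist_1: "twist 1 = 1"
  by (simp_all add: twist_def fps_compose_mult_distrib fps_compose_power fps_compose_add_distrib
      fps_compose_sub_distrib numeral_fps_const)

lemma twist_dilate: "twist (dilate f) = dilate f"
  by (simp add: fps_eq_iff twist_nth dilate_nth)

lemma twist_twist: "twist (twist f) = f"
  by (simp add: fps_eq_iff twist_nth flip: mult.assoc power_mult_distrib)

lemma dilate_prod: "dilate (prod f I) = (\<Prod>i\<in>I. dilate (f i))"
  by (induction I rule: infinite_finite_induct) (simp_all add: dilate_mult dilate_1)

lemma twist_prod: "twist (prod f I) = (\<Prod>i\<in>I. twist (f i))"
  by (induction I rule: infinite_finite_induct) (simp_all add: twist_mult twist_1)

text \<open>Congruence modulo \<open>fps_X ^ (N + 1)\<close>. Identities between infinite products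
  are proved by checking it for every \<open>N\<close> on finite products.\<close>

definition fps_agree :: "nat \<Rightarrow> 'a::field_char_0 fps \<Rightarrow> 'a fps \<Rightarrow> bool" where
  "fps_agree N f g \<longleftrightarrow> (\<forall>k\<le>N. fps_nth f k = fps_nth g k)"

lemma fps_agree_refl: "fps_agree N f f"
  by (simp add: fps_agree_def)

lemma fps_agree_sym: "fps_agree N f g \<Longrightarrow> fps_agree N g f"
  by (simp add: fps_agree_def)

lemma fps_agree_trans: "fps_agree N f g \<Longrightarrow> fps_agree N g h \<Longrightarrow> fps_agree N f h"
  by (simp add: fps_agree_def)

lemma fps_agree_mono: "fps_agree N f g \<Longrightarrow> M \<le> N \<Longrightarrow> fps_agree M f g"
  by (simp add: fps_agree_def)

lemma fps_agree_mult: "fps_agree N f g \<Longrightarrow> fps_agree N f' g' \<Longrightarrow> fps_agree N (f * f') (g * g')"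
  unfolding fps_agree_def fps_mult_nth by (intro allI impI sum.cong) auto

lemma fps_agree_dilate: "fps_agree N f g \<Longrightarrow> fps_agree N (dilate f) (dilate g)"
  by (auto simp: fps_agree_def dilate_nth)

lemma fps_agree_twist: "fps_agree N f g \<Longrightarrow> fps_agree N (twist f) (twist g)"
  by (auto simp: fps_agree_def twist_nth)

lemma fps_agree_eqI: "(\<And>N. fps_agree N f g) \<Longrightarrow> f = g"
  by (auto simp: fps_agree_def fps_eq_iff)

definition euler_partial :: "nat \<Rightarrow> 'a::field_char_0 fps" where
  "euler_partial n = (\<Prod>i<n. 1 - fps_X ^ Suc i)"

text \<open>The coefficient of index \<open>k\<close> no longer changes from the \<open>k\<close>-th
  partial product on, so a diagonal choice yields the infinite product.\<close>

definition euler :: "'a::field_char_0 fps" where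
  "euler = Abs_fps (\<lambda>k. fps_nth (euler_partial k) k)"

lemma euler_partial_agree: "fps_agree n (euler_partial n) euler"
proof -
  have "fps_nth (euler_partial n :: 'a fps) k = fps_nth (euler_partial k) k" if "k \<le> n" for k :: nat
    using that
  proof (induction n rule: dec_induct)
    case (step n)
    have "euler_partial (Suc n) = euler_partial n - fps_X ^ Suc n * (euler_partial n :: 'a fps)"
      by (simp add: euler_partial_def algebra_simps del: power_Suc)
    then show ?case using step by (simp add: fps_X_power_mult_nth del: power_Suc)
  qed simp
  then show ?thesis by (simp add: fps_agree_def euler_def)
qed

lemma euler_nth_0 [simp]: "fps_nth euler 0 = 1"
  by (simp add: euler_def euler_partial_def)

lemma euler_nth_1: "fps_nth euler (Suc 0) = - 1"
  by (simp add: euler_def euler_partial_def)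

lemma dilate_eq_0_iff: "dilate f = 0 \<longleftrightarrow> f = 0"
proof
  assume d: "dilate f = 0"
  have "fps_nth f n = 0" for n using arg_cong[OF d, of "\<lambda>f. fps_nth f (2 * n)"] by (simp add: dilate_nth)
  then show "f = 0" by (simp add: fps_eq_iff)
qed (simp add: fps_eq_iff dilate_nth)

text \<open>The product of the \<open>1 - fps_X ^ n\<close> over odd \<open>n\<close>, as the
  quotient of the full product by its even part.\<close>

definition odd_euler :: "'a::field_char_0 fps" where
  "odd_euler = euler * inverse (dilate euler)"

lemma dilate_euler_nth_0: "fps_nth (dilate euler) 0 = 1"
  by (simp add: dilate_nth)

lemma odd_euler_mult_dilate_euler: "odd_euler * dilate euler = euler"
  by (simp add: odd_euler_def mult.assoc inverse_mult_eq_1 dilate_euler_nth_0)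

lemma odd_euler_nth_0: "fps_nth odd_euler 0 = 1"
  by (simp add: odd_euler_def dilate_euler_nth_0)

lemma odd_euler_nth_1: "fps_nth odd_euler (Suc 0) = - 1"
  using arg_cong[OF odd_euler_mult_dilate_euler, of "\<lambda>f. fps_nth f (Suc 0)"]
  by (simp add: fps_mult_nth dilate_nth euler_nth_1 odd_euler_nth_0)

lemma euler_partial_double: "euler_partial (2 * n) = (\<Prod>i<n. 1 - fps_X ^ (2 * i + 1)) * dilate (euler_partial n)"
proof -
  have "dilate (1 - fps_X ^ Suc i) = (1 - fps_X ^ Suc (Suc (2 * i)) :: 'a fps)" for i
    by (simp add: dilate_diff dilate_1 dilate_power dilate_X flip: power_mult del: power_Suc)
  then show ?thesis
    unfolding euler_partial_def dilate_prod by (induction n) (simp_all add: mult_ac del: power_Suc)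
qed

lemma odd_euler_agree: "fps_agree n (\<Prod>i<n. 1 - fps_X ^ (2 * i + 1)) odd_euler"
proof -
  let ?P = "\<Prod>i<n. 1 - fps_X ^ (2 * i + 1) :: 'a fps"
  have "fps_agree n (?P * dilate euler) (?P * dilate (euler_partial n))"
    by (intro fps_agree_mult fps_agree_dilate fps_agree_refl fps_agree_sym[OF euler_partial_agree])
  moreover have "fps_agree n (?P * dilate (euler_partial n)) euler"
    using fps_agree_mono[OF euler_partial_agree[of "2 * n"], of n] by (simp add: euler_partial_double)
  ultimately have "fps_agree n (?P * dilate euler) euler" by (rule fps_agree_trans)
  then have "fps_agree n (?P * dilate euler * inverse (dilate euler)) odd_euler"
    unfolding odd_euler_def by (intro fps_agree_mult fps_agree_refl)
  moreover have "dilate euler * inverse (dilate euler) = (1 :: 'a fps)"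
    by (simp add: dilate_euler_nth_0 inverse_mult_eq_1')
  ultimately show ?thesis by (simp add: mult.assoc)
qed

text \<open>For odd exponents the twist turns \<open>1 - fps_X ^ n\<close> into
  \<open>1 + fps_X ^ n\<close>, and the two multiply to \<open>1 - (fps_X ^ n) ^ 2\<close>.\<close>

lemma odd_euler_twist: "odd_euler * twist odd_euler = dilate odd_euler"
proof (rule fps_agree_eqI)
  fix n
  let ?P = "\<Prod>i<n. 1 - fps_X ^ (2 * i + 1) :: 'a fps"
  have tw: "twist (1 - fps_X ^ (2 * i + 1)) = (1 + fps_X ^ (2 * i + 1) :: 'a fps)" for i
    by (simp add: twist_diff twist_1 twist_power twist_X del: power_Suc)
  have "(1 - fps_X ^ (2 * i + 1)) * (1 + fps_X ^ (2 * i + 1)) = dilate (1 - fps_X ^ (2 * i + 1) :: 'a fps)" for i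
  proof -
    have "(1 - x) * (1 + x) = 1 - x ^ 2" for x :: "'a fps"
      by (simp add: algebra_simps power2_eq_square)
    then show ?thesis by (simp only: dilate_diff dilate_1 dilate_X_power)
  qed
  then have "?P * twist ?P = dilate ?P"
    unfolding twist_prod dilate_prod tw by (simp only: prod.distrib[symmetric])
  moreover have "fps_agree n (odd_euler * twist odd_euler) (?P * twist ?P)"
    by (intro fps_agree_mult fps_agree_twist fps_agree_sym[OF odd_euler_agree])
  ultimately have "fps_agree n (odd_euler * twist odd_euler) (dilate ?P)" by simp
  then show "fps_agree n (odd_euler * twist odd_euler) (dilate odd_euler :: 'a fps)"
    by (rule fps_agree_trans[OF _ fps_agree_dilate[OF odd_euler_agree]])
qed

section \<open>Theta series and sums of two squares\<close>

definition theta :: "'a::field_char_0 fps" where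
  "theta = Abs_fps (\<lambda>n. of_nat (card {a::int. a ^ 2 = int n}))"

lemma finite_int_square_roots: "finite {a::int. a ^ 2 = int n}"
proof (rule finite_subset)
  show "{a::int. a ^ 2 = int n} \<subseteq> {- int n..int n}"
  proof
    fix a :: int assume "a \<in> {a. a ^ 2 = int n}"
    then have "\<bar>a\<bar> * \<bar>a\<bar> = int n" by (simp add: power2_eq_square)
    moreover have "\<bar>a\<bar> \<le> \<bar>a\<bar> * \<bar>a\<bar>" using mult_left_mono[of 1 "\<bar>a\<bar>" "\<bar>a\<bar>"] by (cases "a = 0") auto
    ultimately show "a \<in> {- int n..int n}" by auto
  qed
qed simp

lemma card_int_square_roots:
  "card {a::int. a ^ 2 = int n} = (if n = 0 then 1 else if \<exists>t. n = t ^ 2 then 2 else 0)"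
proof -
  consider "n = 0" | t where "n > 0" "n = t ^ 2" | "n > 0" "\<nexists>t. n = t ^ 2" by blast
  then show ?thesis
  proof cases
    case (2 t)
    then have "{a::int. a ^ 2 = int n} = {int t, - int t}" by (auto simp: power2_eq_iff)
    then show ?thesis using 2 by auto
  next
    case 3
    have "a ^ 2 \<noteq> int n" for a :: int
    proof
      assume "a ^ 2 = int n"
      then have "int (nat \<bar>a\<bar> ^ 2) = int n" by simp
      then show False using 3(2) by (metis of_nat_eq_iff)
    qed
    then show ?thesis using 3 by simp
  qed simp
qed

lemma theta_power2_nth:
  "fps_nth (theta ^ 2 :: 'a::field_char_0 fps) n = of_nat (card {(a::int, b::int). a ^ 2 + b ^ 2 = int n})"
proof -
  let ?A = "\<lambda>i. {a::int. a ^ 2 = int i}"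
  have eq: "{(a::int, b::int). a ^ 2 + b ^ 2 = int n} = (\<Union>i\<in>{0..n}. ?A i \<times> ?A (n - i))"
  proof (intro equalityI subsetI)
    fix p assume "p \<in> {(a::int, b::int). a ^ 2 + b ^ 2 = int n}"
    then obtain a b where p: "p = (a, b)" "a ^ 2 + b ^ 2 = int n" by blast
    have nn: "0 \<le> a ^ 2" "0 \<le> b ^ 2" by simp_all
    then have "nat (a ^ 2) \<le> n" "a ^ 2 = int (nat (a ^ 2))" "b ^ 2 = int (n - nat (a ^ 2))"
      using p(2) by linarith+
    then show "p \<in> (\<Union>i\<in>{0..n}. ?A i \<times> ?A (n - i))" by (auto simp: p(1) intro!: bexI[of _ "nat (a ^ 2)"])
  qed auto
  have "card (\<Union>i\<in>{0..n}. ?A i \<times> ?A (n - i)) = (\<Sum>i\<in>{0..n}. card (?A i \<times> ?A (n - i)))"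
  proof (rule card_UN_disjoint)
    show "\<forall>i\<in>{0..n}. finite (?A i \<times> ?A (n - i))"
      by (intro ballI finite_cartesian_product finite_int_square_roots)
  qed auto
  also have "of_nat \<dots> = (\<Sum>i=0..n. of_nat (card (?A i)) * of_nat (card (?A (n - i))) :: 'a)"
    by (simp only: card_cartesian_product of_nat_sum of_nat_mult)
  also have "\<dots> = fps_nth (theta ^ 2) n"
    unfolding power2_eq_square[of "theta :: 'a fps"] by (simp only: fps_mult_nth theta_def fps_nth_Abs_fps)
  finally show ?thesis unfolding eq ..
qed

text \<open>The map \<open>(a, b)\<close> to \<open>(a + b, a - b)\<close> is multiplication by 1 +
  i on Gaussian integers up to the order of the parts. It is onto, since an even sum of two squares
  forces equal parities.\<close>

lemma card_two_squares_double:
  "card {(a::int, b::int). a ^ 2 + b ^ 2 = int (2 * n)} = card {(a::int, b::int). a ^ 2 + b ^ 2 = int n}"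
proof (rule bij_betw_same_card[symmetric])
  have par: "2 * ((a + b) div 2) = a + b \<and> 2 * ((a - b) div 2) = a - b"
    if "a ^ 2 + b ^ 2 = int (2 * n)" for a b :: int
  proof -
    have "even (a ^ 2 + b ^ 2)" using that by simp
    then have "even (a + b)" "even (a - b)" by auto
    then show ?thesis by auto
  qed
  show "bij_betw (\<lambda>(a, b). (a + b, a - b)) {(a::int, b::int). a ^ 2 + b ^ 2 = int n}
      {(a::int, b::int). a ^ 2 + b ^ 2 = int (2 * n)}"
  proof (rule bij_betw_byWitness[where f' = "\<lambda>(a, b). ((a + b) div 2, (a - b) div 2)"])
    show "\<forall>p\<in>{(a::int, b::int). a ^ 2 + b ^ 2 = int (2 * n)}.
        (\<lambda>(a, b). (a + b, a - b)) ((\<lambda>(a, b). ((a + b) div 2, (a - b) div 2)) p) = p"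
    proof (rule ballI)
      fix p assume "p \<in> {(a::int, b::int). a ^ 2 + b ^ 2 = int (2 * n)}"
      then obtain a b where p: "p = (a, b)" "a ^ 2 + b ^ 2 = int (2 * n)" by blast
      from par[OF p(2)] have "(a + b) div 2 + (a - b) div 2 = a" "(a + b) div 2 - (a - b) div 2 = b"
        by linarith+
      then show "(\<lambda>(a, b). (a + b, a - b)) ((\<lambda>(a, b). ((a + b) div 2, (a - b) div 2)) p) = p"
        by (simp add: p(1))
    qed
    show "(\<lambda>(a, b). (a + b, a - b)) ` {(a::int, b::int). a ^ 2 + b ^ 2 = int n} \<subseteq> {(a, b). a ^ 2 + b ^ 2 = int (2 * n)}"
      by (auto simp: power2_eq_square algebra_simps)
    show "(\<lambda>(a, b). ((a + b) div 2, (a - b) div 2)) ` {(a::int, b::int). a ^ 2 + b ^ 2 = int (2 * n)} \<subseteq> {(a, b). a ^ 2 + b ^ 2 = int n}"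
    proof (rule image_subsetI)
      fix p assume "p \<in> {(a::int, b::int). a ^ 2 + b ^ 2 = int (2 * n)}"
      then obtain a b where p: "p = (a, b)" and ab: "a ^ 2 + b ^ 2 = int (2 * n)" by blast
      define c where "c = (a + b) div 2"
      define d where "d = (a - b) div 2"
      have a: "a = c + d" and b: "b = c - d" using par[OF ab] by (auto simp: c_def d_def)
      have "a ^ 2 + b ^ 2 = 2 * (c ^ 2 + d ^ 2)" unfolding a b by (simp add: power2_eq_square algebra_simps)
      then have "2 * (c ^ 2 + d ^ 2) = 2 * int n" using ab by simp
      then show "(\<lambda>(a, b). ((a + b) div 2, (a - b) div 2)) p \<in> {(a, b). a ^ 2 + b ^ 2 = int n}"
        by (simp add: p c_def d_def)
    qed
  qed auto
qed

text \<open>Adding the twist doubles the even coefficients and kills the odd ones; the even ones are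
  numbers of representations by two squares, which do not change when the argument is
  doubled.\<close>

lemma theta_duplication: "theta ^ 2 + twist theta ^ 2 = 2 * dilate (theta ^ 2)"
proof (rule fps_ext)
  fix n
  show "fps_nth (theta ^ 2 + twist theta ^ 2) n = fps_nth (2 * dilate (theta ^ 2)) n"
    using card_two_squares_double[of "n div 2"]
    by (auto simp: dilate_nth twist_nth theta_power2_nth numeral_fps_const simp flip: twist_power elim!: evenE)
qed

text \<open>A finite form of Gauss's identity for the square theta series, in the manner of Shanks.\<close>

lemma gauss_square_partial_sum:
  fixes x :: "'a::comm_ring_1"
  shows "(\<Prod>i=1..n. 1 + x ^ i) * (1 + 2 * (\<Sum>s=1..n. (- 1) ^ s * x ^ (s ^ 2))) =
    (\<Sum>s<Suc n. (- 1) ^ s * x ^ (s * Suc n) * (\<Prod>i=Suc s..n. 1 - x ^ i) * (\<Prod>i<s. 1 + x ^ i))"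
proof (induction n)
  case 0
  then show ?case by simp
next
  case (Suc n)
  let ?m = "Suc n"
  let ?A = "\<lambda>n s. \<Prod>i=Suc s..n. 1 - x ^ i" and ?B = "\<lambda>s. \<Prod>i<s. 1 + x ^ i"
  let ?R = "\<lambda>n. \<Prod>i=1..n. 1 + x ^ i"
  let ?t = "\<lambda>n s. (- 1) ^ s * x ^ (s * Suc n) * ?A n s * ?B s"
  \<comment> \<open>The telescoping term. Its product starts at \<open>i = s\<close>, so at
    \<open>s = 0\<close> the factor \<open>1 - x ^ 0\<close> makes it vanish.\<close>
  let ?T = "\<lambda>s. (- 1) ^ s * x ^ (s * ?m) * (\<Prod>i=s..n. 1 - x ^ i) * ?B s"
  have step: "?t ?m s = (1 + x ^ ?m) * ?t n s + (?T (Suc s) - ?T s)" if "s < Suc n" for s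
  proof -
    have 1: "?A ?m s = ?A n s * (1 - x ^ ?m)" using that by (simp add: prod.nat_ivl_Suc' mult.commute del: power_Suc)
    have 2: "(\<Prod>i=s..n. 1 - x ^ i) = (1 - x ^ s) * ?A n s"
      using that by (intro prod.atLeast_Suc_atMost) simp
    have 3: "?B (Suc s) = ?B s * (1 + x ^ s)" by simp
    have 4: "x ^ (s * Suc ?m) = x ^ s * x ^ (s * ?m)" "x ^ (Suc s * ?m) = x ^ ?m * x ^ (s * ?m)"
      by (simp_all add: power_add)
    have 5: "(- 1 :: 'a) ^ Suc s = - ((- 1) ^ s)" by simp
    show ?thesis unfolding 1 2 3 4 5 by (simp add: algebra_simps del: power_Suc)
  qed
  \<comment> \<open>The factor for \<open>i = 0\<close> is \<open>1 + x ^ 0 = 2\<close>; it is the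
    source of the 2 in front of the theta sum.\<close>
  have B: "?B (Suc ?m) = 2 * ?R ?m"
    by (subst prod.lessThan_Suc_shift) (simp add: prod.atLeast1_atMost_eq)
  have "(\<Sum>s<Suc ?m. ?t ?m s) = (\<Sum>s<Suc n. (1 + x ^ ?m) * ?t n s + (?T (Suc s) - ?T s)) + ?t ?m ?m"
    unfolding sum.lessThan_Suc[of _ ?m] by (intro arg_cong2[where f = "(+)"] sum.cong step) auto
  also have "\<dots> = (1 + x ^ ?m) * (\<Sum>s<Suc n. ?t n s) + (?T ?m - ?T 0) + ?t ?m ?m"
    unfolding sum.distrib sum_distrib_left[symmetric] sum_lessThan_telescope[of ?T "Suc n"] ..
  also have "?T 0 = 0" by (simp add: prod.atLeast_Suc_atMost)
  also have "?T ?m = (- 1) ^ ?m * x ^ (?m ^ 2) * ?B ?m" by (simp add: power2_eq_square)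
  also have "?t ?m ?m = (- 1) ^ ?m * x ^ (?m ^ 2) * (x ^ ?m * ?B ?m)"
    by (simp add: power2_eq_square power_add mult_ac)
  also have "(1 + x ^ ?m) * (\<Sum>s<Suc n. ?t n s) + ((- 1) ^ ?m * x ^ (?m ^ 2) * ?B ?m - 0) + (- 1) ^ ?m * x ^ (?m ^ 2) * (x ^ ?m * ?B ?m) =
      (1 + x ^ ?m) * (\<Sum>s<Suc n. ?t n s) + (- 1) ^ ?m * x ^ (?m ^ 2) * ?B (Suc ?m)"
    unfolding prod.lessThan_Suc[of _ ?m] by (simp add: algebra_simps del: power_Suc)
  also have "\<dots> = ?R ?m * (1 + 2 * (\<Sum>s=1..?m. (- 1) ^ s * x ^ (s ^ 2)))"
    unfolding B Suc.IH[symmetric] by (simp add: algebra_simps del: power_Suc)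
  finally show ?case by simp
qed

lemma twist_theta_agree:
  "fps_agree n (1 + 2 * (\<Sum>s=1..n. (- 1) ^ s * fps_X ^ (s ^ 2))) (twist theta)"
  unfolding fps_agree_def
proof (intro allI impI)
  fix k assume k: "k \<le> n"
  have c: "fps_nth ((- 1) ^ s * fps_X ^ (s ^ 2)) k = (if s ^ 2 = k then (- 1) ^ s else 0 :: 'a)" for s
    by (auto simp: fps_X_power_nth minus_one_power_iff)
  have "fps_nth (1 + 2 * (\<Sum>s=1..n. (- 1) ^ s * fps_X ^ (s ^ 2))) k =
      (if k = 0 then 1 else 0) + 2 * (\<Sum>s=1..n. if s ^ 2 = k then (- 1) ^ s else 0 :: 'a)"
    unfolding numeral_fps_const by (simp add: fps_sum_nth c)
  also have "\<dots> = (- 1) ^ k * of_nat (card {a::int. a ^ 2 = int k})"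
  proof (cases "\<exists>t. k = t ^ 2")
    case True
    then obtain t where t: "k = t ^ 2" by blast
    have "(\<Sum>s=1..n. if s ^ 2 = k then (- 1) ^ s else 0 :: 'a) = (\<Sum>s=1..n. if s = t then (- 1) ^ s else 0)"
      by (intro sum.cong) (auto simp: t)
    moreover have "t \<le> n" using k self_le_power[of t 2] by (cases "t = 0") (auto simp: t)
    moreover have "(- 1 :: 'a) ^ (t ^ 2) = (- 1) ^ t" by (simp add: minus_one_power_iff)
    moreover have "card {a::int. a ^ 2 = int k} = (if t = 0 then 1 else 2)"
      unfolding card_int_square_roots by (auto simp: t)
    ultimately show ?thesis by (auto simp del: of_nat_power simp: t)
  next
    case False
    then have "(\<Sum>s=1..n. if s ^ 2 = k then (- 1) ^ s else 0 :: 'a) = 0" by (intro sum.neutral) auto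
    moreover have "k \<noteq> 0" using False[unfolded not_ex, rule_format, of 0] by simp
    ultimately show ?thesis using False by (simp add: card_int_square_roots)
  qed
  finally show "fps_nth (1 + 2 * (\<Sum>s=1..n. (- 1) ^ s * fps_X ^ (s ^ 2))) k = fps_nth (twist theta :: 'a fps) k"
    by (simp add: twist_nth theta_def)
qed

text \<open>In the finite identity the terms with \<open>s\<close> at least 1 are divisible by
  \<open>fps_X ^ Suc n\<close>, and the term with \<open>s = 0\<close> is
  \<open>euler_partial n\<close>. Multiplying by \<open>euler_partial n\<close> turns the product of
  the \<open>1 + fps_X ^ i\<close> into its dilation.\<close>

lemma twist_theta_eq: "twist theta * dilate euler = euler ^ 2"
proof (rule fps_agree_eqI)
  fix n
  let ?E = "euler_partial n :: 'a fps" and ?R = "\<Prod>i=1..n. 1 + fps_X ^ i :: 'a fps"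
  let ?S = "1 + 2 * (\<Sum>s=1..n. (- 1) ^ s * fps_X ^ (s ^ 2)) :: 'a fps"
  let ?t = "\<lambda>s. (- 1) ^ s * fps_X ^ (s * Suc n) * (\<Prod>i=Suc s..n. 1 - fps_X ^ i) * (\<Prod>i<s. 1 + fps_X ^ i) :: 'a fps"
  have E: "?E = (\<Prod>i=1..n. 1 - fps_X ^ i)"
    unfolding euler_partial_def by (simp add: prod.atLeast1_atMost_eq)
  have RE: "?E * ?R = dilate ?E"
  proof -
    have "(1 - x) * (1 + x) = 1 - x ^ 2" for x :: "'a fps"
      by (simp add: algebra_simps power2_eq_square)
    then show ?thesis
      unfolding E dilate_prod prod.distrib[symmetric] by (simp only: dilate_diff dilate_1 dilate_X_power)
  qed
  have "fps_agree n (?R * ?S) ?E"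
    unfolding fps_agree_def
  proof (intro allI impI)
    fix k assume k: "k \<le> n"
    have "fps_nth (?t (Suc s)) k = 0" for s
    proof -
      have "?t (Suc s) = fps_X ^ (Suc s * Suc n) * ((- 1) ^ Suc s * (\<Prod>i=Suc (Suc s)..n. 1 - fps_X ^ i) * (\<Prod>i<Suc s. 1 + fps_X ^ i))"
        by (simp only: mult_ac)
      also have "fps_nth \<dots> k = 0" unfolding fps_X_power_mult_nth using k by simp
      finally show ?thesis .
    qed
    then have "fps_nth (\<Sum>s<n. ?t (Suc s)) k = 0" unfolding fps_sum_nth by simp
    moreover have "?R * ?S = ?E + (\<Sum>s<n. ?t (Suc s))"
      unfolding gauss_square_partial_sum sum.lessThan_Suc_shift by (simp add: E)
    ultimately show "fps_nth (?R * ?S) k = fps_nth ?E k" by simp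
  qed
  then have "fps_agree n (?E * (?R * ?S)) (euler ^ 2)"
    unfolding power2_eq_square by (intro fps_agree_mult euler_partial_agree) (rule fps_agree_trans[OF _ euler_partial_agree])
  moreover have "?E * (?R * ?S) = ?S * dilate ?E" unfolding RE[symmetric] by (simp only: mult_ac)
  moreover have "fps_agree n (twist theta * dilate euler) (?S * dilate ?E)"
    by (intro fps_agree_mult fps_agree_dilate fps_agree_sym[OF euler_partial_agree] fps_agree_sym[OF twist_theta_agree])
  ultimately show "fps_agree n (twist theta * dilate euler) (euler ^ 2 :: 'a fps)"
    using fps_agree_trans[of n "twist theta * dilate euler" "?S * dilate ?E" "euler ^ 2"] by (simp only:)
qed

section \<open>The modular equation for \<open>f\<close>\<close>

lemma euler_nonzero: "euler \<noteq> 0"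
  by (metis euler_nth_0 fps_zero_nth zero_neq_one)

lemma odd_euler_nonzero: "odd_euler \<noteq> 0"
  by (metis odd_euler_nth_0 fps_zero_nth zero_neq_one)

lemma twist_theta_odd_euler: "twist theta = odd_euler ^ 2 * dilate euler"
proof -
  let ?d = "dilate euler :: 'a fps"
  have "twist theta * ?d = (odd_euler * ?d) ^ 2" unfolding twist_theta_eq odd_euler_mult_dilate_euler ..
  also have "\<dots> = (odd_euler ^ 2 * ?d) * ?d" by (simp only: power2_eq_square mult_ac)
  finally have "twist theta * ?d = (odd_euler ^ 2 * ?d) * ?d" .
  moreover have "?d \<noteq> 0" by (simp add: dilate_eq_0_iff euler_nonzero)
  ultimately show ?thesis by simp
qed

text \<open>Up to the factor \<open>dilate euler\<close>, \<open>theta\<close> and its twist are the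
  squares of \<open>twist odd_euler\<close> and \<open>odd_euler\<close>, so this is theta
  duplication. That factor splits off \<open>dilate odd_euler\<close>, and the rest cancels.
  Together with \<open>odd_euler_twist\<close> it forms a step of the arithmetic-geometric
  mean.\<close>

lemma odd_euler_agm:
  "(twist odd_euler ^ 4 + odd_euler ^ 4) * dilate odd_euler ^ 2 = (2 * dilate (twist odd_euler) ^ 4 :: 'a::field_char_0 fps)"
proof -
  let ?o = "odd_euler :: 'a fps"
  let ?o' = "twist ?o" and ?s = "dilate (euler :: 'a fps)"
  have tt: "twist theta = ?o ^ 2 * ?s" by (rule twist_theta_odd_euler)
  have t: "theta = ?o' ^ 2 * ?s"
    using arg_cong[OF tt, of twist] by (simp add: twist_twist twist_mult twist_power twist_dilate)
  have s: "?s = dilate ?o * dilate ?s"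
    unfolding dilate_mult[symmetric] odd_euler_mult_dilate_euler ..
  have "theta ^ 2 + twist theta ^ 2 = 2 * dilate (theta ^ 2 :: 'a fps)" by (rule theta_duplication)
  then have "(?o' ^ 2 * ?s) ^ 2 + (?o ^ 2 * ?s) ^ 2 = 2 * dilate ((?o' ^ 2 * ?s) ^ 2)"
    unfolding tt unfolding t .
  then have "(?o' ^ 2 * ?s) ^ 2 + (?o ^ 2 * ?s) ^ 2 = 2 * (dilate ?o' ^ 2 * dilate ?s) ^ 2"
    by (simp add: dilate_mult dilate_power)
  also have "(?o' ^ 2 * ?s) ^ 2 + (?o ^ 2 * ?s) ^ 2 = (?o' ^ 4 + ?o ^ 4) * ?s ^ 2"
    by (simp add: algebra_simps power_mult_distrib flip: power_mult)
  also have "?s ^ 2 = dilate ?o ^ 2 * dilate ?s ^ 2" by (subst s) (simp add: power_mult_distrib)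
  also have "2 * (dilate ?o' ^ 2 * dilate ?s) ^ 2 = 2 * dilate ?o' ^ 4 * dilate ?s ^ 2"
    by (simp add: power_mult_distrib flip: power_mult)
  finally have "((?o' ^ 4 + ?o ^ 4) * dilate ?o ^ 2) * dilate ?s ^ 2 = (2 * dilate ?o' ^ 4) * dilate ?s ^ 2"
    by (simp only: mult.assoc)
  moreover have "dilate ?s ^ 2 \<noteq> 0"
    by (simp add: dilate_eq_0_iff euler_nonzero)
  ultimately show ?thesis by simp
qed

text \<open>Comparing coefficients of positive index \<open>n\<close>, the square gives twice the
  \<open>n\<close>-th one once the lower ones vanish, and the dilation gives 0 or a lower
  one.\<close>

lemma fps_square_eq_dilate:
  fixes Z :: "'a::field_char_0 fps"
  assumes "Z ^ 2 = dilate Z" "fps_nth Z 0 = 1"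
  shows "Z = 1"
proof -
  have "fps_nth Z n = fps_nth 1 n" for n
  proof (induction n rule: less_induct)
    case (less n)
    show ?case
    proof (cases "n = 0")
      case False
      have "fps_nth (Z ^ 2) n = (\<Sum>i=0..n. fps_nth Z i * fps_nth Z (n - i))"
        by (simp add: power2_eq_square fps_mult_nth)
      also have "\<dots> = (\<Sum>i\<in>{0, n}. fps_nth Z i * fps_nth Z (n - i))"
        using False less by (intro sum.mono_neutral_right) auto
      also have "\<dots> = 2 * fps_nth Z n" using False assms(2) by simp
      finally have "2 * fps_nth Z n = fps_nth (dilate Z) n" by (simp add: assms(1))
      also have "\<dots> = 0"
        using False less[of "n div 2"] by (auto simp: dilate_nth elim!: evenE)
      finally show ?thesis using False by simp
    qed (simp add: assms(2))
  qed
  then show ?thesis by (simp add: fps_eq_iff)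
qed

lemma fps_power_nth_1:
  fixes f :: "'a::field_char_0 fps"
  assumes "fps_nth f 0 = 1"
  shows "fps_nth (f ^ n) (Suc 0) = of_nat n * fps_nth f (Suc 0)"
proof (induction n)
  case (Suc n)
  then show ?case using assms by (simp add: fps_mult_nth fps_nth_power_0 algebra_simps)
qed simp

text \<open>
  Jacobi's aequatio identica satis abstrusa. Both sides satisfy the same functional equation relating
  the square of a series to its dilation, and this determines a series with given leading term.
\<close>

lemma odd_euler_jacobi:
  "(twist odd_euler ^ 8 - odd_euler ^ 8) * dilate odd_euler ^ 8 = (16 * fps_X :: 'a::field_char_0 fps)"
proof -
  let ?o = "odd_euler :: 'a fps"
  let ?o' = "twist ?o" and ?d = "dilate ?o"
  define W where "W = ?o' ^ 8 - ?o ^ 8"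
  define A where "A = dilate ?o' ^ 8"
  define B where "B = ?d ^ 8"
  have od: "?o * ?o' = ?d" by (rule odd_euler_twist)
  have agm: "(?o' ^ 4 + ?o ^ 4) * ?d ^ 2 = 2 * dilate ?o' ^ 4" by (rule odd_euler_agm)
  have B0: "?d \<noteq> 0" by (simp add: dilate_eq_0_iff odd_euler_nonzero)
  have dW: "dilate W = A - B" by (simp add: W_def A_def B_def dilate_diff dilate_power)
  have dB: "dilate B = A * B"
    unfolding A_def B_def dilate_power power_mult_distrib[symmetric]
    using od by (simp add: mult.commute flip: dilate_mult)
  \<comment> \<open>The square of a difference is the square of the sum minus four times the
    product. By \<open>agm\<close> and \<open>od\<close> the sum of the eighth powers, times
    \<open>?d ^ 4\<close>, is linear in \<open>A\<close> and \<open>B\<close>.\<close>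
  have W2: "W ^ 2 * B = 16 * A * dilate W"
  proof -
    have 1: "W ^ 2 = (?o' ^ 8 + ?o ^ 8) ^ 2 - 4 * ?d ^ 8"
      unfolding W_def od[symmetric] by (simp add: power2_eq_square algebra_simps)
    have "(?o' ^ 8 + ?o ^ 8) * ?d ^ 4 = ((?o' ^ 4 + ?o ^ 4) * ?d ^ 2) ^ 2 - 2 * (?o * ?o') ^ 4 * ?d ^ 4"
      by algebra
    also have "\<dots> = 4 * A - 2 * B"
      unfolding agm od A_def B_def by (simp add: power_mult_distrib flip: power_mult power_add)
    finally have 2: "(?o' ^ 8 + ?o ^ 8) * ?d ^ 4 = 4 * A - 2 * B" .
    have "W ^ 2 * B = ((?o' ^ 8 + ?o ^ 8) * ?d ^ 4) ^ 2 - 4 * ?d ^ 8 * B"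
      unfolding 1 B_def by algebra
    also have "\<dots> = (4 * A - 2 * B) ^ 2 - 4 * B * B" unfolding 2 B_def ..
    also have "\<dots> = 16 * A * dilate W" unfolding dW by (simp add: power2_eq_square algebra_simps)
    finally show ?thesis .
  qed
  define V where "V = W * B"
  have V0: "fps_nth V 0 = 0" by (simp add: V_def W_def twist_nth odd_euler_nth_0 fps_nth_power_0)
  \<comment> \<open>The linear coefficients of \<open>odd_euler\<close> and its twist are - 1 and 1,
    so their eighth powers differ by \<open>16 * fps_X\<close> to first order.\<close>
  have V1: "fps_nth V (Suc 0) = 16"
    by (simp add: V_def W_def B_def fps_mult_nth twist_nth dilate_nth odd_euler_nth_0 odd_euler_nth_1
        fps_nth_power_0 fps_power_nth_1)
  have V2: "V ^ 2 = 16 * dilate V"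
  proof -
    have "V ^ 2 = (W ^ 2 * B) * B" by (simp add: V_def power2_eq_square mult_ac)
    also have "\<dots> = 16 * (dilate W * (A * B))" unfolding W2 by (simp only: mult_ac)
    also have "\<dots> = 16 * dilate V" unfolding V_def dilate_mult dB ..
    finally show ?thesis .
  qed
  \<comment> \<open>Normalized to constant term 1; the relation for \<open>V\<close> then loses the
    common factor \<open>256 * fps_X ^ 2\<close> and becomes the one that forces
    \<open>Z = 1\<close>.\<close>
  define Z where "Z = fps_const (1 / 16) * fps_shift 1 V"
  have V: "V = 16 * fps_X * Z"
  proof -
    have "V = fps_X * fps_shift 1 V"
      by (rule fps_ext) (auto simp: V0 fps_X_mult_nth gr0_conv_Suc split: nat.split)
    moreover have "(16 :: 'a fps) * fps_const (1 / 16) = 1"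
      unfolding numeral_fps_const by simp
    moreover have "16 * fps_X * Z = (fps_X * fps_shift 1 V) * (16 * fps_const (1 / 16))"
      unfolding Z_def by (simp only: mult_ac)
    ultimately show ?thesis by (simp only: mult_1_right)
  qed
  have "256 * fps_X ^ 2 * Z ^ 2 = 256 * fps_X ^ 2 * dilate Z"
    using V2 unfolding V dilate_mult dilate_numeral dilate_X by (simp add: power_mult_distrib mult.assoc)
  then have "Z ^ 2 = dilate Z" by simp
  moreover have "fps_nth Z 0 = 1" using V1 by (simp add: Z_def)
  ultimately have "Z = 1" by (rule fps_square_eq_dilate)
  then show ?thesis using V by (simp add: V_def W_def B_def)
qed

lemma fq_odd_euler: "fq * odd_euler ^ 24 = fps_X"
proof -
  let ?E = "euler :: Q2 fps"
  have "(\<lambda>n. (1 - fps_X ^ Suc n) ^ 24) has_prod ?E ^ 24"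
  proof -
    have eq: "(\<Prod>i\<le>n. (1 - fps_X ^ Suc i) ^ 24) = (euler_partial (Suc n) :: Q2 fps) ^ 24" for n
      unfolding euler_partial_def lessThan_Suc_atMost by (rule prod_power_distrib[symmetric])
    have ag: "fps_agree n (euler_partial n ^ k) (?E ^ k)" for n k
      by (induction k) (auto intro!: fps_agree_mult fps_agree_refl euler_partial_agree)
    have "(\<lambda>n. euler_partial (Suc n) ^ 24) \<longlonglongrightarrow> ?E ^ 24"
    proof (rule tendsto_fpsI)
      fix n
      show "\<forall>\<^sub>F m in sequentially. fps_nth (euler_partial (Suc m) ^ 24) n = fps_nth (?E ^ 24) n"
        using eventually_ge_at_top[of n]
      proof eventually_elim
        case (elim m)
        then show ?case using ag[of "Suc m" 24] by (simp add: fps_agree_def)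
      qed
    qed
    moreover have "?E ^ 24 \<noteq> 0" by (simp add: euler_nonzero)
    ultimately have "raw_has_prod (\<lambda>n. (1 - fps_X ^ Suc n) ^ 24) 0 (?E ^ 24)"
      unfolding raw_has_prod_def by (simp only: eq add_0_right) simp
    then show ?thesis by (simp add: has_prod_def)
  qed
  from has_prod_unique[OF this] have D: "Delta = fps_X * ?E ^ 24" by (simp add: Delta_def)
  have "Delta oo fps_X ^ 2 = dilate Delta" by (simp add: dilate_def)
  also have "\<dots> = fps_X * (fps_X * dilate ?E ^ 24)"
    by (simp add: D dilate_mult dilate_power dilate_X power2_eq_square mult.assoc)
  finally have "fq = (fps_X * (fps_X * dilate ?E ^ 24)) / (fps_X * ?E ^ 24)" by (simp add: fq_def D)
  also have "\<dots> = (fps_X * dilate ?E ^ 24) / ?E ^ 24" by (rule div_mult_mult1) simp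
  also have "\<dots> = (fps_X * dilate ?E ^ 24) * inverse (?E ^ 24)"
    by (rule fps_divide_unit) (simp add: fps_nth_power_0)
  finally have f: "fq = fps_X * dilate ?E ^ 24 * inverse (?E ^ 24)" .
  have "fq * odd_euler ^ 24 = fps_X * (odd_euler * dilate ?E) ^ 24 * inverse (?E ^ 24)"
    unfolding f power_mult_distrib by (simp only: mult_ac)
  also have "\<dots> = fps_X"
    unfolding odd_euler_mult_dilate_euler by (simp add: mult.assoc inverse_mult_eq_1' fps_nth_power_0)
  finally show ?thesis .
qed

text \<open>The norm of \<open>fq\<close> over the series in \<open>fps_X ^ 2\<close>. The sign
  comes from multiplying \<open>fps_X\<close> by its twist.\<close>

lemma fq_mult_twist: "fq * twist fq = - dilate fq"
proof -
  let ?o = "odd_euler :: Q2 fps"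
  have "twist (fq * ?o ^ 24) = twist fps_X" "dilate (fq * ?o ^ 24) = dilate fps_X"
    unfolding fq_odd_euler by simp_all
  then have t: "twist fq * twist ?o ^ 24 = - fps_X" and d: "dilate fq * dilate ?o ^ 24 = fps_X ^ 2"
    by (simp_all add: twist_mult twist_power twist_X dilate_mult dilate_power dilate_X)
  have "(fq * twist fq) * dilate ?o ^ 24 = (fq * ?o ^ 24) * (twist fq * twist ?o ^ 24)"
    unfolding odd_euler_twist[symmetric] power_mult_distrib by (simp only: mult_ac)
  also have "\<dots> = (- dilate fq) * dilate ?o ^ 24"
    unfolding t fq_odd_euler by (simp add: d power2_eq_square)
  finally have "(fq * twist fq) * dilate ?o ^ 24 = (- dilate fq) * dilate ?o ^ 24" .
  moreover have "dilate ?o ^ 24 \<noteq> 0" by (simp add: dilate_eq_0_iff odd_euler_nonzero)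
  ultimately show ?thesis by (rule mult_right_cancel[THEN iffD1, rotated])
qed

text \<open>The trace of \<open>fq\<close>. With \<open>fq = fps_X / a ^ 3\<close> and
  \<open>twist fq = - fps_X / b ^ 3\<close> the numerator is \<open>b ^ 3 - a ^ 3\<close>, a
  polynomial in \<open>b - a\<close> and \<open>a * b\<close>. Jacobi's identity
  \<open>(b - a) * (a * b) = 16 * fps_X\<close> yields the constants 48 = 3 * 16 and 4096 = 16 ^
  3.\<close>

lemma fq_add_twist: "fq + twist fq = 48 * dilate fq + 4096 * dilate fq ^ 2"
proof -
  let ?o = "odd_euler :: Q2 fps"
  let ?o' = "twist ?o"
  define a where "a = ?o ^ 8"
  define b where "b = ?o' ^ 8"
  define B where "B = dilate ?o ^ 8"
  define F where "F = dilate fq"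
  have B: "B = a * b"
    unfolding B_def a_def b_def odd_euler_twist[symmetric] by (rule power_mult_distrib)
  have fa: "fq * a ^ 3 = fps_X" unfolding a_def using fq_odd_euler by (simp flip: power_mult)
  have "twist (fq * ?o ^ 24) = twist fps_X" "dilate (fq * ?o ^ 24) = dilate fps_X"
    unfolding fq_odd_euler by simp_all
  then have fb: "twist fq * b ^ 3 = - fps_X" and F: "F * B ^ 3 = fps_X ^ 2"
    by (simp_all add: b_def B_def F_def twist_mult twist_power twist_X dilate_mult dilate_power dilate_X flip: power_mult)
  have J: "(b - a) * B = 16 * fps_X" unfolding a_def b_def B_def by (rule odd_euler_jacobi)
  have "(fq + twist fq) * B ^ 3 = (fq * a ^ 3) * b ^ 3 + (twist fq * b ^ 3) * a ^ 3"
    unfolding B power_mult_distrib by (simp only: distrib_right mult_ac)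
  also have "\<dots> = fps_X * (b ^ 3 - a ^ 3)" unfolding fa fb by (simp add: algebra_simps)
  also have "b ^ 3 - a ^ 3 = (b - a) * ((b - a) ^ 2 + 3 * B)"
    unfolding B by (simp add: power2_eq_square power3_eq_cube algebra_simps)
  finally have eq: "(fq + twist fq) * B ^ 3 = fps_X * ((b - a) * ((b - a) ^ 2 + 3 * B))" .
  have "(fq + twist fq) * B ^ 3 * B ^ 3 = fps_X * (((b - a) * B) * (((b - a) * B) ^ 2 + 3 * B ^ 3))"
    unfolding eq by algebra
  also have "\<dots> = 48 * (fps_X ^ 2) * B ^ 3 + 4096 * (fps_X ^ 2) ^ 2"
    unfolding J by (simp add: power2_eq_square algebra_simps)
  also have "\<dots> = (48 * F + 4096 * F ^ 2) * B ^ 3 * B ^ 3"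
    unfolding F[symmetric] by (simp add: power2_eq_square algebra_simps)
  finally have "(fq + twist fq) * (B ^ 3 * B ^ 3) = (48 * F + 4096 * F ^ 2) * (B ^ 3 * B ^ 3)"
    by (simp only: mult.assoc)
  moreover have "B ^ 3 * B ^ 3 \<noteq> 0"
    by (simp add: B_def dilate_eq_0_iff odd_euler_nonzero)
  ultimately show ?thesis unfolding F_def by (rule mult_right_cancel[THEN iffD1, rotated])
qed

section \<open>The matrix of \<open>U\<close>\<close>

lemma U_op_add: "U_op (F + G) = U_op F + U_op G"
  by (simp add: U_op_def fps_eq_iff)

text \<open>The projection formula: \<open>dilate F\<close> has even exponents only, so an even
  exponent of the product takes an even exponent from \<open>G\<close>.\<close>

lemma U_op_dilate_mult: "U_op (dilate F * G) = F * U_op G"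
proof (rule fps_ext)
  fix n
  have "fps_nth (U_op (dilate F * G)) n = (\<Sum>i=0..2 * n. fps_nth (dilate F) i * fps_nth G (2 * n - i))"
    by (simp add: U_op_def fps_mult_nth)
  also have "\<dots> = (\<Sum>i\<in>(\<lambda>i. 2 * i) ` {0..n}. fps_nth (dilate F) i * fps_nth G (2 * n - i))"
    by (rule sum.mono_neutral_right) (auto simp: dilate_nth elim!: evenE)
  also have "\<dots> = (\<Sum>i=0..n. fps_nth F i * fps_nth G (2 * n - 2 * i))"
    by (subst sum.reindex) (auto simp: inj_on_def dilate_nth)
  also have "\<dots> = fps_nth (F * U_op G) n"
    by (simp add: U_op_def fps_mult_nth diff_mult_distrib2)
  finally show "fps_nth (U_op (dilate F * G)) n = fps_nth (F * U_op G) n" .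
qed

lemma U_op_1: "U_op 1 = 1"
  using U_op_dilate_mult[of 1 1] by (simp add: U_op_def fps_eq_iff)

lemma gq_eq: "gq = 64 * fq"
  by (simp add: gq_def numeral_fps_const)

lemma dilate_gq: "dilate gq = 64 * dilate fq"
  by (simp add: gq_eq dilate_mult dilate_numeral)

text \<open>Trace and norm give a quadratic equation for \<open>fq\<close> over the series in
  \<open>fps_X ^ 2\<close>; scaling by 64 turns its coefficients into the ones seen here.\<close>

lemma gq_power_recurrence: "gq ^ (j + 2) = dilate (48 * gq + 64 * gq ^ 2) * gq ^ (j + 1) + dilate (64 * gq) * gq ^ j"
proof -
  have "fq ^ 2 = (fq + twist fq) * fq - fq * twist fq" by (simp add: power2_eq_square algebra_simps)
  then have "fq ^ 2 = (48 * dilate fq + 4096 * dilate fq ^ 2) * fq + dilate fq"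
    unfolding fq_add_twist fq_mult_twist by simp
  then have "gq ^ 2 = (48 * dilate gq + 64 * dilate gq ^ 2) * gq + 64 * dilate gq"
    unfolding dilate_gq unfolding gq_eq by algebra
  then have g: "gq ^ 2 = dilate (48 * gq + 64 * gq ^ 2) * gq + dilate (64 * gq)"
    unfolding dilate_add dilate_mult dilate_power dilate_numeral .
  have "gq ^ (j + 2) = gq ^ 2 * gq ^ j" by (simp only: power_add mult.commute)
  also have "\<dots> = (dilate (48 * gq + 64 * gq ^ 2) * gq + dilate (64 * gq)) * gq ^ j"
    by (rule arg_cong[OF g])
  also have "\<dots> = dilate (48 * gq + 64 * gq ^ 2) * gq ^ (j + 1) + dilate (64 * gq) * gq ^ j"
    by (simp only: distrib_right distrib_left mult_ac power_add power_one_right)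
  finally show ?thesis .
qed

lemma U_op_gq_power: "U_op (gq ^ (j + 2)) = (48 * gq + 64 * gq ^ 2) * U_op (gq ^ (j + 1)) + 64 * gq * U_op (gq ^ j)"
  unfolding gq_power_recurrence U_op_add U_op_dilate_mult ..

text \<open>\<open>U\<close> reads even coefficients and so agrees on \<open>fq\<close> and its
  twist; hence \<open>U fq\<close> is half of \<open>U\<close> applied to the trace.\<close>

lemma U_op_gq: "U_op gq = 24 * gq + 32 * gq ^ 2"
proof -
  have t: "U_op (twist F) = U_op F" for F by (simp add: U_op_def twist_nth fps_eq_iff)
  have "U_op (fq + twist fq) = U_op (dilate (48 * fq + 4096 * fq ^ 2) * 1)"
    by (simp add: fq_add_twist dilate_add dilate_mult dilate_power dilate_numeral)
  then have "2 * U_op fq = 48 * fq + 4096 * fq ^ 2"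
    unfolding U_op_add t U_op_dilate_mult U_op_1 by simp
  then have "2 * U_op fq = 2 * (24 * fq + 2048 * fq ^ 2)" by simp
  then have f: "U_op fq = 24 * fq + 2048 * fq ^ 2" by (rule mult_left_cancel[THEN iffD1, rotated]) simp
  have "U_op gq = 64 * U_op fq"
    by (simp add: U_op_def gq_def numeral_fps_const fps_eq_iff)
  then show ?thesis unfolding f gq_eq by algebra
qed

text \<open>The value 0 at negative \<open>n\<close> makes \<open>inv_fact (n - 1) = n * inv_fact n\<close> valid for all \<open>n\<close>.\<close>

definition inv_fact :: "int \<Rightarrow> 'a::field_char_0" where
  "inv_fact n = (if n < 0 then 0 else 1 / fact (nat n))"

lemma inv_fact_neg: "n < 0 \<Longrightarrow> inv_fact n = 0"
  by (simp add: inv_fact_def)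

lemma inv_fact_of_nat: "inv_fact (int n) = 1 / fact n"
  by (simp add: inv_fact_def)

lemma inv_fact_minus_1: "inv_fact (n - 1) = of_int n * inv_fact n"
proof (cases "n > 0")
  case True
  then obtain k where n: "n = int (Suc k)" by (metis gr0_implies_Suc zero_less_imp_eq_int)
  have "(inv_fact (int k) :: 'a) = of_nat (Suc k) * inv_fact (int (Suc k))"
    by (simp add: inv_fact_of_nat del: of_nat_Suc)
  then show ?thesis by (simp add: n)
qed (auto simp: inv_fact_def not_less)

text \<open>For positive \<open>j\<close>, the coefficient of \<open>g ^ i\<close> in
  \<open>U (g ^ j)\<close>. The factors \<open>inv_fact\<close> cut out the band
  \<open>j <= 2 * i\<close>, \<open>i <= 2 * j\<close>. Dividing by \<open>j\<close> leaves an
  expression symmetric in \<open>i\<close> and \<open>j\<close>.\<close>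

definition u_coeff :: "nat \<Rightarrow> nat \<Rightarrow> 'a::field_char_0" where
  "u_coeff i j = 3 * of_nat j * fact (i + j - 1) * 2 ^ (2 * i + 2 * j - 1) * inv_fact (2 * int i - int j) * inv_fact (2 * int j - int i)"

lemma u_coeff_eq_0: "2 * i < j \<or> 2 * j < i \<Longrightarrow> u_coeff i j = 0"
  by (auto simp: u_coeff_def inv_fact_neg)

text \<open>What remains of the recurrence for \<open>u_coeff\<close> after a common hypergeometric
  factor is taken out of its four terms.\<close>

lemma u_coeff_recurrence_poly:
  fixes i j :: "'a::field_char_0"
  assumes "a = 2 * i - j - 2" "b = 2 * j + 4 - i"
  shows "(j + 2) * ((i + j + 1) * ((i + j) * (i + j - 1))) =
    3 * (j + 1) * (i + j - 1) * (a * b) + (j + 1) * ((a - 2) * ((a - 1) * a)) + j * ((b - 2) * ((b - 1) * b))"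
  unfolding assms by algebra

lemma u_coeff_recurrence:
  assumes "j \<ge> 1" "i \<ge> 1"
  shows "(u_coeff i (j + 2) :: 'a::field_char_0) =
    48 * u_coeff (i - 1) (j + 1) + 64 * (if i \<ge> 2 then u_coeff (i - 2) (j + 1) else 0) + 64 * u_coeff (i - 1) j"
proof -
  define a where "a = 2 * int i - int j - 2"
  define b where "b = 2 * int j + 4 - int i"
  \<comment> \<open>The smallest factorial and power of 2 with the largest arguments of
    \<open>inv_fact\<close> among the four terms, so that each term is a polynomial times
    \<open>K\<close>.\<close>
  define K :: 'a where "K = 3 * fact (i + j - 2) * 2 ^ (2 * i + 2 * j - 3) * inv_fact a * inv_fact b"
  let ?i = "of_nat i :: 'a" and ?j = "of_nat j :: 'a" and ?a = "of_int a :: 'a" and ?b = "of_int b :: 'a"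
  obtain n where n: "i + j = n + 2" using assms by (metis add_leE add_mono le_Suc_ex nat_1_add_1 add.commute)
  have nn: "(of_nat n :: 'a) = ?i + ?j - 2" using arg_cong[OF n, of "of_nat :: nat \<Rightarrow> 'a"] by (simp add: algebra_simps)
  have e: "2 * i + 2 * j - 3 = 2 * n + 1" using n by simp
  have K: "K = 3 * fact n * 2 ^ (2 * n + 1) * inv_fact a * inv_fact b"
    unfolding K_def e using n by simp
  have a3: "inv_fact (a - 3) = (?a - 2) * ((?a - 1) * (?a * inv_fact a))"
    using inv_fact_minus_1[of "a - 2", where 'a = 'a] inv_fact_minus_1[of "a - 1", where 'a = 'a] inv_fact_minus_1[of a, where 'a = 'a] by simp
  have b3: "inv_fact (b - 3) = (?b - 2) * ((?b - 1) * (?b * inv_fact b))"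
    using inv_fact_minus_1[of "b - 2", where 'a = 'a] inv_fact_minus_1[of "b - 1", where 'a = 'a] inv_fact_minus_1[of b, where 'a = 'a] by simp
  have f1: "(fact (n + 1) :: 'a) = (?i + ?j - 1) * fact n"
    by (simp add: nn algebra_simps)
  have f3: "(fact (n + 3) :: 'a) = (?i + ?j + 1) * ((?i + ?j) * ((?i + ?j - 1) * fact n))"
    by (simp add: numeral_3_eq_3 nn algebra_simps)
  have 0: "u_coeff i (j + 2) = 64 * (?j + 2) * ((?i + ?j + 1) * ((?i + ?j) * (?i + ?j - 1))) * K"
  proof -
    have e: "i + (j + 2) - 1 = n + 3" "2 * i + 2 * (j + 2) - 1 = 2 * n + 7"
      "2 * int i - int (j + 2) = a" "2 * int (j + 2) - int i = b"
      using n by (auto simp: a_def b_def)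
    have p: "(2 :: 'a) ^ (2 * n + 7) = 64 * 2 ^ (2 * n + 1)" by (simp add: power_add)
    show ?thesis unfolding u_coeff_def K e f3 p by (simp add: algebra_simps)
  qed
  have 1: "48 * u_coeff (i - 1) (j + 1) = 192 * (?j + 1) * (?i + ?j - 1) * (?a * ?b) * K"
  proof -
    have e: "i - 1 + (j + 1) - 1 = n + 1" "2 * (i - 1) + 2 * (j + 1) - 1 = 2 * n + 3"
      "2 * int (i - 1) - int (j + 1) = a - 1" "2 * int (j + 1) - int (i - 1) = b - 1"
      using n assms by (auto simp: a_def b_def of_nat_diff)
    have p: "(2 :: 'a) ^ (2 * n + 3) = 4 * 2 ^ (2 * n + 1)" by (simp add: power_add)
    show ?thesis unfolding u_coeff_def K e f1 p inv_fact_minus_1 by (simp add: algebra_simps)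
  qed
  have 2: "64 * (if i \<ge> 2 then u_coeff (i - 2) (j + 1) else 0) = 64 * (?j + 1) * ((?a - 2) * ((?a - 1) * ?a)) * K"
  proof (cases "i \<ge> 2")
    case True
    then have e: "i - 2 + (j + 1) - 1 = n" "2 * (i - 2) + 2 * (j + 1) - 1 = 2 * n + 1"
      "2 * int (i - 2) - int (j + 1) = a - 3" "2 * int (j + 1) - int (i - 2) = b"
      using n assms by (auto simp: a_def b_def of_nat_diff)
    have "64 * u_coeff (i - 2) (j + 1) = 64 * (?j + 1) * ((?a - 2) * ((?a - 1) * ?a)) * K"
      unfolding u_coeff_def K e a3 by (simp add: algebra_simps)
    then show ?thesis using True by simp
  next
    case False
    then have "a - 3 < 0" using assms by (simp add: a_def)
    then have "(?a - 2) * ((?a - 1) * (?a * inv_fact a)) = 0" unfolding a3[symmetric] by (rule inv_fact_neg)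
    then have "((?a - 2) * ((?a - 1) * ?a)) * K = 0" unfolding K by auto
    then show ?thesis using False by (simp add: mult.assoc)
  qed
  have 3: "64 * u_coeff (i - 1) j = 64 * ?j * ((?b - 2) * ((?b - 1) * ?b)) * K"
  proof -
    have e: "i - 1 + j - 1 = n" "2 * (i - 1) + 2 * j - 1 = 2 * n + 1"
      "2 * int (i - 1) - int j = a" "2 * int j - int (i - 1) = b - 3"
      using n assms by (auto simp: a_def b_def of_nat_diff)
    show ?thesis unfolding u_coeff_def K e b3 by (simp add: algebra_simps)
  qed
  have "?a = 2 * ?i - ?j - 2" "?b = 2 * ?j + 4 - ?i" by (simp_all add: a_def b_def)
  note P = u_coeff_recurrence_poly[OF this]
  have "64 * (?j + 2) * ((?i + ?j + 1) * ((?i + ?j) * (?i + ?j - 1))) * K =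
      64 * (3 * (?j + 1) * (?i + ?j - 1) * (?a * ?b) + (?j + 1) * ((?a - 2) * ((?a - 1) * ?a)) + ?j * ((?b - 2) * ((?b - 1) * ?b))) * K"
    unfolding P[symmetric] by (simp only: mult.assoc)
  then show ?thesis unfolding 0 1 2 3 by (simp add: algebra_simps)
qed

lemma U_op_gq_power_eq: "U_op (gq ^ Suc j) = Abs_fps (\<lambda>i. u_coeff i (Suc j)) oo gq"
proof -
  define p where "p j = Abs_fps (\<lambda>i. u_coeff i (Suc j) :: Q2)" for j
  have u0: "u_coeff 0 (Suc j) = (0 :: Q2)" for j by (simp add: u_coeff_def inv_fact_neg)
  have p0: "p 0 = 24 * fps_X + 32 * fps_X ^ 2"
  proof (rule fps_ext)
    fix n :: nat
    consider "n = 0" | "n = 1" | "n = 2" | "n > 2" by linarith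
    then show "fps_nth (p 0) n = fps_nth (24 * fps_X + 32 * fps_X ^ 2) n"
      by cases (auto simp: p_def u_coeff_def inv_fact_def numeral_fps_const fact_numeral)
  qed
  \<comment> \<open>The closed formula gives 0 for \<open>j = 0\<close>, whereas
    \<open>U 1 = 1\<close>, so the recurrence of \<open>u_coeff\<close> cannot start there; this
    case is computed by hand.\<close>
  have p1: "p 1 = (48 * fps_X + 64 * fps_X ^ 2) * p 0 + 64 * fps_X"
  proof -
    have "(48 * fps_X + 64 * fps_X ^ 2) * p 0 + 64 * fps_X =
        64 * fps_X + 1152 * fps_X ^ 2 + 3072 * fps_X ^ 3 + (2048 * fps_X ^ 4 :: Q2 fps)"
      unfolding p0 by algebra
    also have "p 1 = \<dots>"
    proof (rule fps_ext)
      fix n :: nat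
      consider "n = 0" | "n = 1" | "n = 2" | "n = 3" | "n = 4" | "n > 4" by linarith
      then show "fps_nth (p 1) n = fps_nth (64 * fps_X + 1152 * fps_X ^ 2 + 3072 * fps_X ^ 3 + 2048 * fps_X ^ 4) n"
        by cases (auto simp: p_def u_coeff_def inv_fact_def numeral_fps_const fact_numeral fps_X_nth fps_X_power_nth)
    qed
    finally show ?thesis by simp
  qed
  have prec: "p (Suc (Suc j)) = (48 * fps_X + 64 * fps_X ^ 2) * p (Suc j) + 64 * fps_X * p j" for j
  proof (rule fps_ext)
    fix n
    have "fps_nth ((48 * fps_X + 64 * fps_X ^ 2) * p (Suc j) + 64 * fps_X * p j) n =
        48 * fps_nth (fps_X * p (Suc j)) n + 64 * fps_nth (fps_X ^ 2 * p (Suc j)) n + 64 * fps_nth (fps_X * p j) n"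
      unfolding numeral_fps_const by (simp add: distrib_right mult.assoc)
    also have "\<dots> = fps_nth (p (Suc (Suc j))) n"
    proof (cases "n = 0")
      case False
      then show ?thesis
        using u_coeff_recurrence[of "Suc j" n, where 'a = Q2]
        by (auto simp: p_def fps_X_power_mult_nth not_less)
    qed (simp add: p_def u0)
    finally show "fps_nth (p (Suc (Suc j))) n = fps_nth ((48 * fps_X + 64 * fps_X ^ 2) * p (Suc j) + 64 * fps_X * p j) n" ..
  qed
  have comp: "((48 * fps_X + 64 * fps_X ^ 2) * F + 64 * fps_X * G) oo gq = (48 * gq + 64 * gq ^ 2) * (F oo gq) + 64 * gq * (G oo gq)" for F G
    by (simp add: fps_compose_add_distrib fps_compose_mult_distrib numeral_fps_const flip: fps_compose_power)
  have U1: "U_op (gq ^ Suc 0) = p 0 oo gq"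
    by (simp add: U_op_gq p0 fps_compose_add_distrib fps_compose_mult_distrib numeral_fps_const flip: fps_compose_power)
  have "U_op (gq ^ Suc j) = p j oo gq \<and> U_op (gq ^ Suc (Suc j)) = p (Suc j) oo gq"
  proof (induction j)
    case 0
    have "p 1 oo gq = (48 * gq + 64 * gq ^ 2) * (p 0 oo gq) + 64 * gq"
      unfolding p1 using comp[of "p 0" 1] by simp
    then show ?case using U1 U_op_gq_power[of 0] by (simp add: U_op_1 numeral_2_eq_2)
  next
    case (Suc j)
    then show ?case using U_op_gq_power[of "Suc j"] comp[of "p (Suc j)" "p j"] by (simp add: prec)
  qed
  then show ?thesis by (simp add: p_def)
qed

text \<open>As \<open>gq\<close> has no constant term, the coefficient of index \<open>n\<close>
  after \<open>U\<close> involves only \<open>gq ^ k\<close> with \<open>k <= 2 * n\<close>, and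
  linearity over infinite series becomes a swap of finite sums. The bound on \<open>j\<close> is the
  edge of the band of \<open>u_coeff\<close>.\<close>

lemma U_op_cusp_series:
  "U_op (cusp_series a) = cusp_series (\<lambda>i. \<Sum>j<2 * i + 2. u_coeff (Suc i) (Suc j) * a j)"
proof (rule fps_ext)
  fix n
  let ?a = "case_nat 0 a :: nat \<Rightarrow> Q2"
  let ?c = "case_nat 0 (\<lambda>i. \<Sum>j<2 * i + 2. u_coeff (Suc i) (Suc j) * a j) :: nat \<Rightarrow> Q2"
  have c: "?c i = (\<Sum>k=0..2 * n. u_coeff i k * ?a k)" if "i \<le> n" for i
  proof (cases i)
    case 0
    then show ?thesis by (simp add: u_coeff_eq_0 split: nat.split) (auto intro!: sum.neutral simp: u_coeff_eq_0 split: nat.split)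
  next
    case (Suc i')
    have "(\<Sum>k=0..2 * n. u_coeff i k * ?a k) = (\<Sum>k\<in>Suc ` {..<2 * i' + 2}. u_coeff i k * ?a k)"
    proof (rule sum.mono_neutral_right)
      show "Suc ` {..<2 * i' + 2} \<subseteq> {0..2 * n}" using that Suc by auto
      show "\<forall>k\<in>{0..2 * n} - Suc ` {..<2 * i' + 2}. u_coeff i k * ?a k = 0"
      proof
        fix k assume k: "k \<in> {0..2 * n} - Suc ` {..<2 * i' + 2}"
        show "u_coeff i k * ?a k = 0"
        proof (cases k)
          case (Suc k')
          then have "2 * i < k" using k \<open>i = Suc i'\<close> by auto
          then show ?thesis by (simp add: u_coeff_eq_0)
        qed simp
      qed
    qed simp
    then show ?thesis by (simp add: Suc sum.reindex)
  qed
  have U: "fps_nth (gq ^ k) (2 * n) * ?a k = (\<Sum>i=0..n. u_coeff i k * ?a k * fps_nth (gq ^ i) n)" for k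
  proof (cases k)
    case (Suc j)
    have "fps_nth (gq ^ k) (2 * n) = fps_nth (U_op (gq ^ k)) n" by (simp add: U_op_def)
    also have "\<dots> = (\<Sum>i=0..n. u_coeff i k * fps_nth (gq ^ i) n)"
      unfolding Suc U_op_gq_power_eq by (simp add: fps_compose_nth)
    finally show ?thesis by (simp add: sum_distrib_left mult_ac)
  qed simp
  have "fps_nth (U_op (cusp_series a)) n = (\<Sum>k=0..2 * n. fps_nth (gq ^ k) (2 * n) * ?a k)"
    by (simp add: U_op_def cusp_series_def fps_compose_nth mult.commute)
  also have "\<dots> = (\<Sum>i=0..n. \<Sum>k=0..2 * n. u_coeff i k * ?a k * fps_nth (gq ^ i) n)"
    unfolding U by (rule sum.swap)
  also have "\<dots> = (\<Sum>i=0..n. ?c i * fps_nth (gq ^ i) n)"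
    by (intro sum.cong refl) (simp add: c sum_distrib_right)
  finally show "fps_nth (U_op (cusp_series a)) n = fps_nth (cusp_series (\<lambda>i. \<Sum>j<2 * i + 2. u_coeff (Suc i) (Suc j) * a j)) n"
    by (simp only: cusp_series_def fps_compose_nth fps_nth_Abs_fps)
qed

section \<open>A well-poised summation\<close>

text \<open>Up to a factor free of \<open>k\<close>, the summand of the entry \<open>(i, j)\<close>
  of \<open>A D B\<close>. Pairs such as \<open>inv_fact (i + k)\<close> and
  \<open>inv_fact (i - k)\<close>, exchanged by changing the sign of \<open>k\<close>, make the sum
  well-poised.\<close>

definition wp_term :: "nat \<Rightarrow> nat \<Rightarrow> nat \<Rightarrow> 'a::field_char_0" where
  "wp_term i j k = 4 * of_nat k * fact (2 * k + i - 1) * fact (2 * k + j - 1) * inv_fact (2 * int k - int i) *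
     inv_fact (2 * int k - int j) * inv_fact (int i + int k) * inv_fact (int i - int k) *
     inv_fact (int j + int k) * inv_fact (int j - int k)"

definition wp_sum :: "nat \<Rightarrow> nat \<Rightarrow> 'a::field_char_0" where
  "wp_sum i j = (\<Sum>k=1..i. wp_term i j k)"

definition wp_rhs :: "nat \<Rightarrow> nat \<Rightarrow> 'a::field_char_0" where
  "wp_rhs i j = fact (i + j - 1) * fact (2 * i) * fact (2 * j) * inv_fact (2 * int i - int j) *
     inv_fact (2 * int j - int i) / (fact i ^ 2 * fact j ^ 2)"

text \<open>Wilf-Zeilberger certificate for the recurrence of \<open>wp_sum\<close> in \<open>i\<close>.\<close>

definition wp_cert :: "nat \<Rightarrow> nat \<Rightarrow> nat \<Rightarrow> 'a::field_char_0" where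
  "wp_cert i j k = fact (2 * k + i + 1) * fact (2 * k + j + 1) * inv_fact (2 * int k - int i) *
     inv_fact (2 * int k - int j) * inv_fact (int i + int k + 1) * inv_fact (int i - int k) *
     inv_fact (int j + int k) * inv_fact (int j - int k - 1)"

text \<open>By well-poisedness \<open>wp_cert\<close> at \<open>k\<close> and at
  \<open>k - 1\<close> is one common factor times \<open>Q k\<close> and \<open>Q (- k)\<close>. The
  difference is odd in \<open>k\<close>, in accordance with the factor \<open>k\<close> of
  \<open>wp_term\<close>.\<close>

lemma wp_cert_poly:
  fixes i j k :: "'a::field_char_0"
  defines "Q \<equiv> \<lambda>k. (2 * k + i) * (2 * k + i + 1) * ((2 * k + j) * (2 * k + j + 1)) * ((j - k) * (i + 1 - k))"
  shows "(3 * i + 2) * (Q k - Q (- k)) = - 2 * (i + j + 1) * k *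
    ((2 * i - j + 1) * (2 * i - j + 2) * (i + 1) * (4 * k ^ 2 - i ^ 2) - 2 * (i + j) * (2 * i + 1) * (2 * j - i) * ((i + 1) ^ 2 - k ^ 2))"
  unfolding Q_def by algebra

text \<open>All four terms are polynomials times \<open>M\<close>, which reduces the claim to
  \<open>wp_cert_poly\<close>. The certificate proper is \<open>wp_cert\<close> times - 2 (3 i + 2)
  / (i + j + 1); its denominator stands on the left.\<close>

lemma wp_telescope:
  assumes "i \<ge> 1" "j \<ge> 1" "k \<ge> 1"
  defines "a \<equiv> of_nat i :: 'a::field_char_0" and "b \<equiv> of_nat j :: 'a"
  shows "(a + b + 1) * ((2 * a - b + 1) * (2 * a - b + 2) * (a + 1) * wp_term (Suc i) j k
      - 2 * (a + b) * (2 * a + 1) * (2 * b - a) * wp_term i j k) =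
    - 2 * (3 * a + 2) * (wp_cert i j k - wp_cert i j (k - 1))"
proof -
  define c where "c = (of_nat k :: 'a)"
  define M where "M = fact (2 * k + i - 1) * fact (2 * k + j - 1) * inv_fact (2 * int k - int i) *
     inv_fact (2 * int k - int j) * inv_fact (int i + int k + 1) * inv_fact (int i + 1 - int k) *
     inv_fact (int j + int k) * (inv_fact (int j - int k) :: 'a)"
  let ?Q = "\<lambda>k. (2 * k + a) * (2 * k + a + 1) * ((2 * k + b) * (2 * k + b + 1)) * ((b - k) * (a + 1 - k))"
  have fm: "(fact m :: 'a) = of_nat m * fact (m - 1)" if "m \<ge> 1" for m
    using that by (cases m) auto
  have f1: "(fact (2 * k + i) :: 'a) = (2 * c + a) * fact (2 * k + i - 1)"
    "(fact (2 * k + j) :: 'a) = (2 * c + b) * fact (2 * k + j - 1)"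
    using fm[of "2 * k + i"] fm[of "2 * k + j"] assms(1-3) by (simp_all add: a_def b_def c_def)
  have f2: "(fact (2 * k + i + 1) :: 'a) = (2 * c + a + 1) * ((2 * c + a) * fact (2 * k + i - 1))"
    "(fact (2 * k + j + 1) :: 'a) = (2 * c + b + 1) * ((2 * c + b) * fact (2 * k + j - 1))"
    unfolding f1[symmetric] by (simp_all add: a_def b_def c_def algebra_simps)
  have I: "inv_fact (2 * int k - int i - 1) = (2 * c - a) * inv_fact (2 * int k - int i)"
    "inv_fact (2 * int k - int j - 1) = (2 * c - b) * inv_fact (2 * int k - int j)"
    "inv_fact (2 * int k - int i - 1 - 1) = (2 * c - a - 1) * inv_fact (2 * int k - int i - 1)"
    "inv_fact (2 * int k - int j - 1 - 1) = (2 * c - b - 1) * inv_fact (2 * int k - int j - 1)"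
    "inv_fact (int i + int k + 1 - 1) = (a + c + 1) * inv_fact (int i + int k + 1)"
    "inv_fact (int i + 1 - int k - 1) = (a + 1 - c) * inv_fact (int i + 1 - int k)"
    "inv_fact (int j + int k - 1) = (b + c) * inv_fact (int j + int k)"
    "inv_fact (int j - int k - 1) = (b - c) * inv_fact (int j - int k)"
    unfolding inv_fact_minus_1 by (simp_all add: a_def b_def c_def)
  have T1: "wp_term (Suc i) j k = 4 * c * (4 * c ^ 2 - a ^ 2) * M"
  proof -
    have e: "2 * k + Suc i - 1 = 2 * k + i" "2 * int k - int (Suc i) = 2 * int k - int i - 1"
      "int (Suc i) + int k = int i + int k + 1" "int (Suc i) - int k = int i + 1 - int k" by simp_all
    show ?thesis unfolding wp_term_def e M_def I f1 c_def[symmetric] by (simp add: algebra_simps power2_eq_square)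
  qed
  have T0: "wp_term i j k = 4 * c * ((a + 1) ^ 2 - c ^ 2) * M"
  proof -
    have I': "inv_fact (int i + int k) = (a + c + 1) * inv_fact (int i + int k + 1)"
      "inv_fact (int i - int k) = (a + 1 - c) * inv_fact (int i + 1 - int k)"
      using I(5,6) by simp_all
    show ?thesis unfolding wp_term_def M_def I' c_def[symmetric] by (simp add: algebra_simps power2_eq_square)
  qed
  have H1: "wp_cert i j k = ?Q c * M"
  proof -
    have I': "inv_fact (int i - int k) = (a + 1 - c) * inv_fact (int i + 1 - int k)"
      using I(6) by simp
    show ?thesis unfolding wp_cert_def M_def I' I(8) f2 by (simp only: mult_ac)
  qed
  have H0: "wp_cert i j (k - 1) = ?Q (- c) * M"
  proof -
    have e: "2 * (k - 1) + i + 1 = 2 * k + i - 1" "2 * (k - 1) + j + 1 = 2 * k + j - 1"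
      "2 * int (k - 1) - int i = 2 * int k - int i - 1 - 1" "2 * int (k - 1) - int j = 2 * int k - int j - 1 - 1"
      "int i + int (k - 1) + 1 = int i + int k + 1 - 1" "int i - int (k - 1) = int i + 1 - int k"
      "int j + int (k - 1) = int j + int k - 1" "int j - int (k - 1) - 1 = int j - int k"
      using assms(1-3) by (auto simp: of_nat_diff)
    have q: "?Q (- c) = ((2 * c - a - 1) * (2 * c - a)) * ((2 * c - b - 1) * (2 * c - b)) * ((b + c) * (a + c + 1))"
      by algebra
    show ?thesis unfolding wp_cert_def e I M_def q by (simp only: mult_ac)
  qed
  have "(a + b + 1) * ((2 * a - b + 1) * (2 * a - b + 2) * (a + 1) * wp_term (Suc i) j k
      - 2 * (a + b) * (2 * a + 1) * (2 * b - a) * wp_term i j k) =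
    - 2 * (- 2 * (a + b + 1) * c *
      ((2 * a - b + 1) * (2 * a - b + 2) * (a + 1) * (4 * c ^ 2 - a ^ 2) - 2 * (a + b) * (2 * a + 1) * (2 * b - a) * ((a + 1) ^ 2 - c ^ 2))) * M"
    unfolding T1 T0 by algebra
  also have "\<dots> = - 2 * ((3 * a + 2) * (?Q c - ?Q (- c))) * M"
    unfolding wp_cert_poly ..
  also have "\<dots> = - 2 * (3 * a + 2) * (wp_cert i j k - wp_cert i j (k - 1))"
    unfolding H1 H0 by (simp only: left_diff_distrib right_diff_distrib mult_ac)
  finally show ?thesis .
qed

lemma wp_sum_extend:
  assumes "K \<ge> i"
  shows "wp_sum i j = (\<Sum>k=1..K. wp_term i j k)"
  unfolding wp_sum_def
proof (rule sum.mono_neutral_left)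
  show "\<forall>k\<in>{1..K} - {1..i}. wp_term i j k = 0" by (auto simp: wp_term_def inv_fact_neg)
qed (use assms in auto)

lemma wp_sum_recurrence:
  assumes "i \<ge> 1" "j \<ge> 1"
  defines "a \<equiv> of_nat i :: 'a::field_char_0" and "b \<equiv> of_nat j :: 'a"
  shows "(2 * a - b + 1) * (2 * a - b + 2) * (a + 1) * wp_sum (Suc i) j =
    2 * (a + b) * (2 * a + 1) * (2 * b - a) * wp_sum i j"
proof -
  let ?A = "(2 * a - b + 1) * (2 * a - b + 2) * (a + 1)" and ?B = "2 * (a + b) * (2 * a + 1) * (2 * b - a)"
  have "(a + b + 1) * (?A * wp_sum (Suc i) j - ?B * wp_sum i j) =
      (\<Sum>k=1..Suc i. (a + b + 1) * (?A * wp_term (Suc i) j k - ?B * wp_term i j k))"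
    \<comment> \<open>Both sums run up to \<open>Suc i\<close>, where the summand of
      \<open>wp_sum i j\<close> is 0; a common range lets the certificate telescope.\<close>
    unfolding wp_sum_extend[of i "Suc i" j, OF le_SucI[OF order_refl]] wp_sum_extend[of "Suc i" "Suc i" j, OF order_refl]
    by (simp only: sum_distrib_left[symmetric] sum_subtractf)
  also have "\<dots> = (\<Sum>k=1..Suc i. - 2 * (3 * a + 2) * (wp_cert i j k - wp_cert i j (k - 1)))"
  proof (rule sum.cong[OF refl])
    fix k assume "k \<in> {1..Suc i}"
    then show "(a + b + 1) * (?A * wp_term (Suc i) j k - ?B * wp_term i j k) = - 2 * (3 * a + 2) * (wp_cert i j k - wp_cert i j (k - 1))"
      unfolding a_def b_def by (intro wp_telescope assms) auto
  qed
  also have "\<dots> = - 2 * (3 * a + 2) * (\<Sum>k=1..Suc i. wp_cert i j k - wp_cert i j (k - 1))"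
    by (simp only: sum_distrib_left)
  also have "(\<Sum>k=1..Suc i. wp_cert i j k - wp_cert i j (k - 1)) = wp_cert i j (Suc i) - (wp_cert i j 0 :: 'a)"
  proof -
    have "(\<Sum>k=1..Suc i. wp_cert i j k - wp_cert i j (k - 1)) = (\<Sum>k<Suc i. wp_cert i j (Suc k) - (wp_cert i j k :: 'a))"
      by (simp only: One_nat_def sum.atLeast1_atMost_eq diff_Suc_Suc diff_zero)
    also have "\<dots> = wp_cert i j (Suc i) - wp_cert i j 0" by (rule sum_lessThan_telescope)
    finally show ?thesis .
  qed
  \<comment> \<open>Both ends vanish: at \<open>Suc i\<close> through
    \<open>inv_fact (i - k)\<close>, at 0 through \<open>inv_fact (2 * k - i)\<close>.\<close>
  also have "wp_cert i j (Suc i) = (0 :: 'a)" by (simp add: wp_cert_def inv_fact_neg)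
  also have "wp_cert i j 0 = (0 :: 'a)" using assms by (simp add: wp_cert_def inv_fact_neg)
  finally have "(a + b + 1) * (?A * wp_sum (Suc i) j - ?B * wp_sum i j) = 0" by simp
  moreover have "a + b + 1 \<noteq> 0"
  proof -
    have "a + b + 1 = of_nat (Suc (i + j))" by (simp add: a_def b_def)
    then show ?thesis by (simp only: of_nat_neq_0 not_False_eq_True)
  qed
  ultimately show ?thesis by simp
qed

lemma wp_rhs_recurrence:
  assumes "i \<ge> 1" "j \<ge> 1"
  defines "a \<equiv> of_nat i :: 'a::field_char_0" and "b \<equiv> of_nat j :: 'a"
  shows "(2 * a - b + 1) * (2 * a - b + 2) * (a + 1) * wp_rhs (Suc i) j =
    2 * (a + b) * (2 * a + 1) * (2 * b - a) * wp_rhs i j"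
proof -
  have a1: "a + 1 \<noteq> 0" using of_nat_neq_0[of i, where 'a = 'a] by (simp add: a_def add.commute)
  obtain n where n: "i + j = Suc n" using assms by (cases "i + j") auto
  have f1: "(fact (Suc i + j - 1) :: 'a) = (a + b) * fact (i + j - 1)"
  proof -
    have "(of_nat (Suc n) :: 'a) = a + b" unfolding a_def b_def n[symmetric] by simp
    then show ?thesis using n by (simp del: of_nat_Suc)
  qed
  have f2: "(fact (2 * Suc i) :: 'a) = 2 * (a + 1) * (2 * a + 1) * fact (2 * i)"
    by (simp add: a_def algebra_simps)
  have f3: "(fact (Suc i) :: 'a) = (a + 1) * fact i" by (simp add: a_def algebra_simps)
  have i1: "(2 * a - b + 1) * ((2 * a - b + 2) * inv_fact (2 * int (Suc i) - int j)) = inv_fact (2 * int i - int j)"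
  proof -
    have "inv_fact (2 * int (Suc i) - int j - 1) = (2 * a - b + 2) * inv_fact (2 * int (Suc i) - int j)"
      unfolding inv_fact_minus_1 by (simp add: a_def b_def algebra_simps)
    moreover have "inv_fact (2 * int (Suc i) - int j - 1 - 1) = (2 * a - b + 1) * inv_fact (2 * int (Suc i) - int j - 1)"
      unfolding inv_fact_minus_1[of "2 * int (Suc i) - int j - 1"] by (simp add: a_def b_def algebra_simps)
    moreover have "2 * int (Suc i) - int j - 1 - 1 = 2 * int i - int j" by simp
    ultimately show ?thesis by simp
  qed
  have i2: "inv_fact (2 * int j - int (Suc i)) = (2 * b - a) * inv_fact (2 * int j - int i)"
  proof -
    have "2 * int j - int (Suc i) = 2 * int j - int i - 1" by simp
    then show ?thesis by (simp only: inv_fact_minus_1) (simp add: a_def b_def)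
  qed
  have "(2 * a - b + 1) * (2 * a - b + 2) * (a + 1) * wp_rhs (Suc i) j =
     (a + 1) * (fact (Suc i + j - 1) * fact (2 * Suc i) * fact (2 * j) *
     ((2 * a - b + 1) * ((2 * a - b + 2) * inv_fact (2 * int (Suc i) - int j))) *
     inv_fact (2 * int j - int (Suc i))) / (fact (Suc i) ^ 2 * fact j ^ 2)"
    unfolding wp_rhs_def by (simp only: times_divide_eq_right mult_ac)
  also have "\<dots> = ((a + 1) ^ 2 * (2 * (a + b) * (2 * a + 1) * (2 * b - a) * (fact (i + j - 1) * fact (2 * i) * fact (2 * j) *
      inv_fact (2 * int i - int j) * inv_fact (2 * int j - int i)))) / ((a + 1) ^ 2 * (fact i ^ 2 * fact j ^ 2))"
    unfolding i1 i2 f1 f2 f3 by (simp only: power2_eq_square mult_ac)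
  also have "\<dots> = 2 * (a + b) * (2 * a + 1) * (2 * b - a) * wp_rhs i j"
    using a1 by (simp add: wp_rhs_def mult.assoc)
  finally show ?thesis .
qed

lemma wp_sum_eq_0: "2 * i < j \<Longrightarrow> wp_sum i j = 0"
  unfolding wp_sum_def by (rule sum.neutral) (auto simp: wp_term_def inv_fact_neg)

lemma wp_rhs_eq_0: "2 * i < j \<Longrightarrow> wp_rhs i j = 0"
  by (simp add: wp_rhs_def inv_fact_neg)

lemma wp_sum_single:
  assumes "i \<ge> 1" "2 * i \<le> Suc j"
  shows "wp_sum i j = wp_term i j i"
proof -
  have "wp_sum i j = (\<Sum>k\<in>{i}. wp_term i j k)"
    unfolding wp_sum_def
  proof (rule sum.mono_neutral_right)
    show "\<forall>k\<in>{1..i} - {i}. wp_term i j k = 0" using assms by (auto simp: wp_term_def inv_fact_neg)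
  qed (use assms in auto)
  then show ?thesis by simp
qed

lemma wp_sum_base:
  assumes i: "i \<ge> 1" and j: "j = 2 * i \<or> Suc j = 2 * i"
  shows "(wp_sum i j :: 'a::field_char_0) = wp_rhs i j"
  using j
proof
  assume j: "j = 2 * i"
  have "(fact (4 * i) :: 'a) = of_nat (4 * i) * fact (4 * i - 1)" using i by (cases "4 * i") auto
  then have f: "(fact (4 * i) :: 'a) = 4 * of_nat i * fact (4 * i - 1)" by simp
  have e: "inv_fact (2 * int i - int i) = (1 / fact i :: 'a)" "inv_fact (int i + int i) = (1 / fact (2 * i) :: 'a)"
    "inv_fact (int (2 * i) + int i) = (1 / fact (3 * i) :: 'a)" "inv_fact (int (2 * i) - int i) = (1 / fact i :: 'a)"
    "inv_fact (2 * int (2 * i) - int i) = (1 / fact (3 * i) :: 'a)"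
    using inv_fact_of_nat[of i, where 'a = 'a] inv_fact_of_nat[of "2 * i", where 'a = 'a] inv_fact_of_nat[of "3 * i", where 'a = 'a]
    by (simp_all add: algebra_simps)
  have z: "inv_fact 0 = (1 :: 'a)" by (simp add: inv_fact_def)
  have "wp_sum i j = (wp_term i j i :: 'a)" using i j by (intro wp_sum_single) auto
  also have "\<dots> = fact (3 * i - 1) * (4 * of_nat i * fact (4 * i - 1)) / (fact i ^ 2 * fact (2 * i) * fact (3 * i))"
    unfolding j wp_term_def e by (simp add: z power2_eq_square mult_ac)
  also have "\<dots> = wp_rhs i j"
    unfolding j wp_rhs_def e f[symmetric] by (simp add: z power2_eq_square)
  finally show ?thesis .
next
  assume j: "Suc j = 2 * i"
  obtain n where n: "i = Suc n" using i by (cases i) auto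
  have jn: "j = 2 * n + 1" using j n by simp
  have e: "inv_fact (2 * int i - int i) = (1 / fact (n + 1) :: 'a)" "inv_fact (2 * int i - int j) = (1 / fact 1 :: 'a)"
    "inv_fact (int i + int i) = (1 / fact (2 * n + 2) :: 'a)" "inv_fact (int i - int i) = (1 / fact 0 :: 'a)"
    "inv_fact (int j + int i) = (1 / fact (3 * n + 2) :: 'a)" "inv_fact (int j - int i) = (1 / fact n :: 'a)"
    "inv_fact (2 * int j - int i) = (1 / fact (3 * n + 1) :: 'a)"
    using inv_fact_of_nat[of "n + 1", where 'a = 'a] inv_fact_of_nat[of 1, where 'a = 'a] inv_fact_of_nat[of "2 * n + 2", where 'a = 'a]
      inv_fact_of_nat[of 0, where 'a = 'a] inv_fact_of_nat[of "3 * n + 2", where 'a = 'a] inv_fact_of_nat[of n, where 'a = 'a]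
      inv_fact_of_nat[of "3 * n + 1", where 'a = 'a]
    by (simp_all add: n jn algebra_simps)
  have e': "2 * i + i - 1 = 3 * n + 2" "2 * i + j - 1 = 4 * n + 2" "i + j - 1 = 3 * n + 1" "2 * i = 2 * n + 2" "2 * j = 4 * n + 2"
    "i = n + 1" "of_nat i = (of_nat n + 1 :: 'a)"
    by (simp_all add: n jn)
  have nz: "(of_nat n + 1 :: 'a) \<noteq> 0" using of_nat_neq_0[of n, where 'a = 'a] by (simp add: add.commute)
  have f: "(fact (n + 1) :: 'a) = (of_nat n + 1) * fact n" "(fact (2 * n + 2) :: 'a) = 2 * (of_nat n + 1) * fact (2 * n + 1)"
    by (simp_all add: algebra_simps)
  have "wp_sum i j = (wp_term i j i :: 'a)" using i j by (intro wp_sum_single) auto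
  also have "\<dots> = 4 * (of_nat n + 1) * fact (4 * n + 2) / (fact (n + 1) * fact (2 * n + 2) * fact n)"
  proof -
    have gen: "4 * c * x * y * (1 / p) * (1 / 1) * (1 / q) * (1 / 1) * (1 / x) * (1 / r) = 4 * c * y / (p * q * r)"
      if "x \<noteq> 0" for c x y p q r :: 'a
      using that by simp
    show ?thesis unfolding wp_term_def e unfolding e'(1,2,7) fact_0 fact_1 by (rule gen) (rule fact_nonzero)
  qed
  also have "\<dots> = fact (4 * n + 2) * fact (2 * n + 2) / (fact (n + 1) ^ 2 * fact (2 * n + 1) ^ 2)"
  proof -
    have gen: "4 * c * y / ((c * x) * (2 * c * z) * x) = y * (2 * c * z) / ((c * x) ^ 2 * z ^ 2)"
      if "c \<noteq> 0" "x \<noteq> 0" "z \<noteq> 0" for c x y z :: 'a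
      using that by (simp add: power2_eq_square field_simps)
    show ?thesis unfolding f by (intro gen nz fact_nonzero)
  qed
  also have "\<dots> = wp_rhs i j"
  proof -
    have gen: "y * q / (p ^ 2 * r ^ 2) = x * q * y * (1 / 1) * (1 / x) / (p ^ 2 * r ^ 2)"
      if "x \<noteq> 0" for x y p q r :: 'a
      using that by simp
    show ?thesis
      unfolding wp_rhs_def e unfolding e'(3) unfolding e'(4,5) unfolding e'(6) jn fact_1 by (rule gen) (rule fact_nonzero)
  qed
  finally show ?thesis .
qed

text \<open>The leading coefficient of the recurrence vanishes when \<open>2 * i\<close> is
  \<open>j - 1\<close> or \<open>j - 2\<close>. The values at \<open>Suc i\<close> missed this way
  are those of \<open>wp_sum_base\<close>, where a single summand survives; for smaller
  \<open>i\<close> both sides are 0.\<close>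

theorem well_poised_sum:
  assumes "i \<ge> 1" "j \<ge> 1"
  shows "(wp_sum i j :: 'a::field_char_0) = wp_rhs i j"
  using assms(1)
proof (induction i rule: dec_induct)
  case base
  consider "j = 1" | "j = 2" | "j > 2" using assms(2) by linarith
  then show ?case by cases (auto simp: wp_sum_eq_0 wp_rhs_eq_0 wp_sum_base)
next
  case (step i)
  show ?case
  proof (cases "2 * i \<ge> j")
    case True
    let ?a = "of_nat i :: 'a" and ?b = "of_nat j :: 'a"
    have "2 * ?a - ?b + 1 = of_nat (Suc (2 * i - j))" "2 * ?a - ?b + 2 = of_nat (Suc (Suc (2 * i - j)))" "?a + 1 = of_nat (Suc i)"
      using True by (simp_all add: of_nat_diff)
    then have "(2 * ?a - ?b + 1) * (2 * ?a - ?b + 2) * (?a + 1) \<noteq> 0"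
      by (simp only: mult_eq_0_iff of_nat_neq_0 simp_thms)
    moreover have "(2 * ?a - ?b + 1) * (2 * ?a - ?b + 2) * (?a + 1) * wp_sum (Suc i) j =
        (2 * ?a - ?b + 1) * (2 * ?a - ?b + 2) * (?a + 1) * wp_rhs (Suc i) j"
      using wp_sum_recurrence[OF step(1) assms(2), where 'a = 'a] wp_rhs_recurrence[OF step(1) assms(2), where 'a = 'a] step.IH by simp
    ultimately show ?thesis by (rule mult_left_cancel[THEN iffD1])
  next
    case False
    then have "j = 2 * Suc i \<or> Suc j = 2 * Suc i \<or> 2 * Suc i < j" by presburger
    then consider "j = 2 * Suc i" | "Suc j = 2 * Suc i" | "2 * Suc i < j" by blast
    then show ?thesis by cases (auto simp: wp_sum_eq_0 wp_rhs_eq_0 intro!: wp_sum_base)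
  qed
qed

section \<open>The factorization of the matrix of \<open>U\<close>\<close>

text \<open>The factors of \<open>wp_term\<close> that contain \<open>i\<close>, with
  \<open>j\<close> in the place of \<open>k\<close>, scaled to be 1 on the diagonal.\<close>

definition a_coeff :: "nat \<Rightarrow> nat \<Rightarrow> 'a::field_char_0" where
  "a_coeff i j = 4 ^ i / 4 ^ j * fact i ^ 2 * fact (2 * j) ^ 2 * fact (2 * j + i - 1) * inv_fact (2 * int j - int i) *
     inv_fact (int j + int i) * inv_fact (int i - int j) / (fact (2 * i) * fact j * fact (3 * j - 1))"

text \<open>Because \<open>u_coeff i j\<close> divided by \<open>j\<close> is symmetric, the right
  factor is the transpose of the left one up to the weights \<open>j\<close> and
  \<open>k\<close>.\<close>

definition b_coeff :: "nat \<Rightarrow> nat \<Rightarrow> 'a::field_char_0" where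
  "b_coeff k j = a_coeff j k * of_nat j / of_nat k"

lemma a_coeff_eq_0: "i < j \<or> 2 * j < i \<Longrightarrow> a_coeff i j = 0"
  by (auto simp: a_coeff_def inv_fact_neg)

lemma a_coeff_same: "j \<ge> 1 \<Longrightarrow> a_coeff j j = 1"
proof -
  have e: "inv_fact (2 * int j - int j) = (1 / fact j :: 'a)" "inv_fact (int j + int j) = (1 / fact (2 * j) :: 'a)"
    "inv_fact (int j - int j) = (1 :: 'a)"
    using inv_fact_of_nat[of j, where 'a = 'a] inv_fact_of_nat[of "2 * j", where 'a = 'a] inv_fact_of_nat[of 0, where 'a = 'a]
    by simp_all
  show ?thesis unfolding a_coeff_def e by (simp add: power2_eq_square)
qed

text \<open>\<open>d_entry k\<close> absorbs all factors in \<open>k\<close> brought in by scaling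
  the diagonals of the outer matrices to 1; what is left is \<open>wp_term\<close> times
  \<open>?c\<close>, which is free of \<open>k\<close>.\<close>

lemma u_coeff_factorization:
  assumes "i \<ge> 1" "j \<ge> 1"
  shows "(u_coeff i j :: Q2) = (\<Sum>k=1..i. a_coeff i k * d_entry k * b_coeff k j)"
proof -
  let ?c = "4 ^ i * 4 ^ j * fact i ^ 2 * fact j ^ 2 / (fact (2 * i) * fact (2 * j)) * (3 * of_nat j / 2) :: Q2"
  have t: "a_coeff i k * d_entry k * b_coeff k j = ?c * wp_term i j k" if "k \<ge> 1" for k
  proof -
    have k0: "(of_nat k :: Q2) \<noteq> 0" using that by simp
    have f: "(fact (3 * k) :: Q2) = 3 * of_nat k * fact (3 * k - 1)"
      using fact_reduce[of "3 * k", where 'a = Q2] that by simp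
    have p: "(2 :: Q2) ^ (4 * k + 1) = 2 * (4 ^ k * 4 ^ k)"
    proof -
      have "(2 :: Q2) ^ (4 * k + 1) = 2 * ((2 ^ 4) ^ k)" by (simp add: power_mult)
      then show ?thesis by (simp flip: power_mult_distrib)
    qed
    \<comment> \<open>Free variables stand for the factorials, so that the cancellation is a field
      identity in which no factorial unfolds.\<close>
    have gen: "p / q * F ^ 2 * T ^ 2 * X * i1 * i2 * i3 / (G * H * Z) * (2 * (q * q) * (3 * c * Z) ^ 2 * H ^ 2 / (3 * T ^ 4)) *
        (r / q * F' ^ 2 * T ^ 2 * X' * i1' * i2' * i3' / (G' * H * Z) * b / c) =
        p * r * F ^ 2 * F' ^ 2 / (G * G') * (3 * b / 2) * (4 * c * X * X' * i1 * i1' * i2 * i3 * i2' * i3')"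
      if "q \<noteq> 0" "c \<noteq> 0" "Z \<noteq> 0" "T \<noteq> 0" "H \<noteq> 0" "G \<noteq> 0" "G' \<noteq> 0"
      for p q F T X i1 i2 i3 G H Z c r F' X' i1' i2' i3' G' b :: Q2
      using that by (simp add: field_simps power2_eq_square power4_eq_xxxx)
    show ?thesis
      unfolding a_coeff_def b_coeff_def d_entry_def wp_term_def f p add.commute[of "int k"]
      by (rule gen) (use k0 in auto)
  qed
  have "(\<Sum>k=1..i. a_coeff i k * d_entry k * b_coeff k j) = (\<Sum>k=1..i. ?c * wp_term i j k)"
    by (rule sum.cong[OF refl], rule t) simp
  also have "\<dots> = ?c * wp_rhs i j"
    unfolding well_poised_sum[OF assms, symmetric] wp_sum_def by (rule sum_distrib_left[symmetric])
  also have "\<dots> = u_coeff i j"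
  proof -
    obtain n where n: "2 * i + 2 * j = Suc n" using assms by (cases "2 * i + 2 * j") auto
    have "(4 :: Q2) ^ i * 4 ^ j = (2 ^ 2) ^ i * (2 ^ 2) ^ j" by simp
    also have "\<dots> = 2 ^ (2 * i + 2 * j)" by (simp only: power_mult power_add)
    also have "\<dots> = 2 * 2 ^ (2 * i + 2 * j - 1)" unfolding n by simp
    finally have p: "(4 :: Q2) ^ i * 4 ^ j = 2 * 2 ^ (2 * i + 2 * j - 1)" .
    show ?thesis unfolding wp_rhs_def u_coeff_def p by simp
  qed
  finally show ?thesis ..
qed

section \<open>The 2-adic size of the three factors\<close>

lemma norm2_2: "norm2 2 = 1 / 2"
proof -
  have "abs2 2 = 1 / 2" using abs2_quot[of 2 1] by (simp add: power_int_minus)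
  then show ?thesis using norm2_of_rat[of 2] by simp
qed

lemma norm2_of_nat_odd:
  assumes "odd n"
  shows "norm2 (of_nat n) = 1"
proof -
  obtain m where m: "n = 2 * m + 1" using assms by (rule oddE)
  have "norm2 (2 * of_nat m) < norm2 1"
    using norm2_of_nat_le[of m] by (simp add: norm2_mult norm2_2)
  from norm2_add_dominant[OF this] show ?thesis by (simp add: m add.commute)
qed

text \<open>Among 2j + 1, ..., 2j + k the odd numbers are units, and the even ones are the doubles
  of j + 1, ..., j + (k div 2).\<close>

lemma norm2_pochhammer_odd: "norm2 (pochhammer (of_nat (2 * j + 1)) k) = (1 / 2) ^ (k div 2) * norm2 (pochhammer (of_nat (j + 1)) (k div 2))"
proof -
  have even: "norm2 (pochhammer (of_nat (2 * j + 1)) (2 * m)) = (1 / 2) ^ m * norm2 (pochhammer (of_nat (j + 1)) m)" for m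
  proof (induction m)
    case (Suc m)
    have "pochhammer (of_nat (2 * j + 1) :: Q2) (2 * Suc m) =
        pochhammer (of_nat (2 * j + 1)) (2 * m) * of_nat (2 * (j + m) + 1) * (2 * of_nat (j + 1 + m))"
      by (simp add: pochhammer_Suc algebra_simps)
    moreover have "pochhammer (of_nat (j + 1) :: Q2) (Suc m) = pochhammer (of_nat (j + 1)) m * of_nat (j + 1 + m)"
      by (simp add: pochhammer_Suc algebra_simps)
    moreover have "norm2 (of_nat (2 * (j + m) + 1)) = 1" by (rule norm2_of_nat_odd) simp
    ultimately show ?case using Suc by (simp only: norm2_mult norm2_2) simp
  qed simp
  show ?thesis
  proof (cases "even k")
    case True
    then show ?thesis using even[of "k div 2"] by simp
  next
    case False
    then obtain m where k: "k = 2 * m + 1" by (rule oddE)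
    have "pochhammer (of_nat (2 * j + 1) :: Q2) k = pochhammer (of_nat (2 * j + 1)) (2 * m) * of_nat (2 * (j + m) + 1)"
      by (simp add: k pochhammer_Suc algebra_simps)
    moreover have "norm2 (of_nat (2 * (j + m) + 1)) = 1" by (rule norm2_of_nat_odd) simp
    ultimately show ?thesis using even[of m] by (simp only: norm2_mult k) simp
  qed
qed

lemma norm2_pochhammer_of_nat_le: "norm2 (pochhammer (of_nat n) k) \<le> 1"
  unfolding pochhammer_of_nat by (rule norm2_of_nat_le)

text \<open>The part of \<open>a_coeff (j + k) j\<close> that carries the denominators; its
  cofactors in \<open>a_coeff_ratio\<close> are integers.\<close>

definition a_ratio :: "nat \<Rightarrow> nat \<Rightarrow> Q2" where
  "a_ratio j k = 2 ^ k * pochhammer (of_nat (j + 1)) k /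
     (pochhammer (of_nat (2 * j + 1)) k * (\<Prod>s<k. of_nat (2 * (j + s) + 1)))"

text \<open>The denominator uses up \<open>k div 2\<close> of the \<open>k\<close> powers of 2.
  Apart from odd factors, what it has left is a Pochhammer product that is an initial piece of the
  one in the numerator.\<close>

lemma norm2_a_ratio_le:
  assumes "k \<ge> 1"
  shows "norm2 (a_ratio j k) \<le> 1 / 2"
proof -
  let ?m = "k div 2"
  let ?p = "norm2 (pochhammer (of_nat (j + 1)) ?m)"
  have "pochhammer (of_nat (j + 1) :: Q2) ?m \<noteq> 0" unfolding pochhammer_of_nat of_nat_eq_0_iff
    by (simp add: pochhammer_pos)
  then have p: "?p > 0" by (simp add: less_le)
  have "(\<Prod>s<k. norm2 (of_nat (2 * (j + s) + 1))) = (\<Prod>s<k. 1)"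
    by (rule prod.cong[OF refl], rule norm2_of_nat_odd) simp
  then have odd: "norm2 (\<Prod>s<k. of_nat (2 * (j + s) + 1)) = 1" unfolding norm2_prod by simp
  have "pochhammer (of_nat (j + 1) :: Q2) k = pochhammer (of_nat (j + 1)) ?m * pochhammer (of_nat (j + 1) + of_nat ?m) (k - ?m)"
    by (rule pochhammer_product) simp
  then have "norm2 (pochhammer (of_nat (j + 1)) k) = ?p * norm2 (pochhammer (of_nat (j + 1 + ?m)) (k - ?m))"
    by (simp only: norm2_mult of_nat_add)
  also have "\<dots> \<le> ?p * 1" using p by (intro mult_left_mono norm2_pochhammer_of_nat_le) auto
  finally have le: "norm2 (pochhammer (of_nat (j + 1)) k) \<le> ?p" by simp
  have "norm2 (a_ratio j k) = (1 / 2) ^ k * norm2 (pochhammer (of_nat (j + 1)) k) / ((1 / 2) ^ ?m * ?p)"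
    unfolding a_ratio_def norm2_divide norm2_mult norm2_power norm2_2 odd norm2_pochhammer_odd by simp
  also have "\<dots> \<le> (1 / 2) ^ k * ?p / ((1 / 2) ^ ?m * ?p)"
    using le p by (intro divide_right_mono mult_left_mono) auto
  also have "\<dots> = (1 / 2) ^ k / (1 / 2) ^ ?m"
    by (rule mult_divide_mult_cancel_right) (rule p[THEN less_imp_neq, symmetric])
  also have "\<dots> = (1 / 2) ^ (k - ?m)" by (subst power_diff) auto
  also have "\<dots> \<le> (1 / 2) ^ 1" using assms by (intro power_decreasing) auto
  finally show ?thesis by simp
qed

lemma fact_add_pochhammer: "(fact (n + k) :: 'a::field_char_0) = fact n * pochhammer (of_nat (n + 1)) k"
  by (induction k) (simp_all add: pochhammer_Suc algebra_simps)

lemma fact_double_shift: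
  "(fact (2 * j + 2 * k) :: Q2) = fact (2 * j) * (2 ^ k * pochhammer (of_nat (j + 1)) k * (\<Prod>s<k. of_nat (2 * (j + s) + 1)))"
proof (induction k)
  case (Suc k)
  have "(fact (2 * j + 2 * Suc k) :: Q2) = of_nat (2 * j + 2 * k + 2) * (of_nat (2 * (j + k) + 1) * fact (2 * j + 2 * k))"
    by (simp add: algebra_simps)
  also have "\<dots> = fact (2 * j) * (2 ^ Suc k * pochhammer (of_nat (j + 1)) (Suc k) * (\<Prod>s<Suc k. of_nat (2 * (j + s) + 1)))"
    unfolding Suc pochhammer_Suc by (simp add: algebra_simps)
  finally show ?case .
qed simp

lemma a_coeff_ratio:
  assumes "j \<ge> 1" "k \<le> j"
  shows "a_coeff (j + k) j = a_ratio j k * of_nat (j choose k) * pochhammer (of_nat (3 * j)) k"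
proof -
  let ?P = "pochhammer (of_nat (j + 1)) k :: Q2" and ?P2 = "pochhammer (of_nat (2 * j + 1)) k :: Q2"
    and ?O = "\<Prod>s<k. of_nat (2 * (j + s) + 1) :: Q2" and ?P3 = "pochhammer (of_nat (3 * j)) k :: Q2"
  have e: "inv_fact (2 * int j - int (j + k)) = (1 / fact (j - k) :: Q2)" "inv_fact (int j + int (j + k)) = (1 / fact (2 * j + k) :: Q2)"
    "inv_fact (int (j + k) - int j) = (1 / fact k :: Q2)"
    using inv_fact_of_nat[of "j - k", where 'a = Q2] inv_fact_of_nat[of "2 * j + k", where 'a = Q2] inv_fact_of_nat[of k, where 'a = Q2] assms
    by (simp_all add: of_nat_diff algebra_simps)
  have e': "2 * j + (j + k) - 1 = (3 * j - 1) + k" "2 * (j + k) = 2 * j + 2 * k" using assms by auto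
  have f1: "(fact (j + k) :: Q2) = fact j * ?P" by (rule fact_add_pochhammer)
  have f2: "(fact (2 * j + k) :: Q2) = fact (2 * j) * ?P2" by (rule fact_add_pochhammer)
  have f3: "(fact ((3 * j - 1) + k) :: Q2) = fact (3 * j - 1) * ?P3"
    using fact_add_pochhammer[of "3 * j - 1" k, where 'a = Q2] assms by simp
  have f4: "(fact (2 * j + 2 * k) :: Q2) = fact (2 * j) * (2 ^ k * ?P * ?O)" by (rule fact_double_shift)
  have bin: "(of_nat (j choose k) :: Q2) = fact j / (fact k * fact (j - k))"
    using assms by (simp add: binomial_fact)
  have nz: "?P \<noteq> 0" "?P2 \<noteq> 0" "?O \<noteq> 0"
  proof -
    show "?P \<noteq> 0" "?P2 \<noteq> 0" unfolding pochhammer_of_nat of_nat_eq_0_iff by (simp_all add: pochhammer_pos)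
    show "?O \<noteq> 0" by (simp only: prod_zero_iff finite_lessThan of_nat_eq_0_iff) simp
  qed
  have p: "(4 :: Q2) ^ (j + k) / 4 ^ j = 2 ^ k * 2 ^ k"
  proof -
    have "(4 :: Q2) ^ k = 2 ^ k * 2 ^ k" by (simp flip: power_mult_distrib)
    then show ?thesis by (simp add: power_add)
  qed
  have gen: "t * t * (J * P) ^ 2 * T ^ 2 * (Z * P3) * (1 / M) * (1 / (T * P2)) * (1 / K) / (T * (t * P * W) * J * Z) =
      t * P / (P2 * W) * (J / (K * M)) * P3"
    if "t \<noteq> 0" "J \<noteq> 0" "P \<noteq> 0" "T \<noteq> 0" "Z \<noteq> 0" "M \<noteq> 0" "P2 \<noteq> 0" "K \<noteq> 0" "W \<noteq> 0"
    for t J P T Z P3 M P2 K W :: Q2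
    using that by (simp add: field_simps power2_eq_square)
  show ?thesis
    unfolding a_coeff_def e e' f1 f2 f3 f4 p a_ratio_def bin
    by (rule gen) (use nz in auto)
qed

lemma norm2_a_coeff:
  assumes "j \<ge> 1"
  shows "norm2 (a_coeff i j - (if i = j then 1 else 0)) \<le> 1 / 2"
proof -
  consider "i < j \<or> 2 * j < i" | "i = j" | k where "i = j + k" "k \<ge> 1" "k \<le> j"
    using assms le_Suc_ex[of j i] by fastforce
  then show ?thesis
  proof cases
    case (3 k)
    have "norm2 (a_coeff i j) \<le> 1 / 2"
      unfolding 3(1) a_coeff_ratio[OF assms 3(3)]
      by (intro norm2_mult_le_right norm2_a_ratio_le 3 norm2_of_nat_le norm2_pochhammer_of_nat_le)
    then show ?thesis using 3 by simp
  qed (use assms in \<open>auto simp: a_coeff_eq_0 a_coeff_same\<close>)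
qed

text \<open>The weight divides by \<open>j\<close>, but the Pochhammer product starting at
  \<open>3 * j\<close> contains \<open>j\<close>; after cancellation the bound for
  \<open>a_ratio\<close> applies again.\<close>

lemma norm2_b_coeff:
  assumes "j \<ge> 1"
  shows "norm2 (b_coeff j i - (if i = j then 1 else 0)) \<le> 1 / 2"
proof -
  consider "i < j \<or> 2 * j < i" | "i = j" | k where "i = j + k" "k \<ge> 1" "k \<le> j"
    using assms le_Suc_ex[of j i] by fastforce
  then show ?thesis
  proof cases
    case (3 k)
    then obtain m where m: "k = Suc m" by (cases k) auto
    have "pochhammer (of_nat (3 * j) :: Q2) k = of_nat (3 * j) * pochhammer (of_nat (3 * j + 1)) m"
      unfolding m pochhammer_rec by (simp add: add.commute)
    then have "b_coeff j i = a_ratio j k * of_nat (j choose k) * (of_nat (3 * i) * pochhammer (of_nat (3 * j + 1)) m)"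
      unfolding b_coeff_def 3(1) a_coeff_ratio[OF assms 3(3)] using assms by (simp add: field_simps)
    also have "norm2 \<dots> \<le> 1 / 2"
      by (intro norm2_mult_le_right[of "a_ratio j k * of_nat (j choose k)"] norm2_mult_le_right[of "a_ratio j k"]
        norm2_mult_le_left norm2_a_ratio_le 3 norm2_of_nat_le norm2_pochhammer_of_nat_le)
    finally show ?thesis using 3 by simp
  qed (use assms in \<open>auto simp: b_coeff_def a_coeff_eq_0 a_coeff_same\<close>)
qed

lemma d_entry_nonzero: "d_entry j \<noteq> 0"
  by (simp add: d_entry_def)

text \<open>The quotient of consecutive entries is 9 ((3j + 1)(3j + 2))^2 / (2j + 1)^4. One of two
  consecutive integers is even, and the square doubles its contribution.\<close>

lemma norm2_d_entry_Suc: "norm2 (d_entry (Suc j)) \<le> norm2 (d_entry j) / 4"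
proof -
  let ?j = "of_nat j :: Q2"
  have f1: "(fact (3 * Suc j) :: Q2) = 3 * (?j + 1) * ((3 * ?j + 1) * (3 * ?j + 2)) * fact (3 * j)"
    by (simp add: numeral_3_eq_3 algebra_simps)
  have f2: "(fact (2 * Suc j) :: Q2) = 2 * (?j + 1) * (2 * ?j + 1) * fact (2 * j)"
    by (simp add: algebra_simps)
  have f3: "(fact (Suc j) :: Q2) = (?j + 1) * fact j" by simp
  have p: "(2 :: Q2) ^ (4 * Suc j + 1) = 16 * 2 ^ (4 * j + 1)" by (simp add: power_add)
  have nz: "?j + 1 \<noteq> 0" "2 * ?j + 1 \<noteq> 0"
    using of_nat_neq_0[of j, where 'a = Q2] of_nat_neq_0[of "2 * j", where 'a = Q2] by (simp_all add: add.commute)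
  have gen: "16 * t * (3 * c * w * F) ^ 2 * (c * J) ^ 2 / (3 * (2 * c * y * T) ^ 4) * y ^ 4 = 9 * w ^ 2 * (t * F ^ 2 * J ^ 2 / (3 * T ^ 4))"
    if "c \<noteq> 0" "y \<noteq> 0" "T \<noteq> 0" for t c w F J y T :: Q2
    using that by (simp add: field_simps power2_eq_square power4_eq_xxxx)
  have "d_entry (Suc j) * (2 * ?j + 1) ^ 4 = 9 * ((3 * ?j + 1) * (3 * ?j + 2)) ^ 2 * d_entry j"
    unfolding d_entry_def f1 f2 f3 p by (rule gen) (use nz in auto)
  then have "norm2 (d_entry (Suc j)) * norm2 (of_nat (2 * j + 1)) ^ 4 =
      norm2 (of_nat 9) * norm2 (of_nat ((3 * j + 1) * (3 * j + 2))) ^ 2 * norm2 (d_entry j)"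
    unfolding norm2_mult[symmetric] norm2_power[symmetric]
    by (simp only: of_nat_add of_nat_mult of_nat_numeral of_nat_1)
  also have "norm2 (of_nat (2 * j + 1)) = 1" by (rule norm2_of_nat_odd) simp
  also have "norm2 (of_nat 9) = 1" by (rule norm2_of_nat_odd) simp
  finally have eq: "norm2 (d_entry (Suc j)) = norm2 (of_nat ((3 * j + 1) * (3 * j + 2))) ^ 2 * norm2 (d_entry j)" by simp
  have "even ((3 * j + 1) * (3 * j + 2))" by simp
  then obtain m where m: "(3 * j + 1) * (3 * j + 2) = 2 * m" by (rule evenE)
  have "norm2 (of_nat ((3 * j + 1) * (3 * j + 2))) \<le> 1 / 2"
    unfolding m of_nat_mult by (intro norm2_mult_le_right norm2_of_nat_le) (simp add: norm2_2)
  then have "norm2 (of_nat ((3 * j + 1) * (3 * j + 2))) ^ 2 \<le> (1 / 2) ^ 2" by (rule power_mono) simp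
  from mult_right_mono[OF this norm2_nonneg[of "d_entry j"]] show ?thesis
    unfolding eq by (simp add: power2_eq_square)
qed

lemma norm2_d_entry_less: "i < j \<Longrightarrow> norm2 (d_entry j) < norm2 (d_entry i)"
proof (induction j rule: less_Suc_induct)
  case (1 i)
  have "norm2 (d_entry i) > 0" using d_entry_nonzero[of i] by (simp add: less_le)
  then show ?case using norm2_d_entry_Suc[of i] by linarith
qed simp

lemma norm2_d_entry_le: "norm2 (d_entry (Suc j)) \<le> (1 / 4) ^ j"
proof (induction j)
  case 0
  have "d_entry (Suc 0) = of_nat 24" by (simp add: d_entry_def fact_numeral)
  then show ?case using norm2_of_nat_le[of 24] by simp
next
  case (Suc j)
  then show ?case using norm2_d_entry_Suc[of "Suc j"] by simp
qed

lemma compact_matrix_scale_rows: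
  assumes "\<And>i j. norm2 (C i j) \<le> 1"
  shows "compact_matrix (\<lambda>i j. d_entry (Suc i) * C i j)"
proof -
  have le: "norm2 (d_entry (Suc i) * C i j) \<le> (1 / 4) ^ i" for i j
    by (intro norm2_mult_le_right norm2_d_entry_le assms)
  show ?thesis unfolding compact_matrix_def
  proof (intro conjI allI impI)
    show "norm2 (d_entry (Suc i) * C i j) \<le> 1" for i j
      using le power_le_one[of "1 / 4 :: real" i] by (rule order_trans) auto
    fix e :: real assume "e > 0"
    then obtain N where N: "(1 / 4) ^ N < e" using real_arch_pow_inv[of e "1 / 4"] by auto
    have "norm2 (d_entry (Suc i) * C i j) \<le> e" if "i \<ge> N" for i j
    proof -
      have "(1 / 4 :: real) ^ i \<le> (1 / 4) ^ N" using that by (intro power_decreasing) auto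
      then show ?thesis using le[of i j] N by linarith
    qed
    then show "\<exists>N. \<forall>i\<ge>N. \<forall>j. norm2 (d_entry (Suc i) * C i j) \<le> e" by blast
  qed
qed

lemma char_series_D_op:
  "char_series S0 M0_norm D_op = fredholm_det (\<lambda>i j. d_entry (Suc i) * (if i = j then 1 else 0))"
proof (rule char_series_eq[where r = Suc])
  show "compact_matrix (\<lambda>i j. d_entry (Suc i) * (if i = j then 1 else 0))"
    by (rule compact_matrix_scale_rows) auto
  fix a
  have "(\<Sum>j<Suc i. d_entry (Suc i) * (if i = j then 1 else 0) * a j) = d_entry (Suc i) * a i" for i
    by (simp add: sum.If_cases)
  moreover have "(\<lambda>j. d_entry j * (case_nat 0 a :: nat \<Rightarrow> Q2) j) = case_nat 0 (\<lambda>i. d_entry (Suc i) * a i)"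
    by (auto simp: fun_eq_iff split: nat.split)
  ultimately show "D_op (cusp_series a) = cusp_series (\<lambda>i. \<Sum>j<Suc i. d_entry (Suc i) * (if i = j then 1 else 0) * a j)"
    by (simp add: D_op_def cusp_series_def)
qed auto

lemma norm2_le_1_of_near_delta:
  assumes "norm2 (x - (if P then 1 else 0)) \<le> 1 / 2"
  shows "norm2 x \<le> 1"
  using norm2_ultra[of "x - (if P then 1 else 0)" "if P then 1 else 0"] assms
  by (auto simp: max_def split: if_splits)

lemma norm2_char_series_U_op:
  "norm2 (fps_nth (char_series S0 M0_norm U_op) m) = (\<Prod>i<m. norm2 (d_entry (Suc i)))"
proof -
  let ?u = "\<lambda>i j. u_coeff (Suc i) (Suc j) :: Q2"
  define X where "X i j = (a_coeff (Suc i) (Suc j) :: Q2)" for i j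
  define B where "B i j = (b_coeff (Suc i) (Suc j) :: Q2)" for i j
  define Y where "Y i j = d_entry (Suc i) * B i j" for i j
  \<comment> \<open>Column \<open>l\<close> of \<open>X\<close> is 0 from row
    \<open>2 * l + 2\<close> on, so this finite sum is the full entry of the product of
    \<open>B\<close> and \<open>A\<close>.\<close>
  define C where "C k l = (\<Sum>i<2 * l + 2. B k i * X i l)" for k l
  have X: "norm2 (X i j - (if i = j then 1 else 0)) \<le> 1 / 2" for i j
    using norm2_a_coeff[of "Suc j" "Suc i"] by (simp add: X_def)
  have B: "norm2 (B j i - (if i = j then 1 else 0)) \<le> 1 / 2" for i j
    using norm2_b_coeff[of "Suc j" "Suc i"] by (simp add: B_def)
  note X1 = norm2_le_1_of_near_delta[OF X] and B1 = norm2_le_1_of_near_delta[OF B]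
  have B0: "B k k = 1" for k by (simp add: B_def b_coeff_def a_coeff_same del: of_nat_Suc)
  have Xz: "X i l = 0" if "i < l \<or> 2 * l + 2 \<le> i" for i l
    unfolding X_def using that by (intro a_coeff_eq_0) auto
  have Y: "compact_matrix Y" unfolding Y_def[abs_def] by (rule compact_matrix_scale_rows[OF B1])
  have XY: "(\<Sum>k<n. X i k * Y k j) = ?u i j" if "n \<ge> Suc i" for n i j
  proof -
    have "?u i j = (\<Sum>k=1..Suc i. a_coeff (Suc i) k * d_entry k * b_coeff k (Suc j))"
      by (rule u_coeff_factorization) auto
    also have "\<dots> = (\<Sum>k<Suc i. X i k * Y k j)"
      by (simp only: One_nat_def sum.atLeast1_atMost_eq X_def Y_def B_def mult.assoc)
    also have "\<dots> = (\<Sum>k<n. X i k * Y k j)"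
      using that by (intro sum.mono_neutral_left) (auto simp: Xz)
    finally show ?thesis ..
  qed
  have YX: "(\<Sum>i<n. Y k i * X i l) = d_entry (Suc k) * C k l" if "n \<ge> 2 * l + 2" for n k l
  proof -
    have "d_entry (Suc k) * C k l = (\<Sum>i<2 * l + 2. Y k i * X i l)"
      unfolding C_def sum_distrib_left Y_def by (simp only: mult.assoc)
    also have "\<dots> = (\<Sum>i<n. Y k i * X i l)"
      using that by (intro sum.mono_neutral_left) (auto simp: Xz)
    finally show ?thesis ..
  qed
  \<comment> \<open>The identity is subtracted at \<open>i = k\<close>, where
    \<open>B k k = 1\<close> leaves an entry of \<open>X\<close> minus the identity; every other
    term has an off-diagonal factor from \<open>B\<close>.\<close>
  have C: "norm2 (C k l - (if k = l then 1 else 0)) \<le> 1 / 2" for k l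
  proof -
    have "(if k = l then 1 else 0 :: Q2) = (\<Sum>i<2 * l + 2. if i = k then if k = l then 1 else 0 else 0)"
      by (simp add: sum.delta)
    then have "C k l - (if k = l then 1 else 0) = (\<Sum>i<2 * l + 2. B k i * X i l - (if i = k then if k = l then 1 else 0 else 0))"
      unfolding C_def by (simp only: sum_subtractf)
    also have "norm2 \<dots> \<le> 1 / 2"
    proof (rule norm2_sum_le)
      fix i
      show "norm2 (B k i * X i l - (if i = k then if k = l then 1 else 0 else 0)) \<le> 1 / 2"
      proof (cases "i = k")
        case True
        then show ?thesis using X[of k l] by (simp add: B0)
      next
        case False
        then have "norm2 (B k i) \<le> 1 / 2" using B[of k i] by simp
        from norm2_mult_le_right[OF this X1] show ?thesis using False by simp
      qed
    qed simp
    finally show ?thesis .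
  qed
  have "compact_matrix ?u"
    unfolding compact_matrix_def
  proof (intro conjI allI impI)
    have Y1: "norm2 (Y i j) \<le> 1" for i j using Y by (simp add: compact_matrix_def)
    show "norm2 (?u i j) \<le> 1" for i j
      unfolding XY[OF order_refl, symmetric] by (intro norm2_sum_le norm2_mult_le_left X1 Y1) auto
    fix e :: real assume e: "e > 0"
    then obtain N where N: "\<And>k j. k \<ge> N \<Longrightarrow> norm2 (Y k j) \<le> e" using Y unfolding compact_matrix_def by blast
    \<comment> \<open>For \<open>k < N\<close> the entry \<open>X i k\<close> is outside the band,
      so these rows meet only rows of \<open>Y\<close> from \<open>N\<close> on.\<close>
    have "norm2 (?u i j) \<le> e" if "i \<ge> 2 * N + 2" for i j
      unfolding XY[OF order_refl, symmetric]
    proof (rule norm2_sum_le)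
      fix k
      show "norm2 (X i k * Y k j) \<le> e"
      proof (cases "k \<ge> N")
        case True
        then show ?thesis by (intro norm2_mult_le_left X1 N)
      next
        case False
        then show ?thesis using that e by (simp add: Xz)
      qed
    qed (use e in simp)
    then show "\<exists>N. \<forall>i\<ge>N. \<forall>j. norm2 (?u i j) \<le> e" by blast
  qed
  moreover have "?u i j = 0" if "j \<ge> 2 * i + 2" for i j
    using that by (intro u_coeff_eq_0) auto
  ultimately have "char_series S0 M0_norm U_op = fredholm_det ?u"
    by (rule char_series_eq[where r = "\<lambda>i. 2 * i + 2"]) (assumption, rule U_op_cusp_series)
  also have "\<dots> = fredholm_det (\<lambda>k l. d_entry (Suc k) * C k l)"
  proof (rule fredholm_det_commute[of X Y])
    show "(\<lambda>i. X i j) \<longlonglongrightarrow> 0" for j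
      by (intro Lim_transform_eventually[OF tendsto_const] eventually_mono[OF eventually_ge_at_top[of "2 * j + 2"]]) (simp add: Xz)
    show "(\<lambda>n. \<Sum>k<n. X i k * Y k j) \<longlonglongrightarrow> ?u i j" for i j
      by (intro Lim_transform_eventually[OF tendsto_const] eventually_mono[OF eventually_ge_at_top[of "Suc i"]]) (simp only: XY)
    show "(\<lambda>n. \<Sum>i<n. Y k i * X i l) \<longlonglongrightarrow> d_entry (Suc k) * C k l" for k l
      by (intro Lim_transform_eventually[OF tendsto_const] eventually_mono[OF eventually_ge_at_top[of "2 * l + 2"]]) (simp only: YX)
  qed (rule X1 Y)+
  finally show ?thesis
    using norm2_fredholm_coeff[of "\<lambda>i. d_entry (Suc i)" C m] d_entry_nonzero norm2_d_entry_less
      compact_matrix_scale_rows[OF norm2_le_1_of_near_delta[OF C]] C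
    by simp
qed

theorem theorem2:
  shows "newton_polygon (char_series S0 M0_norm U_op) = newton_polygon (char_series S0 M0_norm D_op)"
proof (rule newton_polygon_cong)
  fix m
  have "norm2 (fps_nth (char_series S0 M0_norm D_op) m) = (\<Prod>i<m. norm2 (d_entry (Suc i)))"
    unfolding char_series_D_op
    by (intro norm2_fredholm_coeff compact_matrix_scale_rows) (auto simp: d_entry_nonzero norm2_d_entry_less)
  then show "norm2 (fps_nth (char_series S0 M0_norm U_op) m) = norm2 (fps_nth (char_series S0 M0_norm D_op) m)"
    by (simp add: norm2_char_series_U_op)
qed

end
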